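(* Let $Q=(-10,10)^n\times(0,10]$, $J_1=(-1,1)^n\times(0,\tfrac12]$ and $J_3=(-\tfrac12,\tfrac12)^n\times(\tfrac14,\tfrac12]$. Let $q>n+2$, $p_1<p\le q$, $f\in L^p_+(Q)$ and $\mu\in L^q_+(Q)$, and let $\beta_0>0$ be the constant fixed in the context (depending only on $n,\Lambda,\lambda,p,q,\|\mu\|_{L^q(Q)}$). Then for every $\varepsilon_0\in(0,\beta_0)$ there exists a constant $C_3=C_3(n,\Lambda,\lambda,p,q,\|\mu\|_{L^q(Q)},\varepsilon_0)>0$ such that every $L^p$-viscosity subsolution $u\in C(Q)$ of $$u_t+\mathcal P^-(D^2u)-\mu|Du|-f=0\quad\text{in }Q$$ satisfies $$\sup_{J_3}u\le C_3\left(\|u^+\|_{L^{\varepsilon_0}(J_1)}+\|f\|_{L^p(Q)}\right).$$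
   Context: Fix $n\in\mathbb N$ and constants $0<\lambda\le\Lambda<\infty$. $\mathbb S^n$ is the set of real symmetric $n\times n$ matrices with the usual order. The Pucci operators are $\mathcal P^+(X)=\max\{-\mathrm{Tr}(AX): A\in\mathbb S^n,\ \lambda I\le A\le\Lambda I\}$ and $\mathcal P^-(X)=\min\{-\mathrm{Tr}(AX): A\in\mathbb S^n,\ \lambda I\le A\le\Lambda I\}$ for $X\in\mathbb S^n$. $Du$, $D^2u$ are the first and second derivatives in the space variable $x$, $u_t$ is the time derivative, $u^+=\max\{u,0\}$, and $\|g\|_{L^{\varepsilon_0}(J_1)}=(\int_{J_1}|g|^{\varepsilon_0}dx\,dt)^{1/\varepsilon_0}$ also for $\varepsilon_0<1$. $L^p_+(Q)$ is the set of nonnegative functions in $L^p(Q)$. For $Q=\Omega\times(0,T]$ the parabolic boundary is $\partial_pQ=(\Omega\times\{0\})\cup(\partial\Omega\times[0,T))$. The parabolic distance is $d((x,t),(y,s))=\sqrt{|x-y|^2+|t-s|}$, and $Q'\Subset Q$ means that the parabolic distance from $Q'$ to $\partial_pQ$ is positive. $W^{2,1}_p(Q)$ is the set of $f\in L^p(Q)$ with weak derivatives $f_t,f_{x_k},f_{x_kx_\ell}\in L^p(Q)$, with norm the sum of the $L^p$ norms of $f$ and of these derivatives; $W^{2,1}_{p,\mathrm{loc}}(Q)$ consists of functions in $W^{2,1}_p(Q')$ for all $Q'\Subset Q$. Set $Q_r(x,t)=(x,t)+(-r,r)^n\times(-r^2,0]$. $L^p$-viscosity sub/supersolutions: $u\in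 C(Q)$ is an $L^p$-viscosity subsolution (resp. supersolution) of $u_t+F(x,t,Du,D^2u)=0$ in $Q$ if for every $\phi\in W^{2,1}_{p,\mathrm{loc}}(Q)$ and every $(x,t)\in Q$ such that $u-\phi$ attains a maximum (resp. minimum) at $(x,t)$ over some cylinder $Q_r(x,t)\subset Q$, one has $\lim_{\varepsilon\to0}\operatorname{ess\,inf}_{(y,s)\in Q_\varepsilon(x,t)}\{\phi_t+F(y,s,D\phi,D^2\phi)\}\le0$ (resp. $\lim_{\varepsilon\to0}\operatorname{ess\,sup}_{(y,s)\in Q_\varepsilon(x,t)}\{\phi_t+F(y,s,D\phi,D^2\phi)\}\ge0$). $p_1=p_1(n,\Lambda/\lambda)\in[\frac{n+2}2,n+1)$ is the constant giving the range $p>p_1$ of exponents for which the Aleksandrov-Bakelman-Pucci maximum principle holds, i.e. for every $p>p_1$ there is $C=C(n,\Lambda,\lambda,p)$ such that, with $Q^*=\{|x|<1\}\times(0,1]$, for every $f\in L^p(Q^* )$ there is $u\in C(\overline{Q^*})\cap W^{2,1}_{p,\mathrm{loc}}(Q^* )$ with $u_t+\mathcal P^+(D^2u)=f$ a.e. in $Q^*$, $u=0$ on $\partial_pQ^*$, $-C\|f^-\|_{L^p(Q^* )}\le u\le C\|f^+\|_{L^p(Q^* )}$, and $\|u\|_{W^{2,1}_p(Q')}\le C'\|f\|_{L^p(Q^* )}$ for every $Q'\Subset Q^*$, where $C'$ depends only on $n,\Lambda,\lambda,p$ and the distance of $Q'$ to $\partial_pQ^*$. The constant $\beta_0$: with $J_2=(-1,1)^n\times(9,10]$,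 there exist constants $A_0,\beta_0,\varepsilon_1>0$ depending only on $n,\Lambda,\lambda,p,q,\|\mu\|_{L^q(Q)}$ such that for all $\hat\mu\in L^q_+(Q)$ with $\|\hat\mu\|_{L^q(Q)}\le\|\mu\|_{L^q(Q)}$ and all $\hat f\in L^p_+(Q)$ with $\|\hat f\|_{L^p(Q)}\le\varepsilon_1$, every nonnegative $L^p$-viscosity supersolution $w\in C(Q)$ of $w_t+\mathcal P^+(D^2w)+\hat\mu|Dw|+\hat f=0$ in $Q$ with $\inf_{J_2}w\le1$ satisfies $|\{(x,t)\in J_1: w(x,t)\ge s\}|\le A_0s^{-\beta_0}$ for all $s>0$. Fix such constants. *)

theory Defs
  imports "HOL-Analysis.Analysis" "HOL-Probability.Essential_Supremum"
begin

text \<open>Points of space-time are pairs \<open>(x, t)\<close> of type \<open>(real ^ 'n) \<times> real\<close>; the dimension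
  \<open>n\<close> is \<open>CARD('n)\<close>.\<close>

subsection \<open>Pucci operators\<close>

definition loewner_le :: "real ^ 'n ^ 'n \<Rightarrow> real ^ 'n ^ 'n \<Rightarrow> bool" where
  "loewner_le A B \<longleftrightarrow> (\<forall>\<xi>. \<xi> \<bullet> (A *v \<xi>) \<le> \<xi> \<bullet> (B *v \<xi>))"

definition elliptic_matrices :: "real \<Rightarrow> real \<Rightarrow> (real ^ 'n ^ 'n) set" where
  "elliptic_matrices lam Lam =
     {A. transpose A = A \<and> loewner_le (mat lam) A \<and> loewner_le A (mat Lam)}"

text \<open>For \<open>lam \<le> Lam\<close> the set of elliptic matrices is compact and nonempty, so the supremum and
  infimum below are attained.\<close>

definition pucci_plus :: "real \<Rightarrow> real \<Rightarrow> real ^ 'n ^ 'n \<Rightarrow> real" where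
  "pucci_plus lam Lam X = (SUP A\<in>elliptic_matrices lam Lam. - trace (A ** X))"

definition pucci_minus :: "real \<Rightarrow> real \<Rightarrow> real ^ 'n ^ 'n \<Rightarrow> real" where
  "pucci_minus lam Lam X = (INF A\<in>elliptic_matrices lam Lam. - trace (A ** X))"

subsection \<open>Lebesgue spaces\<close>

text \<open>The (quasi-)norm takes the value \<open>\<infinity>\<close> when the integral diverges.\<close>

definition Lp_norm :: "real \<Rightarrow> 'a::euclidean_space set \<Rightarrow> ('a \<Rightarrow> real) \<Rightarrow> ennreal" where
  "Lp_norm p S g =
     (let I = (\<integral>\<^sup>+ z. ennreal (\<bar>g z\<bar> powr p) \<partial>lebesgue_on S)
      in if I = \<infinity> then \<infinity> else ennreal (enn2real I powr (1 / p)))"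

definition Lp_space :: "real \<Rightarrow> 'a::euclidean_space set \<Rightarrow> ('a \<Rightarrow> real) set" where
  "Lp_space p S = {g. g \<in> borel_measurable (lebesgue_on S) \<and> Lp_norm p S g < \<infinity>}"

definition Lp_nonneg :: "real \<Rightarrow> 'a::euclidean_space set \<Rightarrow> ('a \<Rightarrow> real) set" where
  "Lp_nonneg p S = {g \<in> Lp_space p S. AE z in lebesgue_on S. 0 \<le> g z}"

subsection \<open>Parabolic geometry\<close>

definition cube :: "real \<Rightarrow> (real ^ 'n) set" where
  "cube r = {x. \<forall>i. - r < x $ i \<and> x $ i < r}"

definition pcyl :: "(real ^ 'n) set \<Rightarrow> real \<Rightarrow> ((real ^ 'n) \<times> real) set" where
  "pcyl \<Omega> T = \<Omega> \<times> {0<..T}"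

definition pboundary :: "(real ^ 'n) set \<Rightarrow> real \<Rightarrow> ((real ^ 'n) \<times> real) set" where
  "pboundary \<Omega> T = (\<Omega> \<times> {0}) \<union> (frontier \<Omega> \<times> {0..<T})"

definition pdist :: "(real ^ 'n) \<times> real \<Rightarrow> (real ^ 'n) \<times> real \<Rightarrow> real" where
  "pdist z w = sqrt ((norm (fst z - fst w))\<^sup>2 + \<bar>snd z - snd w\<bar>)"

definition pdist_set :: "((real ^ 'n) \<times> real) set \<Rightarrow> ((real ^ 'n) \<times> real) set \<Rightarrow> ereal" where
  "pdist_set A B = (INF z\<in>A. INF w\<in>B. ereal (pdist z w))"

definition pcompactly_in :: "((real ^ 'n) \<times> real) set \<Rightarrow> (real ^ 'n) set \<Rightarrow> real \<Rightarrow> bool" where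
  "pcompactly_in Q' \<Omega> T \<longleftrightarrow>
     Q' \<in> sets lebesgue \<and> Q' \<subseteq> pcyl \<Omega> T \<and> 0 < pdist_set Q' (pboundary \<Omega> T)"

definition Qr :: "real \<Rightarrow> (real ^ 'n) \<times> real \<Rightarrow> ((real ^ 'n) \<times> real) set" where
  "Qr r z = (\<lambda>w. z + w) ` (cube r \<times> {- (r\<^sup>2)<..0})"

subsection \<open>Weak derivatives and parabolic Sobolev spaces\<close>

primrec Ck :: "nat \<Rightarrow> ('a::euclidean_space \<Rightarrow> real) \<Rightarrow> bool" where
  "Ck 0 \<psi> \<longleftrightarrow> continuous_on UNIV \<psi>"
| "Ck (Suc k) \<psi> \<longleftrightarrow> (\<forall>z. \<psi> differentiable (at z)) \<and>
     (\<forall>e\<in>Basis. Ck k (\<lambda>z. frechet_derivative \<psi> (at z) e))"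

definition test_functions :: "'a::euclidean_space set \<Rightarrow> ('a \<Rightarrow> real) set" where
  "test_functions U =
     {\<psi>. (\<forall>k. Ck k \<psi>) \<and> compact (closure {z. \<psi> z \<noteq> 0}) \<and> closure {z. \<psi> z \<noteq> 0} \<subseteq> U}"

text \<open>\<open>g\<close> is the weak derivative of \<open>f\<close> in direction \<open>e\<close> on the open set \<open>U\<close>. Only used for
  \<open>f\<close> and \<open>g\<close> in some \<open>L\<^sup>p\<close> with \<open>p \<ge> 1\<close>, so that both integrands are integrable.\<close>

definition weak_deriv :: "'a::euclidean_space set \<Rightarrow> 'a \<Rightarrow> ('a \<Rightarrow> real) \<Rightarrow> ('a \<Rightarrow> real) \<Rightarrow> bool" where
  "weak_deriv U e f g \<longleftrightarrow>
     (\<forall>\<psi>\<in>test_functions U.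
        (LINT z|lebesgue_on U. f z * frechet_derivative \<psi> (at z) e) =
        - (LINT z|lebesgue_on U. g z * \<psi> z))"

text \<open>\<open>W21 p S f ft Df D2f\<close> states that \<open>f\<close> is in \<open>W\<^sup>2\<^sup>,\<^sup>1\<^sub>p(S)\<close> with weak derivatives \<open>ft\<close>
  (time), \<open>Df\<close> (spatial gradient) and \<open>D2f\<close> (spatial Hessian). Sets such as \<open>\<Omega> \<times> (0,T]\<close> are
  not open, so test functions are supported in the interior.\<close>

definition W21 :: "real \<Rightarrow> ((real ^ 'n) \<times> real) set \<Rightarrow> ((real ^ 'n) \<times> real \<Rightarrow> real) \<Rightarrow>
    ((real ^ 'n) \<times> real \<Rightarrow> real) \<Rightarrow> ((real ^ 'n) \<times> real \<Rightarrow> real ^ 'n) \<Rightarrow>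
    ((real ^ 'n) \<times> real \<Rightarrow> real ^ 'n ^ 'n) \<Rightarrow> bool" where
  "W21 p S f ft Df D2f \<longleftrightarrow>
     f \<in> Lp_space p S \<and> ft \<in> Lp_space p S \<and>
     (\<forall>k. (\<lambda>z. Df z $ k) \<in> Lp_space p S) \<and>
     (\<forall>k l. (\<lambda>z. D2f z $ k $ l) \<in> Lp_space p S) \<and>
     weak_deriv (interior S) (0, 1) f ft \<and>
     (\<forall>k. weak_deriv (interior S) (axis k 1, 0) f (\<lambda>z. Df z $ k)) \<and>
     (\<forall>k l. weak_deriv (interior S) (axis l 1, 0) (\<lambda>z. Df z $ k) (\<lambda>z. D2f z $ k $ l))"

definition W21_norm :: "real \<Rightarrow> ((real ^ 'n) \<times> real) set \<Rightarrow> ((real ^ 'n) \<times> real \<Rightarrow> real) \<Rightarrow>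
    ((real ^ 'n) \<times> real \<Rightarrow> real) \<Rightarrow> ((real ^ 'n) \<times> real \<Rightarrow> real ^ 'n) \<Rightarrow>
    ((real ^ 'n) \<times> real \<Rightarrow> real ^ 'n ^ 'n) \<Rightarrow> ennreal" where
  "W21_norm p S f ft Df D2f =
     Lp_norm p S f + Lp_norm p S ft + (\<Sum>k\<in>UNIV. Lp_norm p S (\<lambda>z. Df z $ k)) +
     (\<Sum>k\<in>UNIV. \<Sum>l\<in>UNIV. Lp_norm p S (\<lambda>z. D2f z $ k $ l))"

definition W21_loc :: "real \<Rightarrow> (real ^ 'n) set \<Rightarrow> real \<Rightarrow> ((real ^ 'n) \<times> real \<Rightarrow> real) \<Rightarrow>
    ((real ^ 'n) \<times> real \<Rightarrow> real) \<Rightarrow> ((real ^ 'n) \<times> real \<Rightarrow> real ^ 'n) \<Rightarrow>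
    ((real ^ 'n) \<times> real \<Rightarrow> real ^ 'n ^ 'n) \<Rightarrow> bool" where
  "W21_loc p \<Omega> T f ft Df D2f \<longleftrightarrow> (\<forall>Q'. pcompactly_in Q' \<Omega> T \<longrightarrow> W21 p Q' f ft Df D2f)"

subsection \<open>Viscosity solutions\<close>

definition esssup_on :: "'a::euclidean_space set \<Rightarrow> ('a \<Rightarrow> real) \<Rightarrow> ereal" where
  "esssup_on S g = esssup (lebesgue_on S) (\<lambda>z. ereal (g z))"

definition essinf_on :: "'a::euclidean_space set \<Rightarrow> ('a \<Rightarrow> real) \<Rightarrow> ereal" where
  "essinf_on S g = - esssup (lebesgue_on S) (\<lambda>z. - ereal (g z))"

text \<open>In both definitions \<open>continuous_on (pcyl \<Omega> T) \<phi>\<close> selects the continuous representative of the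
  Sobolev function \<open>\<phi>\<close>, which exists for \<open>p > (n + 2) / 2\<close>; the pointwise condition on \<open>u - \<phi>\<close>
  is meaningful only for it. The limits exist by monotonicity in \<open>\<epsilon>\<close>.\<close>

definition Lp_visc_subsol :: "real \<Rightarrow> (real ^ 'n) set \<Rightarrow> real \<Rightarrow>
    ((real ^ 'n) \<times> real \<Rightarrow> real ^ 'n \<Rightarrow> real ^ 'n ^ 'n \<Rightarrow> real) \<Rightarrow>
    ((real ^ 'n) \<times> real \<Rightarrow> real) \<Rightarrow> bool" where
  "Lp_visc_subsol p \<Omega> T F u \<longleftrightarrow>
     continuous_on (pcyl \<Omega> T) u \<and>
     (\<forall>\<phi> \<phi>t D\<phi> D2\<phi>. continuous_on (pcyl \<Omega> T) \<phi> \<and> W21_loc p \<Omega> T \<phi> \<phi>t D\<phi> D2\<phi> \<longrightarrow>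
       (\<forall>z\<in>pcyl \<Omega> T.
         (\<exists>r>0. Qr r z \<subseteq> pcyl \<Omega> T \<and> (\<forall>w\<in>Qr r z. u w - \<phi> w \<le> u z - \<phi> z)) \<longrightarrow>
         Lim (at_right 0) (\<lambda>\<epsilon>. essinf_on (Qr \<epsilon> z) (\<lambda>w. \<phi>t w + F w (D\<phi> w) (D2\<phi> w))) \<le> 0))"

definition Lp_visc_supersol :: "real \<Rightarrow> (real ^ 'n) set \<Rightarrow> real \<Rightarrow>
    ((real ^ 'n) \<times> real \<Rightarrow> real ^ 'n \<Rightarrow> real ^ 'n ^ 'n \<Rightarrow> real) \<Rightarrow>
    ((real ^ 'n) \<times> real \<Rightarrow> real) \<Rightarrow> bool" where
  "Lp_visc_supersol p \<Omega> T F u \<longleftrightarrow>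
     continuous_on (pcyl \<Omega> T) u \<and>
     (\<forall>\<phi> \<phi>t D\<phi> D2\<phi>. continuous_on (pcyl \<Omega> T) \<phi> \<and> W21_loc p \<Omega> T \<phi> \<phi>t D\<phi> D2\<phi> \<longrightarrow>
       (\<forall>z\<in>pcyl \<Omega> T.
         (\<exists>r>0. Qr r z \<subseteq> pcyl \<Omega> T \<and> (\<forall>w\<in>Qr r z. u z - \<phi> z \<le> u w - \<phi> w)) \<longrightarrow>
         0 \<le> Lim (at_right 0) (\<lambda>\<epsilon>. esssup_on (Qr \<epsilon> z) (\<lambda>w. \<phi>t w + F w (D\<phi> w) (D2\<phi> w)))))"

subsection \<open>The exponent range of the maximum principle\<close>

text \<open>\<open>C'\<close> is a function of the parabolic distance of \<open>Q'\<close> to the parabolic boundary.\<close>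

definition ABP_exponent :: "'n::finite itself \<Rightarrow> real \<Rightarrow> real \<Rightarrow> real \<Rightarrow> bool" where
  "ABP_exponent _ lam Lam p1 \<longleftrightarrow>
     (real CARD('n) + 2) / 2 \<le> p1 \<and> p1 < real CARD('n) + 1 \<and>
     (\<forall>p>p1. \<exists>C>0. \<exists>C' :: ereal \<Rightarrow> real.
        \<forall>f \<in> Lp_space p (pcyl (ball (0 :: real ^ 'n) 1) 1).
          \<exists>u ut Du D2u.
            continuous_on (closure (pcyl (ball 0 1) 1)) u \<and>
            W21_loc p (ball 0 1) 1 u ut Du D2u \<and>
            (AE z in lebesgue_on (pcyl (ball 0 1) 1). ut z + pucci_plus lam Lam (D2u z) = f z) \<and>
            (\<forall>z\<in>pboundary (ball 0 1) 1. u z = 0) \<and>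
            (\<forall>z\<in>pcyl (ball 0 1) 1.
               - C * enn2real (Lp_norm p (pcyl (ball 0 1) 1) (\<lambda>w. max (- f w) 0)) \<le> u z \<and>
               u z \<le> C * enn2real (Lp_norm p (pcyl (ball 0 1) 1) (\<lambda>w. max (f w) 0))) \<and>
            (\<forall>Q'. pcompactly_in Q' (ball 0 1) 1 \<longrightarrow>
               W21_norm p Q' u ut Du D2u
                 \<le> ennreal (C' (pdist_set Q' (pboundary (ball 0 1) 1))) *
                   Lp_norm p (pcyl (ball 0 1) 1) f))"

subsection \<open>The fixed sets and the decay constants\<close>

definition Q :: "((real ^ 'n) \<times> real) set" where
  "Q = pcyl (cube 10) 10"

definition J1 :: "((real ^ 'n) \<times> real) set" where
  "J1 = cube 1 \<times> {0<..1/2}"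

definition J2 :: "((real ^ 'n) \<times> real) set" where
  "J2 = cube 1 \<times> {9<..10}"

definition J3 :: "((real ^ 'n) \<times> real) set" where
  "J3 = cube (1/2) \<times> {1/4<..1/2}"

text \<open>\<open>M\<close> stands for the norm of \<open>\<mu>\<close> in \<open>L\<^sup>q(Q)\<close>, the only datum of \<open>\<mu>\<close> on which the constants
  \<open>A0\<close>, \<open>\<beta>0\<close> and \<open>\<epsilon>1\<close> depend.\<close>

definition decay_constants :: "'n::finite itself \<Rightarrow> real \<Rightarrow> real \<Rightarrow> real \<Rightarrow> real \<Rightarrow> real \<Rightarrow>
    real \<Rightarrow> real \<Rightarrow> real \<Rightarrow> bool" where
  "decay_constants _ lam Lam p q M A0 \<beta>0 \<epsilon>1 \<longleftrightarrow>
     0 < A0 \<and> 0 < \<beta>0 \<and> 0 < \<epsilon>1 \<and>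
     (\<forall>(\<mu> :: (real ^ 'n) \<times> real \<Rightarrow> real) f w.
        \<mu> \<in> Lp_nonneg q Q \<and> Lp_norm q Q \<mu> \<le> ennreal M \<and>
        f \<in> Lp_nonneg p Q \<and> Lp_norm p Q f \<le> ennreal \<epsilon>1 \<and>
        Lp_visc_supersol p (cube 10) 10
          (\<lambda>z \<xi> X. pucci_plus lam Lam X + \<mu> z * norm \<xi> + f z) w \<and>
        (\<forall>z\<in>Q. 0 \<le> w z) \<and> (INF z\<in>J2. w z) \<le> 1 \<longrightarrow>
        (\<forall>s>0. measure lebesgue {z\<in>J1. s \<le> w z} \<le> A0 * s powr (- \<beta>0)))"

end

theory Submission
  imports Defs "HOL-Real_Asymp.Real_Asymp"
begin

text \<open>Blow-up argument. Suppose that \<open>u > C S\<close> at a point of \<open>J3\<close>, where \<open>S\<close> bounds the two norms on the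
  right-hand side. Given a point where \<open>u \<ge> H\<close>, look at the backward parabolic cylinder of size \<open>r\<close> below
  it. If \<open>u \<le> \<nu> H\<close> there, for a fixed \<open>\<nu> > 1\<close> close to 1, then \<open>\<nu> H - u\<close>, normalised and rescaled to \<open>Q\<close>,
  is a supersolution to which the decay estimate applies; hence \<open>u > H / 2\<close> on at least half of the
  rescaled copy of \<open>J1\<close>. Chebyshev's inequality for the \<open>\<epsilon>0\<close>-norm bounds the measure of that set by
  \<open>(2 S / H)\<close> to the power \<open>\<epsilon>0\<close>, a contradiction as soon as \<open>r\<close> to the power \<open>n + 2\<close> is a large multiple
  of this. So \<open>u > \<nu> H\<close> somewhere in the cylinder, and the step can be repeated with \<open>\<nu> H\<close>. The radii
  decay geometrically, the points stay in a compact subset of \<open>Q\<close>, and the values of \<open>u\<close> tend to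
  infinity, contradicting continuity. Scaling preserves the hypotheses because \<open>q > n + 2\<close> and
  \<open>p > (n + 2) / 2\<close>.\<close>

section \<open>Smooth functions and cutoffs\<close>

text \<open>The test functions of the viscosity definition live on all of \<open>Q\<close>, and this
  shapes the proof. A test function for the rescaled supersolution, transported back, is defined
  only over the small cylinder, while the subsolution property of \<open>u\<close> asks for a
  function on \<open>Q\<close>. A cutoff cures this at the sides and the bottom but not at the top
  face, which in general lies strictly inside \<open>Q\<close>; there the function is reflected in
  time, and weak differentiability across the face has to be proved.

  The constants are tied together as follows. The decay estimate gives the half-measure statement
  once the threshold \<open>(\<nu> - 1/2) / (\<nu> - 1)\<close> is large, which fixes
  \<open>\<nu>\<close>. At level \<open>\<nu> ^ k\<close> Chebyshev's bound decays like
  \<open>\<nu> powr (- \<epsilon>0 * k)\<close>, whereas a cylinder of size \<open>r\<close> has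
  measure proportional to \<open>r ^ (n + 2)\<close>; so the radii shrink by the ratio
  \<open>\<nu> powr (- \<epsilon>0 / (n + 2))\<close>. The initial radius is fixed by the total
  drift allowed to the points, and \<open>C\<close> only afterwards, by the comparison at level 0
  and by the smallness of the source.\<close>

abbreviation pd :: "('a::euclidean_space \<Rightarrow> real) \<Rightarrow> 'a \<Rightarrow> 'a \<Rightarrow> real" where
  "pd f e z \<equiv> frechet_derivative f (at z) e"

definition smooth :: "('a::euclidean_space \<Rightarrow> real) \<Rightarrow> bool" where
  "smooth f \<longleftrightarrow> (\<forall>k. Ck k f)"

lemma pd_eqI: "(f has_derivative f') (at z) \<Longrightarrow> pd f e z = f' e"
  using frechet_derivative_at by metis

lemma pd_add:
  assumes "f differentiable at z" "g differentiable at z"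
  shows "pd (\<lambda>x. f x + g x) e z = pd f e z + pd g e z"
  using assms[THEN frechet_derivative_works[THEN iffD1]] by (intro pd_eqI has_derivative_add)

lemma pd_mult:
  assumes "f differentiable at z" "g differentiable at z"
  shows "pd (\<lambda>x. f x * g x) e z = f z * pd g e z + pd f e z * g z"
  using assms[THEN frechet_derivative_works[THEN iffD1]] by (intro pd_eqI has_derivative_mult)

lemma pd_compose:
  assumes "f differentiable at (A z)" "(A has_derivative L) (at z)"
  shows "pd (\<lambda>x. f (A x)) e z = pd f (L e) (A z)"
  using assms by (intro pd_eqI[OF has_derivative_compose]) (auto simp: frechet_derivative_works[symmetric])

lemma linear_pd: "f differentiable at z \<Longrightarrow> linear (\<lambda>e. pd f e z)"
  by (metis linear_frechet_derivative)

lemma Ck_continuous: "Ck k f \<Longrightarrow> continuous_on UNIV f"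
  by (cases k) (auto simp: continuous_on_eq_continuous_at differentiable_imp_continuous_within)

lemma Ck_SucD: "Ck (Suc k) f \<Longrightarrow> Ck k f"
proof (induction k arbitrary: f)
  case 0
  then show ?case using Ck_continuous Ck.simps(1) by blast
qed simp

lemma Ck_const: "Ck k (\<lambda>x. c)"
  by (induction k arbitrary: c) (auto intro: continuous_intros)

lemma Ck_add: "Ck k f \<Longrightarrow> Ck k g \<Longrightarrow> Ck k (\<lambda>x. f x + g x)"
proof (induction k arbitrary: f g)
  case 0
  then show ?case by (auto intro: continuous_intros)
next
  case (Suc k)
  then show ?case by (auto simp: pd_add)
qed

lemma Ck_sum: "(\<And>i. i \<in> I \<Longrightarrow> Ck k (f i)) \<Longrightarrow> Ck k (\<lambda>x. \<Sum>i\<in>I. f i x)"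
  by (induction I rule: infinite_finite_induct) (auto simp: Ck_const Ck_add)

lemma Ck_mult: "Ck k f \<Longrightarrow> Ck k g \<Longrightarrow> Ck k (\<lambda>x. f x * g x)"
proof (induction k arbitrary: f g)
  case 0
  then show ?case by (auto intro: continuous_intros)
next
  case (Suc k)
  then show ?case using Suc.prems[THEN Ck_SucD] by (auto simp: pd_mult intro!: Ck_add)
qed

lemma Ck_prod: "(\<And>i. i \<in> I \<Longrightarrow> Ck k (f i)) \<Longrightarrow> Ck k (\<lambda>x. \<Prod>i\<in>I. f i x)"
  by (induction I rule: infinite_finite_induct) (auto simp: Ck_const Ck_mult)

text \<open>The derivative of \<open>1 / f\<close> is \<open>- f' / f^2\<close>, in which
  \<open>1 / f\<close> appears undifferentiated; the induction hypothesis for the same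
  \<open>f\<close> one order lower therefore suffices, together with closure under products.\<close>

lemma Ck_inverse:
  assumes "Ck k f" "\<And>x. f x \<noteq> 0"
  shows "Ck k (\<lambda>x. inverse (f x))"
  using assms
proof (induction k arbitrary: f)
  case 0
  then show ?case by (auto intro: continuous_intros)
next
  case (Suc k)
  have D: "((\<lambda>x. inverse (f x)) has_derivative
      (\<lambda>h. - (inverse (f z) * pd f h z * inverse (f z)))) (at z)" for z
    using Suc.prems by (intro Deriv.has_derivative_inverse) (auto simp: frechet_derivative_works[symmetric])
  have I: "Ck k (\<lambda>x. inverse (f x))"
    using Suc.IH[OF Ck_SucD[OF Suc.prems(1)] Suc.prems(2)] .
  have "Ck k (\<lambda>z. (-1) * (inverse (f z) * pd f e z * inverse (f z)))" if "e \<in> Basis" for e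
    using Suc.prems(1) that by (intro Ck_mult Ck_const I) auto
  then have "Ck k (\<lambda>z. pd (\<lambda>x. inverse (f x)) e z)" if "e \<in> Basis" for e
    using that by (simp add: pd_eqI[OF D])
  then show ?case using D by (auto simp: differentiable_def)
qed

text \<open>\<open>A\<close> has the same derivative \<open>L\<close> at every point, so each
  partial derivative of the composition is a combination, with constant coefficients, of partial
  derivatives of \<open>f\<close> composed with \<open>A\<close>. The induction thus stays within
  compositions with \<open>A\<close>.\<close>

lemma Ck_compose_affine:
  fixes A :: "'a::euclidean_space \<Rightarrow> 'b::euclidean_space"
  assumes "Ck k f" "\<And>z. (A has_derivative L) (at z)"
  shows "Ck k (\<lambda>x. f (A x))"
  using assms(1)
proof (induction k arbitrary: f)
  case 0
  have "continuous_on UNIV A"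
    using assms(2)[THEN has_derivative_continuous] by (simp add: continuous_on_eq_continuous_at)
  then show ?case using 0 continuous_on_compose2[of UNIV f UNIV A] by simp
next
  case (Suc k)
  have "pd f (L e) y = (\<Sum>b\<in>Basis. (L e \<bullet> b) * pd f b y)" for e y
  proof -
    have "pd f (L e) y = pd f (\<Sum>b\<in>Basis. (L e \<bullet> b) *\<^sub>R b) y" by (simp add: euclidean_representation)
    also have "\<dots> = (\<Sum>b\<in>Basis. (L e \<bullet> b) * pd f b y)"
      using Suc.prems linear_pd[of f y] by (simp add: linear_sum linear_cmul)
    finally show ?thesis .
  qed
  then have "pd (\<lambda>x. f (A x)) e z = (\<Sum>b\<in>Basis. (L e \<bullet> b) * pd f b (A z))" for e z
    using Suc.prems by (simp add: pd_compose[OF _ assms(2)])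
  moreover have "Ck k (\<lambda>z. \<Sum>b\<in>Basis. (L e \<bullet> b) * pd f b (A z))" for e
    using Suc by (intro Ck_sum Ck_mult Ck_const) auto
  moreover have "(\<lambda>x. f (A x)) differentiable at z" for z
    using Suc.prems assms(2)[of z] has_derivative_compose frechet_derivative_works
    unfolding differentiable_def Ck.simps by blast
  ultimately show ?case by simp
qed

lemma
  assumes "smooth f"
  shows smooth_differentiable: "f differentiable at z"
    and smooth_pd: "e \<in> Basis \<Longrightarrow> smooth (pd f e)"
    and smooth_continuous: "continuous_on S f"
proof -
  have "Ck (Suc k) f" for k using assms by (auto simp: smooth_def)
  then show "f differentiable at z" "e \<in> Basis \<Longrightarrow> smooth (pd f e)" "continuous_on S f"
    using Ck_continuous[of "Suc 0" f] continuous_on_subset[of UNIV f S] Ck.simps(2)[of _ f] unfolding smooth_def by blast+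
qed

lemma smooth_const: "smooth (\<lambda>x. c)"
  and smooth_add: "smooth f \<Longrightarrow> smooth g \<Longrightarrow> smooth (\<lambda>x. f x + g x)"
  and smooth_mult: "smooth f \<Longrightarrow> smooth g \<Longrightarrow> smooth (\<lambda>x. f x * g x)"
  and smooth_prod: "(\<And>i. i \<in> I \<Longrightarrow> smooth (h i)) \<Longrightarrow> smooth (\<lambda>x. \<Prod>i\<in>I. h i x)"
  and smooth_inverse: "smooth f \<Longrightarrow> (\<And>x. f x \<noteq> 0) \<Longrightarrow> smooth (\<lambda>x. inverse (f x))"
  and smooth_compose_affine: "smooth f' \<Longrightarrow> (\<And>z. (A has_derivative L) (at z)) \<Longrightarrow> smooth (\<lambda>x. f' (A x))"
  unfolding smooth_def by (auto intro: Ck_const Ck_add Ck_mult Ck_prod Ck_inverse Ck_compose_affine)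

text \<open>The functions \<open>x powr (- k) * exp (- 1 / x)\<close>, continued by zero.
  Differentiation maps the family into its own linear span, which is why \<open>k\<close> is kept as
  a parameter: the induction on the order of differentiability runs over all \<open>k\<close> at
  once.\<close>

definition flat_exp :: "nat \<Rightarrow> real \<Rightarrow> real" where
  "flat_exp k x = (if x \<le> 0 then 0 else inverse x ^ k * exp (- inverse x))"

lemma flat_exp_tendsto_0: "(flat_exp k \<longlongrightarrow> 0) (at 0)"
proof (rule filterlim_split_at)
  show "(flat_exp k \<longlongrightarrow> 0) (at_left 0)"
    by (rule tendsto_eventually) (auto simp: eventually_at_filter flat_exp_def)
  have "((\<lambda>x. inverse x ^ k / exp (inverse x)) \<longlongrightarrow> (0::real)) (at_right 0)"
    by (rule filterlim_compose[OF tendsto_power_div_exp_0 filterlim_inverse_at_top_right])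
  then show "(flat_exp k \<longlongrightarrow> 0) (at_right 0)"
    by (rule Lim_transform_eventually)
      (auto simp: eventually_at_filter flat_exp_def exp_minus divide_inverse)
qed

lemma flat_exp_deriv:
  "(flat_exp k has_real_derivative (flat_exp (k + 2) x - k * flat_exp (Suc k) x)) (at x)"
proof -
  consider "x < 0" | "x = 0" | "x > 0" by linarith
  then show ?thesis
  proof cases
    case 1
    have "((\<lambda>x. 0) has_real_derivative 0) (at x)" by simp
    then have "(flat_exp k has_real_derivative 0) (at x)"
      by (rule DERIV_cong_ev[THEN iffD1, rotated 3, OF _])
        (use 1 eventually_nhds_in_open[of "{..<0}" x] in \<open>auto simp: flat_exp_def elim!: eventually_mono\<close>)
    then show ?thesis using 1 by (simp add: flat_exp_def)
  next
    case 2
    \<comment> \<open>The difference quotient of \<open>flat_exp k\<close> at 0 is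
      \<open>flat_exp (Suc k)\<close> itself, so the limit already computed applies.\<close>
    have "((\<lambda>h. (flat_exp k (0 + h) - flat_exp k 0) / h) \<longlongrightarrow> 0) (at 0)"
      using flat_exp_tendsto_0[of "Suc k"]
      by (rule Lim_transform_eventually)
        (auto simp: eventually_at_filter flat_exp_def field_simps)
    then show ?thesis using 2 by (simp add: DERIV_def flat_exp_def)
  next
    case 3
    have "((\<lambda>x. inverse x ^ k * exp (- inverse x)) has_real_derivative
        (flat_exp (k + 2) x - k * flat_exp (Suc k) x)) (at x)"
    proof -
      have "((\<lambda>x. inverse x ^ k) has_real_derivative (- real k * inverse x ^ Suc k)) (at x)"
        using DERIV_power[OF DERIV_inverse[of x], of k] 3 by (cases k) (simp_all add: algebra_simps)
      moreover have "((\<lambda>x. exp (- inverse x)) has_real_derivative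
          exp (- inverse x) * inverse x ^ 2) (at x)"
        using 3 by (auto intro!: derivative_eq_intros simp: power2_eq_square)
      ultimately have "((\<lambda>x. inverse x ^ k * exp (- inverse x)) has_real_derivative
          (- real k * inverse x ^ Suc k) * exp (- inverse x) +
          (exp (- inverse x) * inverse x ^ 2) * inverse x ^ k) (at x)"
        by (rule DERIV_mult)
      then show ?thesis
        using 3 by (simp add: flat_exp_def power_add algebra_simps power2_eq_square)
    qed
    then show ?thesis
      by (rule DERIV_cong_ev[THEN iffD1, rotated 3, OF _])
        (use 3 eventually_nhds_in_open[of "{0<..}" x] in \<open>auto simp: flat_exp_def elim!: eventually_mono\<close>)
  qed
qed

lemma smooth_flat_exp: "smooth (flat_exp k)"
proof -
  have "Ck m (flat_exp k)" for m
  proof (induction m arbitrary: k)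
    case 0
    show ?case using DERIV_isCont[OF flat_exp_deriv[of k]] by (auto simp: continuous_on_eq_continuous_at)
  next
    case (Suc m)
    have D: "(flat_exp k has_derivative
      (\<lambda>h. h * (flat_exp (k + 2) x + (- real k) * flat_exp (Suc k) x))) (at x)" for x
      using flat_exp_deriv[of k x] by (simp add: has_field_derivative_def mult_commute_abs)
    then have "flat_exp k differentiable at x" for x by (auto simp: differentiable_def)
    moreover have "Ck m (\<lambda>x. flat_exp (k + 2) x + (- real k) * flat_exp (Suc k) x)"
      by (intro Ck_add Ck_mult Ck_const Suc.IH)
    ultimately show ?case by (simp add: pd_eqI[OF D])
  qed
  then show ?thesis by (simp add: smooth_def)
qed

text \<open>The standard smooth transition from 0 to 1, rising between 1 and 2.\<close>

definition smooth_step :: "real \<Rightarrow> real" where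
  "smooth_step x = flat_exp 0 (x - 1) * inverse (flat_exp 0 (x - 1) + flat_exp 0 (2 - x))"

lemma smooth_smooth_step: "smooth smooth_step"
proof -
  have 1: "smooth (\<lambda>x. flat_exp 0 (x - 1))"
    by (rule smooth_compose_affine[OF smooth_flat_exp]) (auto intro!: derivative_eq_intros)
  have 2: "smooth (\<lambda>x. flat_exp 0 (2 - x))"
    by (rule smooth_compose_affine[OF smooth_flat_exp, where L = "\<lambda>h. - h"])
      (auto intro!: derivative_eq_intros)
  \<comment> \<open>Every \<open>x\<close> satisfies \<open>x > 1\<close> or \<open>x < 2\<close>,
    so one of the two nonnegative summands is positive.\<close>
  have "flat_exp 0 (x - 1) + flat_exp 0 (2 - x) \<noteq> 0" for x
    by (cases "x \<le> 1"; cases "x \<ge> 2") (auto simp: flat_exp_def add_pos_pos less_imp_neq[symmetric])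
  then show ?thesis unfolding smooth_step_def[abs_def]
    by (intro smooth_mult smooth_inverse smooth_add 1 2)
qed

lemma smooth_step_0: "x \<le> 1 \<Longrightarrow> smooth_step x = 0"
  and smooth_step_1: "x \<ge> 2 \<Longrightarrow> smooth_step x = 1"
  and smooth_step_bounds: "0 \<le> smooth_step x" "smooth_step x \<le> 1"
proof -
  have *: "flat_exp 0 x \<ge> 0" for x by (simp add: flat_exp_def)
  show "x \<le> 1 \<Longrightarrow> smooth_step x = 0" by (simp add: smooth_step_def flat_exp_def)
  show "x \<ge> 2 \<Longrightarrow> smooth_step x = 1" by (simp add: smooth_step_def flat_exp_def)
  show "0 \<le> smooth_step x" by (simp add: smooth_step_def *)
  show "smooth_step x \<le> 1" using *[of "x-1"] *[of "2-x"]
    by (simp add: smooth_step_def divide_inverse[symmetric] divide_le_eq_1 less_le)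
qed

text \<open>One factor for each side in each coordinate: with
  \<open>y = (w - z) \<bullet> b / \<rho>\<close>, the argument \<open>3 - y\<close> is at least 2
  for \<open>y \<le> 1\<close> and at most 1 for \<open>y \<ge> 2\<close>. Hence the plateau is the
  box of half-width \<open>\<rho>\<close>, and the support lies in the box of half-width
  \<open>2 * \<rho>\<close>.\<close>

definition box_cutoff :: "'a::euclidean_space \<Rightarrow> real \<Rightarrow> 'a \<Rightarrow> real" where
  "box_cutoff z \<rho> w =
     (\<Prod>b\<in>Basis. smooth_step (3 - (w - z) \<bullet> b / \<rho>) * smooth_step (3 + (w - z) \<bullet> b / \<rho>))"

lemma smooth_box_cutoff:
  assumes "\<rho> > 0"
  shows "smooth (box_cutoff z \<rho>)"
proof -
  have "smooth (\<lambda>w. smooth_step (3 - (w - z) \<bullet> b / \<rho>))" "smooth (\<lambda>w. smooth_step (3 + (w - z) \<bullet> b / \<rho>))" for b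
    using assms
    by (auto intro!: derivative_eq_intros
        smooth_compose_affine[OF smooth_smooth_step, where A = "\<lambda>w. 3 - (w - z) \<bullet> b / \<rho>" and L = "\<lambda>h. - (h \<bullet> b / \<rho>)"]
        smooth_compose_affine[OF smooth_smooth_step, where A = "\<lambda>w. 3 + (w - z) \<bullet> b / \<rho>" and L = "\<lambda>h. h \<bullet> b / \<rho>"])
  then show ?thesis unfolding box_cutoff_def[abs_def] by (intro smooth_prod smooth_mult)
qed

lemma box_cutoff_1:
  assumes "\<rho> > 0" "\<And>b. b \<in> Basis \<Longrightarrow> \<bar>(w - z) \<bullet> b\<bar> \<le> \<rho>"
  shows "box_cutoff z \<rho> w = 1"
  unfolding box_cutoff_def
proof (rule prod.neutral, rule ballI)
  fix b :: 'a assume "b \<in> Basis"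
  then have "\<bar>(w - z) \<bullet> b\<bar> / \<rho> \<le> 1" using assms by simp
  then have "\<bar>(w - z) \<bullet> b / \<rho>\<bar> \<le> 1" using assms by simp
  then show "smooth_step (3 - (w - z) \<bullet> b / \<rho>) * smooth_step (3 + (w - z) \<bullet> b / \<rho>) = 1"
    by (simp add: smooth_step_1 abs_le_iff del: abs_divide)
qed

lemma box_cutoff_0:
  assumes "\<rho> > 0" "b \<in> Basis" "\<bar>(w - z) \<bullet> b\<bar> \<ge> 2 * \<rho>"
  shows "box_cutoff z \<rho> w = 0"
proof -
  have "\<bar>(w - z) \<bullet> b\<bar> / \<rho> \<ge> 2" using assms by (simp add: field_simps)
  then have "\<bar>(w - z) \<bullet> b / \<rho>\<bar> \<ge> 2" using assms by simp
  then have "smooth_step (3 - (w - z) \<bullet> b / \<rho>) * smooth_step (3 + (w - z) \<bullet> b / \<rho>) = 0"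
    using smooth_step_0 by (cases "(w - z) \<bullet> b / \<rho> \<ge> 2") (auto simp: abs_if split: if_splits)
  then show ?thesis using assms(2) unfolding box_cutoff_def by (intro prod_zero) auto
qed

section \<open>Diagonal affine changes of variables\<close>

text \<open>The form in which \<open>lebesgue_affine_euclidean\<close> gives the change of
  variables. Parabolic dilations and the reflection in time are both of this kind, and
  \<open>daff 0 c\<close> is the linear part.\<close>

definition daff :: "'a::euclidean_space \<Rightarrow> ('a \<Rightarrow> real) \<Rightarrow> 'a \<Rightarrow> 'a" where
  "daff t c x = t + (\<Sum>j\<in>Basis. (c j * (x \<bullet> j)) *\<^sub>R j)"

lemma daff_inner: "j \<in> Basis \<Longrightarrow> daff t c x \<bullet> j = t \<bullet> j + c j * (x \<bullet> j)"
  unfolding daff_def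
  by (simp add: inner_add_left inner_sum_left inner_Basis if_distrib sum.delta cong: if_cong)

lemma has_derivative_daff: "(daff t c has_derivative daff 0 c) (at z)"
proof -
  have "((\<lambda>x. t + (\<Sum>j\<in>Basis. (c j * (x \<bullet> j)) *\<^sub>R j)) has_derivative
      (\<lambda>x. (\<Sum>j\<in>Basis. (c j * (x \<bullet> j)) *\<^sub>R j))) (at z)"
    by (auto intro!: derivative_eq_intros)
  then show ?thesis by (simp add: daff_def[abs_def])
qed

lemma continuous_on_daff: "continuous_on S (daff t c)"
  by (intro continuous_at_imp_continuous_on ballI has_derivative_continuous[OF has_derivative_daff])

lemma daff_0_Basis: "e \<in> Basis \<Longrightarrow> daff 0 c e = c e *\<^sub>R e"
  by (rule euclidean_eqI) (simp add: daff_inner inner_Basis)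

lemma set_nn_integral_lebesgue_on:
  "S \<in> sets lebesgue \<Longrightarrow>
    (\<integral>\<^sup>+ z. f z \<partial>lebesgue_on S) = (\<integral>\<^sup>+ z. f z * indicator S z \<partial>lebesgue)"
  by (subst nn_integral_restrict_space) auto

locale diag_affine =
  fixes t :: "'a::euclidean_space" and c :: "'a \<Rightarrow> real"
  assumes c_nonzero: "\<And>j. j \<in> Basis \<Longrightarrow> c j \<noteq> 0"
begin

abbreviation "T \<equiv> daff t c"
abbreviation "T' \<equiv> daff (- (\<Sum>j\<in>Basis. (t \<bullet> j / c j) *\<^sub>R j)) (\<lambda>j. 1 / c j)"
abbreviation "Jac \<equiv> \<Prod>j\<in>Basis. \<bar>c j\<bar>"

lemma Jac_pos: "0 < Jac"
  using c_nonzero by (intro prod_pos) auto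

lemma T'_inner: "j \<in> Basis \<Longrightarrow> T' x \<bullet> j = (x \<bullet> j - t \<bullet> j) / c j"
  by (simp add: daff_inner inner_sum_left inner_Basis if_distrib sum.delta diff_divide_distrib cong: if_cong)

lemma T'_T [simp]: "T' (T x) = x"
  by (rule euclidean_eqI) (use c_nonzero in \<open>simp add: T'_inner\<close>, simp add: daff_inner c_nonzero)

lemma T_T' [simp]: "T (T' x) = x"
  by (rule euclidean_eqI) (simp add: daff_inner[of _ t] T'_inner c_nonzero)

lemma image_T: "T ` S = T' -` S"
  by (auto simp: image_iff) (metis T_T')

lemma diag_affine_T': "diag_affine (\<lambda>j. 1 / c j)"
  using c_nonzero by unfold_locales auto

lemma measurable_T: "T \<in> lebesgue \<rightarrow>\<^sub>M lebesgue"
  unfolding daff_def[abs_def] by (rule lebesgue_affine_measurable) (rule c_nonzero)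

lemma measurable_T': "T' \<in> lebesgue \<rightarrow>\<^sub>M lebesgue"
  using diag_affine.measurable_T[OF diag_affine_T'] .

lemma lebesgue_eq: "lebesgue = density (distr lebesgue lebesgue T) (\<lambda>_. ennreal Jac)"
  unfolding daff_def[abs_def] by (rule lebesgue_affine_euclidean) (rule c_nonzero)

lemma nn_integral_T:
  assumes "f \<in> borel_measurable lebesgue"
  shows "(\<integral>\<^sup>+x. f x \<partial>lebesgue) = ennreal Jac * (\<integral>\<^sup>+x. f (T x) \<partial>lebesgue)"
proof -
  have "(\<integral>\<^sup>+x. f x \<partial>lebesgue) = (\<integral>\<^sup>+x. f x \<partial>density (distr lebesgue lebesgue T) (\<lambda>_. ennreal Jac))"
    using lebesgue_eq by simp
  also have "\<dots> = (\<integral>\<^sup>+x. ennreal Jac * f x \<partial>distr lebesgue lebesgue T)"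
    using assms by (subst nn_integral_density) (auto simp: measurable_T)
  also have "\<dots> = (\<integral>\<^sup>+x. ennreal Jac * f (T x) \<partial>lebesgue)"
    using assms by (subst nn_integral_distr) (auto simp: measurable_T)
  also have "\<dots> = ennreal Jac * (\<integral>\<^sup>+x. f (T x) \<partial>lebesgue)"
    using measurable_compose[OF measurable_T assms] by (intro nn_integral_cmult)
  finally show ?thesis .
qed

lemma AE_T:
  assumes "AE x in lebesgue. P x"
  shows "AE x in lebesgue. P (T x)"
proof -
  have "AE x in density (distr lebesgue lebesgue T) (\<lambda>_. ennreal Jac). P x"
    by (subst lebesgue_eq[symmetric]) (rule assms)
  then have "AE x in distr lebesgue lebesgue T. P x"
    using Jac_pos by (subst (asm) AE_density) auto
  then show ?thesis by (rule AE_distrD[OF measurable_T])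
qed

lemma borel_measurable_T_iff:
  fixes f :: "'a \<Rightarrow> real"
  shows "(\<lambda>x. f (T x)) \<in> borel_measurable lebesgue \<longleftrightarrow> f \<in> borel_measurable lebesgue"
proof
  assume "(\<lambda>x. f (T x)) \<in> borel_measurable lebesgue"
  from measurable_compose[OF measurable_T' this] show "f \<in> borel_measurable lebesgue" by simp
qed (rule measurable_compose[OF measurable_T])

text \<open>For \<open>f\<close> not measurable both integrals take the default value 0, since
  \<open>f\<close> and its composition with \<open>T\<close> are measurable together. This
  generality matters because \<open>weak_deriv\<close> itself says nothing about measurability or
  integrability.\<close>

lemma integral_T:
  fixes f :: "'a \<Rightarrow> real"
  shows "(LINT x|lebesgue. f x) = Jac * (LINT x|lebesgue. f (T x))"
proof (cases "f \<in> borel_measurable lebesgue")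
  case True
  have "(LINT x|lebesgue. f x) = (LINT x|density (distr lebesgue lebesgue T) (\<lambda>_. ennreal Jac). f x)"
    using lebesgue_eq by simp
  also have "\<dots> = (LINT x|distr lebesgue lebesgue T. Jac * f x)"
    using True Jac_pos by (subst integral_density) (auto simp: measurable_T)
  also have "\<dots> = (LINT x|lebesgue. Jac * f (T x))"
    using True by (subst integral_distr) (auto simp: measurable_T)
  finally show ?thesis by simp
next
  case False
  then have "\<not> integrable lebesgue f" "\<not> integrable lebesgue (\<lambda>x. f (T x))"
    using borel_measurable_T_iff by (auto dest: borel_measurable_integrable)
  then show ?thesis by (simp add: not_integrable_integral_eq)
qed

lemma integrable_T:
  fixes f :: "'a \<Rightarrow> real"
  assumes "integrable lebesgue f"
  shows "integrable lebesgue (\<lambda>x. f (T x))"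
proof -
  have "integrable (density (distr lebesgue lebesgue T) (\<lambda>_. ennreal Jac)) f"
    using assms lebesgue_eq by simp
  then have "integrable (distr lebesgue lebesgue T) (\<lambda>x. Jac * f x)"
    using assms Jac_pos by (subst (asm) integrable_density) (auto simp: measurable_T)
  then have "integrable lebesgue (\<lambda>x. Jac * f (T x))"
    by (rule integrable_distr[OF measurable_T])
  then show ?thesis using c_nonzero by auto
qed

lemma sets_image_T: "S \<in> sets lebesgue \<Longrightarrow> T ` S \<in> sets lebesgue"
  unfolding image_T using measurable_sets[OF measurable_T', of S] by simp

lemma emeasure_image_T:
  assumes "S \<in> sets lebesgue"
  shows "emeasure lebesgue (T ` S) = ennreal Jac * emeasure lebesgue S"
proof -
  have "emeasure lebesgue (T ` S) = (\<integral>\<^sup>+x. indicator (T ` S) x \<partial>lebesgue)"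
    using sets_image_T[OF assms] by simp
  also have "\<dots> = ennreal Jac * (\<integral>\<^sup>+x. indicator (T ` S) (T x) \<partial>lebesgue)"
    using sets_image_T[OF assms] by (intro nn_integral_T) auto
  also have "(\<lambda>x. indicator (T ` S) (T x) :: ennreal) = indicator S"
    by (auto simp: fun_eq_iff indicator_def image_T)
  finally show ?thesis using assms by simp
qed

lemma measure_image_T:
  assumes "S \<in> sets lebesgue"
  shows "measure lebesgue (T ` S) = Jac * measure lebesgue S"
  using Jac_pos unfolding measure_def emeasure_image_T[OF assms] by (simp add: enn2real_mult)

lemma measurable_T_lebesgue_on:
  assumes "S \<in> sets lebesgue" "S' \<in> sets lebesgue" "\<And>x. x \<in> S \<Longrightarrow> T x \<in> S'"
  shows "T \<in> lebesgue_on S \<rightarrow>\<^sub>M lebesgue_on S'"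
  using assms measurable_T
  by (intro measurable_restrict_space2) (auto simp: space_restrict_space intro: measurable_restrict_space1)

lemma AE_T_lebesgue_on:
  assumes "S \<in> sets lebesgue" "S' \<in> sets lebesgue" "\<And>x. x \<in> S \<Longrightarrow> T x \<in> S'"
    and "AE x in lebesgue_on S'. P x"
  shows "AE x in lebesgue_on S. P (T x)"
proof -
  have "AE x in lebesgue. x \<in> S' \<longrightarrow> P x"
    using assms by (subst (asm) AE_restrict_space_iff) auto
  then have "AE x in lebesgue. T x \<in> S' \<longrightarrow> P (T x)" by (rule AE_T)
  then show ?thesis using assms by (subst AE_restrict_space_iff) auto
qed

text \<open>For measurable \<open>h\<close> an almost everywhere bound pulls back along
  \<open>T\<close>; otherwise the right-hand side is the default value \<open>top\<close>.\<close>

lemma esssup_on_T_le: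
  assumes "S \<in> sets lebesgue" "S' \<in> sets lebesgue" "\<And>x. x \<in> S \<Longrightarrow> T x \<in> S'"
  shows "esssup_on S (\<lambda>x. h (T x)) \<le> esssup_on S' h"
proof (cases "(\<lambda>z. ereal (h z)) \<in> borel_measurable (lebesgue_on S')")
  case True
  show ?thesis unfolding esssup_on_def
  proof (rule esssup_I)
    show "(\<lambda>x. ereal (h (T x))) \<in> borel_measurable (lebesgue_on S)"
      by (rule measurable_compose[OF measurable_T_lebesgue_on[OF assms] True])
    show "AE x in lebesgue_on S. ereal (h (T x)) \<le> esssup (lebesgue_on S') (\<lambda>z. ereal (h z))"
      by (rule AE_T_lebesgue_on[OF assms esssup_AE])
  qed
next
  case False
  then show ?thesis by (simp add: esssup_on_def esssup_non_measurable)
qed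

lemma esssup_on_image_T:
  assumes "S \<in> sets lebesgue"
  shows "esssup_on (T ` S) h = esssup_on S (\<lambda>x. h (T x))"
proof (rule antisym)
  have "esssup_on (T ` S) (\<lambda>x. h (T (T' x))) \<le> esssup_on S (\<lambda>x. h (T x))"
    using assms by (intro diag_affine.esssup_on_T_le[OF diag_affine_T']) (auto simp: sets_image_T)
  then show "esssup_on (T ` S) h \<le> esssup_on S (\<lambda>x. h (T x))" by simp
  show "esssup_on S (\<lambda>x. h (T x)) \<le> esssup_on (T ` S) h"
    using assms by (intro esssup_on_T_le) (auto simp: sets_image_T)
qed

text \<open>The substitution contributes the factor \<open>1 / Jac\<close> to the integral, so the
  norm bound with \<open>\<kappa>\<close> holds as soon as
  \<open>k powr p \<le> \<kappa> powr p * Jac\<close>. For the parabolic dilation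
  \<open>Jac = r ^ (n + 2)\<close>, and it is through this condition that the integrability
  exponents get compared with \<open>n + 2\<close>.\<close>

lemma Lp_norm_compose_T:
  assumes S: "S \<in> sets lebesgue" "T ` S \<subseteq> S" and g: "g \<in> Lp_nonneg p S"
    and p: "0 < p" and k: "0 \<le> k" "0 \<le> \<kappa>" "k powr p \<le> \<kappa> powr p * Jac"
  shows "(\<lambda>z. k * g (T z)) \<in> Lp_nonneg p S"
    and "Lp_norm p S (\<lambda>z. k * g (T z)) \<le> ennreal \<kappa> * Lp_norm p S g"
proof -
  let ?I = "\<integral>\<^sup>+ z. ennreal (\<bar>g z\<bar> powr p) \<partial>lebesgue_on S"
  let ?I' = "\<integral>\<^sup>+ z. ennreal (\<bar>k * g (T z)\<bar> powr p) \<partial>lebesgue_on S"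
  have gm: "g \<in> borel_measurable (lebesgue_on S)" and "Lp_norm p S g < \<infinity>"
    and ge: "AE z in lebesgue_on S. 0 \<le> g z"
    using g by (auto simp: Lp_nonneg_def Lp_space_def)
  then have fin: "?I \<noteq> \<infinity>" by (auto simp: Lp_norm_def Let_def)
  have TS: "x \<in> S \<Longrightarrow> T x \<in> S" for x using S by auto
  have gTm: "(\<lambda>z. g (T z)) \<in> borel_measurable (lebesgue_on S)"
    by (rule measurable_compose[OF measurable_T_lebesgue_on[OF S(1) S(1) TS] gm])
  have m: "(\<lambda>z. ennreal (\<bar>g z\<bar> powr p) * indicator S z) \<in> borel_measurable lebesgue"
    using gm S by (subst borel_measurable_restrict_space_iff_ennreal[symmetric]) auto
  have "?I' = ennreal (k powr p) * (\<integral>\<^sup>+ z. ennreal (\<bar>g (T z)\<bar> powr p) \<partial>lebesgue_on S)"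
    using k gTm by (subst nn_integral_cmult[symmetric])
      (auto simp: abs_mult powr_mult ennreal_mult)
  also have "\<dots> = ennreal (k powr p) * (\<integral>\<^sup>+ z. ennreal (\<bar>g (T z)\<bar> powr p) * indicator S z \<partial>lebesgue)"
    using S by (simp add: set_nn_integral_lebesgue_on)
  also have "\<dots> \<le> ennreal (\<kappa> powr p * Jac) * (\<integral>\<^sup>+ z. ennreal (\<bar>g (T z)\<bar> powr p) * indicator S (T z) \<partial>lebesgue)"
    using k TS by (intro mult_mono nn_integral_mono ennreal_leI) (auto simp: indicator_def)
  also have "\<dots> = ennreal (\<kappa> powr p) * (ennreal Jac * (\<integral>\<^sup>+ z. ennreal (\<bar>g (T z)\<bar> powr p) * indicator S (T z) \<partial>lebesgue))"
    using Jac_pos by (simp add: ennreal_mult mult.assoc)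
  also have "\<dots> = ennreal (\<kappa> powr p) * ?I"
    using S by (simp add: nn_integral_T[OF m] set_nn_integral_lebesgue_on)
  finally have le: "?I' \<le> ennreal (\<kappa> powr p) * ?I" .
  then have fin': "?I' \<noteq> \<infinity>" using fin by (auto simp: top_unique ennreal_mult_eq_top_iff)
  have "enn2real ?I' \<le> \<kappa> powr p * enn2real ?I"
    using enn2real_mono[OF le] fin by (simp add: enn2real_mult ennreal_mult_less_top less_top)
  then have "enn2real ?I' powr (1 / p) \<le> (\<kappa> powr p * enn2real ?I) powr (1 / p)"
    using p by (intro powr_mono2) auto
  also have "\<dots> = \<kappa> * enn2real ?I powr (1 / p)"
    using p k by (simp add: powr_mult powr_powr)
  finally show "Lp_norm p S (\<lambda>z. k * g (T z)) \<le> ennreal \<kappa> * Lp_norm p S g"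
    using fin fin' k by (simp add: Lp_norm_def Let_def ennreal_mult[symmetric] ennreal_leI)
  have "AE z in lebesgue_on S. 0 \<le> k * g (T z)"
    using AE_T_lebesgue_on[OF S(1) S(1) TS ge] k by auto
  then show "(\<lambda>z. k * g (T z)) \<in> Lp_nonneg p S"
    using gTm fin' by (auto simp: Lp_nonneg_def Lp_space_def Lp_norm_def Let_def)
qed

lemma test_function_compose_T':
  assumes "\<eta> \<in> test_functions UNIV"
  shows "(\<lambda>z. \<eta> (T' z)) \<in> test_functions UNIV"
proof -
  have sm: "smooth \<eta>" and K: "compact (closure {z. \<eta> z \<noteq> 0})"
    using assms by (auto simp: test_functions_def smooth_def)
  have "compact (T ` closure {z. \<eta> z \<noteq> 0})"
    using K by (intro compact_continuous_image continuous_on_daff)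
  moreover have "{z. \<eta> (T' z) \<noteq> 0} \<subseteq> T ` closure {z. \<eta> z \<noteq> 0}"
    using closure_subset[of "{z. \<eta> z \<noteq> 0}"] by (auto simp: image_T)
  ultimately have "compact (closure {z. \<eta> (T' z) \<noteq> 0})"
    by (meson closure_minimal compact_closure compact_imp_bounded compact_imp_closed bounded_subset)
  moreover have "smooth (\<lambda>z. \<eta> (T' z))"
    by (rule smooth_compose_affine[OF sm has_derivative_daff])
  ultimately show ?thesis by (simp add: test_functions_def smooth_def)
qed

text \<open>Testing the composed function with \<open>\<eta>\<close> is testing the original one
  with \<open>\<eta> \<circ> T'\<close>. Differentiating the latter produces the factor
  \<open>1 / c e\<close>, and the Jacobian occurs on both sides and cancels.\<close>

lemma weak_deriv_compose_T:
  assumes w: "weak_deriv UNIV e f g" and e: "e \<in> Basis"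
  shows "weak_deriv UNIV e (\<lambda>z. f (T z)) (\<lambda>z. c e * g (T z))"
  unfolding weak_deriv_def
proof
  fix \<eta> :: "'a \<Rightarrow> real" assume \<eta>: "\<eta> \<in> test_functions UNIV"
  then have sm: "smooth \<eta>" by (auto simp: test_functions_def smooth_def)
  have pd: "pd (\<lambda>z. \<eta> (T' z)) e (T z) = pd \<eta> e z / c e" for z
    using e linear_cmul[OF linear_pd[OF smooth_differentiable[OF sm]]]
    by (subst pd_compose[OF smooth_differentiable[OF sm] has_derivative_daff])
      (simp add: daff_0_Basis)
  have "Jac * (LINT z|lebesgue. f (T z) * pd \<eta> e z)
      = c e * (Jac * (LINT z|lebesgue. f (T z) * pd (\<lambda>z. \<eta> (T' z)) e (T z)))"
    unfolding pd using c_nonzero[OF e] by simp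
  also have "\<dots> = c e * (LINT z|lebesgue. f z * pd (\<lambda>z. \<eta> (T' z)) e z)"
    by (subst integral_T[of "\<lambda>z. f z * pd (\<lambda>z. \<eta> (T' z)) e z"]) simp
  also have "\<dots> = - c e * (LINT z|lebesgue. g z * \<eta> (T' z))"
    using w test_function_compose_T'[OF \<eta>] by (auto simp: weak_deriv_def lebesgue_on_UNIV_eq)
  also have "\<dots> = Jac * - (LINT z|lebesgue. c e * g (T z) * \<eta> z)"
    by (subst integral_T) (simp add: mult.assoc)
  finally have eq: "Jac * (LINT z|lebesgue. f (T z) * pd \<eta> e z)
      = Jac * - (LINT z|lebesgue. c e * g (T z) * \<eta> z)" .
  show "(LINT z|lebesgue_on UNIV. f (T z) * pd \<eta> e z)
      = - (LINT z|lebesgue_on UNIV. c e * g (T z) * \<eta> z)"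
    unfolding lebesgue_on_UNIV_eq
    by (rule mult_left_cancel[OF less_imp_neq[OF Jac_pos, symmetric], THEN iffD1, OF eq])
qed

end

section \<open>Weak derivatives up to a face\<close>

lemma smooth_bounded_on:
  assumes "smooth k" "bounded S"
  shows "\<exists>C\<ge>0. \<forall>w\<in>S. \<bar>k w\<bar> \<le> C"
proof -
  have "compact (k ` closure S)"
    using assms by (intro compact_continuous_image smooth_continuous) auto
  then obtain C where "\<forall>y\<in>k ` closure S. norm y \<le> C"
    using compact_imp_bounded bounded_iff by metis
  then show ?thesis using closure_subset[of S]
    by (intro exI[of _ "max C 0"]) (fastforce simp: max_def)
qed

lemma smooth_measurable: "smooth k \<Longrightarrow> k \<in> borel_measurable (lebesgue_on S)"
  by (intro measurable_restrict_space1 measurable_completion)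
    (simp add: borel_measurable_continuous_onI smooth_continuous)

lemma integrable_mult_bounded:
  fixes f k :: "'a \<Rightarrow> real"
  assumes "integrable M f" "k \<in> borel_measurable M" "\<And>w. w \<in> space M \<Longrightarrow> \<bar>k w\<bar> \<le> C"
  shows "integrable M (\<lambda>w. f w * k w)"
proof (rule Bochner_Integration.integrable_bound[where f = "\<lambda>w. C * f w"])
  show "AE x in M. norm (f x * k x) \<le> norm (C * f x)"
  proof (rule AE_I2)
    fix x assume "x \<in> space M"
    then have "\<bar>k x\<bar> \<le> C" by (rule assms(3))
    then have "\<bar>k x\<bar> \<le> \<bar>C\<bar>" by linarith
    then show "norm (f x * k x) \<le> norm (C * f x)"
      by (simp add: abs_mult mult.commute[of "\<bar>C\<bar>"] mult_left_mono)
  qed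
qed (use assms in auto)

lemma integrable_mult_smooth:
  assumes "integrable (lebesgue_on S) f" "smooth k" "bounded S"
  shows "integrable (lebesgue_on S) (\<lambda>w. f w * k w)"
proof -
  obtain C where "\<forall>w\<in>S. \<bar>k w\<bar> \<le> C" using smooth_bounded_on[OF assms(2,3)] by auto
  then show ?thesis
    using assms by (intro integrable_mult_bounded[where C = C] smooth_measurable) auto
qed

section \<open>Integrability and closure properties of \<open>Lp_space\<close>\<close>

lemma Lp_space_iff:
  "g \<in> Lp_space p S \<longleftrightarrow> g \<in> borel_measurable (lebesgue_on S) \<and>
     (\<integral>\<^sup>+ z. ennreal (\<bar>g z\<bar> powr p) \<partial>lebesgue_on S) < \<infinity>"
  by (auto simp: Lp_space_def Lp_norm_def Let_def less_top)

lemma Lp_space_integrable: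
  assumes "g \<in> Lp_space p S" "1 \<le> p" "S \<in> lmeasurable"
  shows "integrable (lebesgue_on S) g"
proof (rule integrableI_bounded)
  show m: "g \<in> borel_measurable (lebesgue_on S)" using assms by (auto simp: Lp_space_iff)
  have le: "\<bar>g z\<bar> \<le> 1 + \<bar>g z\<bar> powr p" for z
  proof (cases "\<bar>g z\<bar> \<le> 1")
    case False
    then have "\<bar>g z\<bar> powr 1 \<le> \<bar>g z\<bar> powr p" using assms by (intro powr_mono) auto
    then show ?thesis using False by simp
  qed (simp add: add_increasing2)
  have "(\<integral>\<^sup>+ z. ennreal (norm (g z)) \<partial>lebesgue_on S) \<le>
      (\<integral>\<^sup>+ z. 1 + ennreal (\<bar>g z\<bar> powr p) \<partial>lebesgue_on S)"
    using le by (intro nn_integral_mono)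
      (simp add: ennreal_plus[symmetric] ennreal_leI del: ennreal_plus flip: ennreal_1)
  also have "\<dots> = emeasure (lebesgue_on S) (space (lebesgue_on S)) +
      (\<integral>\<^sup>+ z. ennreal (\<bar>g z\<bar> powr p) \<partial>lebesgue_on S)"
    using m by (subst nn_integral_add) auto
  also have "\<dots> < \<infinity>"
    using assms by (auto simp: Lp_space_iff emeasure_restrict_space fmeasurable_def)
  finally show "(\<integral>\<^sup>+ z. ennreal (norm (g z)) \<partial>lebesgue_on S) < \<infinity>" .
qed

lemma Lp_space_bound:
  assumes "g \<in> Lp_space p S" "h \<in> borel_measurable (lebesgue_on S)" "0 \<le> p"
    "\<And>w. w \<in> S \<Longrightarrow> \<bar>h w\<bar> \<le> C * \<bar>g w\<bar>"
  shows "h \<in> Lp_space p S"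
proof -
  have "(\<integral>\<^sup>+ z. ennreal (\<bar>h z\<bar> powr p) \<partial>lebesgue_on S) \<le>
      (\<integral>\<^sup>+ z. ennreal (\<bar>C\<bar> powr p) * ennreal (\<bar>g z\<bar> powr p) \<partial>lebesgue_on S)"
  proof (rule nn_integral_mono)
    fix z assume "z \<in> space (lebesgue_on S)"
    then have "\<bar>h z\<bar> \<le> C * \<bar>g z\<bar>" using assms(4) by simp
    also have "\<dots> \<le> \<bar>C\<bar> * \<bar>g z\<bar>" by (intro mult_right_mono) auto
    finally have "\<bar>h z\<bar> \<le> \<bar>C\<bar> * \<bar>g z\<bar>" .
    then have "\<bar>h z\<bar> powr p \<le> (\<bar>C\<bar> * \<bar>g z\<bar>) powr p" using assms by (intro powr_mono2) auto
    then show "ennreal (\<bar>h z\<bar> powr p) \<le> ennreal (\<bar>C\<bar> powr p) * ennreal (\<bar>g z\<bar> powr p)"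
      by (simp add: ennreal_mult[symmetric] powr_mult ennreal_leI)
  qed
  also have "\<dots> = ennreal (\<bar>C\<bar> powr p) * (\<integral>\<^sup>+ z. ennreal (\<bar>g z\<bar> powr p) \<partial>lebesgue_on S)"
    using assms by (intro nn_integral_cmult) (auto simp: Lp_space_iff)
  also have "\<dots> < \<infinity>" using assms by (auto simp: Lp_space_iff ennreal_mult_less_top)
  finally show ?thesis using assms by (simp add: Lp_space_iff)
qed

lemma Lp_space_add:
  assumes "f \<in> Lp_space p S" "g \<in> Lp_space p S" "0 \<le> p"
  shows "(\<lambda>z. f z + g z) \<in> Lp_space p S"
proof -
  have "(\<integral>\<^sup>+ z. ennreal (\<bar>f z + g z\<bar> powr p) \<partial>lebesgue_on S) \<le>
      (\<integral>\<^sup>+ z. ennreal (2 powr p) * (ennreal (\<bar>f z\<bar> powr p) + ennreal (\<bar>g z\<bar> powr p)) \<partial>lebesgue_on S)"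
  proof (rule nn_integral_mono)
    fix z
    have "\<bar>f z + g z\<bar> powr p \<le> (2 * max \<bar>f z\<bar> \<bar>g z\<bar>) powr p" using assms by (intro powr_mono2) auto
    also have "\<dots> = 2 powr p * (max \<bar>f z\<bar> \<bar>g z\<bar>) powr p" by (subst powr_mult) auto
    also have "\<dots> \<le> 2 powr p * (\<bar>f z\<bar> powr p + \<bar>g z\<bar> powr p)"
      by (intro mult_left_mono) (auto simp: max_def)
    finally show "ennreal (\<bar>f z + g z\<bar> powr p) \<le>
        ennreal (2 powr p) * (ennreal (\<bar>f z\<bar> powr p) + ennreal (\<bar>g z\<bar> powr p))"
      by (simp add: ennreal_mult[symmetric] ennreal_plus[symmetric] ennreal_leI del: ennreal_plus)
  qed
  also have "\<dots> = ennreal (2 powr p) * ((\<integral>\<^sup>+ z. ennreal (\<bar>f z\<bar> powr p) \<partial>lebesgue_on S) +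
      (\<integral>\<^sup>+ z. ennreal (\<bar>g z\<bar> powr p) \<partial>lebesgue_on S))"
    using assms by (subst nn_integral_cmult) (auto simp: Lp_space_iff nn_integral_add)
  also have "\<dots> < \<infinity>" using assms by (auto simp: Lp_space_iff ennreal_mult_less_top)
  finally show ?thesis using assms by (auto simp: Lp_space_iff)
qed

lemma Lp_space_mult_smooth:
  assumes "g \<in> Lp_space p S" "smooth k" "bounded S" "0 \<le> p"
  shows "(\<lambda>w. k w * g w) \<in> Lp_space p S"
proof -
  obtain C where "\<forall>w\<in>S. \<bar>k w\<bar> \<le> C" using smooth_bounded_on[OF assms(2,3)] by auto
  then show ?thesis using assms smooth_measurable[OF assms(2), of S]
    by (intro Lp_space_bound[OF assms(1), where C = C])
      (auto simp: Lp_space_iff abs_mult intro!: mult_right_mono)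
qed

lemma pd_smooth_step_eq_0: "x < 1 \<or> 2 < x \<Longrightarrow> pd smooth_step 1 x = 0"
proof -
  assume x: "x < 1 \<or> 2 < x"
  have "(smooth_step has_derivative (\<lambda>h. 0)) (at x)"
  proof (cases "x < 1")
    case True
    then show ?thesis
      by (intro has_derivative_transform_within_open[OF has_derivative_const, where s = "{..<1}"])
        (auto simp: smooth_step_0)
  next
    case False
    then show ?thesis using x
      by (intro has_derivative_transform_within_open[OF has_derivative_const, where s = "{2<..}"])
        (auto simp: smooth_step_1)
  qed
  then show ?thesis by (rule pd_eqI)
qed

text \<open>The test function \<open>\<zeta>\<close> need not vanish near the top face \<open>{snd w = s0}\<close> of \<open>U\<close>. Cutting it off in
  time at distance \<open>h\<close> from the face costs a term of size \<open>1 / h\<close> on a strip of width \<open>h\<close>; the bound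
  with \<open>L\<close> keeps that term dominated, so it disappears as \<open>h \<rightarrow> 0\<close>.\<close>

lemma weak_deriv_up_to_face:
  fixes U :: "((real^'n) \<times> real) set"
  assumes U: "open U" "bounded U" "\<And>w. w \<in> U \<Longrightarrow> snd w < s0"
    and f: "integrable (lebesgue_on U) f" and g: "integrable (lebesgue_on U) g"
    and w: "weak_deriv U e f g" and e: "e \<in> Basis"
    and \<zeta>: "smooth \<zeta>" "compact K" "\<And>w. \<zeta> w \<noteq> 0 \<Longrightarrow> w \<in> K"
      "\<And>w. w \<in> K \<Longrightarrow> snd w < s0 \<Longrightarrow> w \<in> U"
    and L: "\<And>w. w \<in> U \<Longrightarrow> \<bar>snd e * \<zeta> w\<bar> \<le> L * (s0 - snd w)"
  shows "(LINT w|lebesgue_on U. f w * pd \<zeta> e w) = - (LINT w|lebesgue_on U. g w * \<zeta> w)"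
proof -
  let ?M = "lebesgue_on U"
  \<comment> \<open>Time to the face in units of \<open>1 / (n + 1)\<close>: the cutoff
    \<open>\<theta> n\<close> vanishes within one unit of the face and is 1 beyond two
    units.\<close>
  define a where "a n w = (s0 - snd w) * (real n + 1)" for n and w :: "(real^'n) \<times> real"
  define \<theta> where "\<theta> n w = smooth_step (a n w)" for n w
  have a_deriv: "(a n has_derivative (\<lambda>h. - snd h * (real n + 1))) (at w)" for n w
    unfolding a_def[abs_def] by (auto intro!: derivative_eq_intros)
  have sm_\<theta>: "smooth (\<theta> n)" for n
    unfolding \<theta>_def[abs_def] by (rule smooth_compose_affine[OF smooth_smooth_step a_deriv])
  have pd_\<theta>: "pd (\<theta> n) e w = - snd e * (real n + 1) * pd smooth_step 1 (a n w)" for n w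
    unfolding \<theta>_def[abs_def]
    using pd_compose[OF smooth_differentiable[OF smooth_smooth_step] a_deriv[of n w], of e]
      linear_cmul[OF linear_pd[OF smooth_differentiable[OF smooth_smooth_step, of "a n w"]],
        of "- snd e * (real n + 1)" 1]
    by simp
  obtain D where D: "D \<ge> 0" "\<forall>x\<in>{1..2}. \<bar>pd smooth_step 1 x\<bar> \<le> D"
    using smooth_bounded_on[OF smooth_pd[OF smooth_smooth_step], of 1 "{1..2}"] by auto
  have D': "\<bar>x * pd smooth_step 1 x\<bar> \<le> 2 * D" for x
  proof (cases "x \<in> {1..2}")
    case True
    then show ?thesis unfolding abs_mult using D by (intro mult_mono) auto
  next
    case False
    then show ?thesis using pd_smooth_step_eq_0[of x] D by auto
  qed
  obtain C where C: "C \<ge> 0" "\<forall>w\<in>U. \<bar>\<zeta> w\<bar> \<le> C" using smooth_bounded_on[OF \<zeta>(1) U(2)] by auto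
  obtain C' where C': "C' \<ge> 0" "\<forall>w\<in>U. \<bar>pd \<zeta> e w\<bar> \<le> C'"
    using smooth_bounded_on[OF smooth_pd[OF \<zeta>(1) e] U(2)] by auto
  have an: "\<forall>\<^sub>F n in sequentially. 2 < a n w" if "w \<in> U" for w
  proof -
    have "filterlim (\<lambda>n. (s0 - snd w) * (real n + 1)) at_top sequentially"
      using U(3)[OF that] by real_asymp
    then show ?thesis unfolding a_def filterlim_at_top_dense by blast
  qed
  have tf: "(\<lambda>w. \<zeta> w * \<theta> n w) \<in> test_functions U" for n
  proof -
    let ?K = "K \<inter> {w. 1 \<le> a n w}"
    have "continuous_on UNIV (a n)" unfolding a_def by (intro continuous_intros)
    then have "closed {w. 1 \<le> a n w}" by (intro closed_Collect_le) auto
    then have K: "compact ?K" using \<zeta>(2) by auto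
    have sub: "{w. \<zeta> w * \<theta> n w \<noteq> 0} \<subseteq> ?K"
    proof
      fix w assume "w \<in> {w. \<zeta> w * \<theta> n w \<noteq> 0}"
      then have "\<zeta> w \<noteq> 0" "smooth_step (a n w) \<noteq> 0" by (auto simp: \<theta>_def)
      moreover from this have "1 < a n w" using smooth_step_0 by (meson not_le)
      ultimately show "w \<in> ?K" using \<zeta>(3) by auto
    qed
    then have cl: "closure {w. \<zeta> w * \<theta> n w \<noteq> 0} \<subseteq> ?K"
      by (intro closure_minimal compact_imp_closed K)
    moreover have "?K \<subseteq> U"
    proof
      fix w assume w: "w \<in> ?K"
      then have "0 < (s0 - snd w) * (real n + 1)" by (auto simp: a_def)
      then have "snd w < s0" by (simp add: zero_less_mult_iff)
      then show "w \<in> U" using w \<zeta>(4) by auto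
    qed
    moreover have "compact (closure {w. \<zeta> w * \<theta> n w \<noteq> 0})"
      using bounded_subset[OF compact_imp_bounded[OF K] cl] by (simp add: compact_eq_bounded_closed)
    moreover have "smooth (\<lambda>w. \<zeta> w * \<theta> n w)" by (intro smooth_mult \<zeta>(1) sm_\<theta>)
    ultimately show ?thesis by (auto simp: test_functions_def smooth_def)
  qed
  have pdp: "pd (\<lambda>w. \<zeta> w * \<theta> n w) e w = \<zeta> w * pd (\<theta> n) e w + pd \<zeta> e w * \<theta> n w" for n w
    by (intro pd_mult smooth_differentiable \<zeta>(1) sm_\<theta>)
  have eq: "(LINT w|?M. f w * pd (\<lambda>w. \<zeta> w * \<theta> n w) e w) = - (LINT w|?M. g w * (\<zeta> w * \<theta> n w))" for n
    using w tf by (auto simp: weak_deriv_def)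
  \<comment> \<open>Differentiating the cutoff costs \<open>n + 1\<close>; the bound on
    \<open>\<zeta>\<close> supplies \<open>s0 - snd w\<close>, and the product of the two is
    \<open>a n w\<close>. The resulting bound is the same for all \<open>n\<close>, which is what
    dominated convergence needs.\<close>
  have bd: "\<bar>\<zeta> w * pd (\<theta> n) e w\<bar> \<le> L * (2 * D)" if "w \<in> U" for n w
  proof -
    have "\<bar>\<zeta> w * pd (\<theta> n) e w\<bar> = \<bar>snd e * \<zeta> w\<bar> * ((real n + 1) * \<bar>pd smooth_step 1 (a n w)\<bar>)"
      by (simp add: pd_\<theta> abs_mult)
    also have "\<dots> \<le> (L * (s0 - snd w)) * ((real n + 1) * \<bar>pd smooth_step 1 (a n w)\<bar>)"
      using L[OF that] by (intro mult_right_mono) auto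
    also have "\<dots> = L * \<bar>a n w * pd smooth_step 1 (a n w)\<bar>"
      using U(3)[OF that] by (simp add: a_def abs_mult)
    also have "\<dots> \<le> L * (2 * D)"
    proof (rule mult_left_mono[OF D'])
      have "0 \<le> L * (s0 - snd w)" using L[OF that] by linarith
      then show "0 \<le> L" using U(3)[OF that] by (simp add: zero_le_mult_iff)
    qed
    finally show ?thesis .
  qed
  have "(\<lambda>n. LINT w|?M. f w * pd (\<lambda>w. \<zeta> w * \<theta> n w) e w) \<longlonglongrightarrow> (LINT w|?M. f w * pd \<zeta> e w)"
  proof (rule integral_dominated_convergence[where w = "\<lambda>w. \<bar>L * (2 * D) + C'\<bar> * \<bar>f w\<bar>"])
    show "(\<lambda>w. f w * pd \<zeta> e w) \<in> borel_measurable ?M"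
      using f smooth_measurable[OF smooth_pd[OF \<zeta>(1) e]] by auto
    show "(\<lambda>w. f w * pd (\<lambda>w. \<zeta> w * \<theta> n w) e w) \<in> borel_measurable ?M" for n
      using f smooth_measurable[OF smooth_pd[OF smooth_mult[OF \<zeta>(1) sm_\<theta>] e]] by auto
    show "integrable ?M (\<lambda>w. \<bar>L * (2 * D) + C'\<bar> * \<bar>f w\<bar>)" using f by auto
    show "AE w in ?M. (\<lambda>n. f w * pd (\<lambda>w. \<zeta> w * \<theta> n w) e w) \<longlonglongrightarrow> f w * pd \<zeta> e w"
    proof (rule AE_I2)
      fix w assume "w \<in> space ?M"
      then have "w \<in> U" by simp
      show "(\<lambda>n. f w * pd (\<lambda>w. \<zeta> w * \<theta> n w) e w) \<longlonglongrightarrow> f w * pd \<zeta> e w"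
        by (rule tendsto_eventually, rule eventually_mono[OF an[OF \<open>w \<in> U\<close>]])
          (unfold pdp pd_\<theta>, simp add: pd_smooth_step_eq_0 \<theta>_def smooth_step_1)
    qed
    show "AE w in ?M. norm (f w * pd (\<lambda>w. \<zeta> w * \<theta> n w) e w) \<le> \<bar>L * (2 * D) + C'\<bar> * \<bar>f w\<bar>" for n
    proof (rule AE_I2)
      fix w assume "w \<in> space ?M"
      then have wU: "w \<in> U" by simp
      have "\<bar>pd \<zeta> e w * \<theta> n w\<bar> \<le> C' * 1"
        unfolding abs_mult using C' wU smooth_step_bounds[of "a n w"]
        by (intro mult_mono) (auto simp: \<theta>_def)
      then have "\<bar>pd (\<lambda>w. \<zeta> w * \<theta> n w) e w\<bar> \<le> \<bar>L * (2 * D) + C'\<bar>"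
        using bd[OF wU, of n] unfolding pdp by linarith
      then show "norm (f w * pd (\<lambda>w. \<zeta> w * \<theta> n w) e w) \<le> \<bar>L * (2 * D) + C'\<bar> * \<bar>f w\<bar>"
        by (simp add: abs_mult mult.commute mult_left_mono)
    qed
  qed
  moreover have "(\<lambda>n. LINT w|?M. g w * (\<zeta> w * \<theta> n w)) \<longlonglongrightarrow> (LINT w|?M. g w * \<zeta> w)"
  proof (rule integral_dominated_convergence[where w = "\<lambda>w. C * \<bar>g w\<bar>"])
    show "(\<lambda>w. g w * \<zeta> w) \<in> borel_measurable ?M"
      using g smooth_measurable[OF \<zeta>(1)] by auto
    show "(\<lambda>w. g w * (\<zeta> w * \<theta> n w)) \<in> borel_measurable ?M" for n
      using g smooth_measurable[OF smooth_mult[OF \<zeta>(1) sm_\<theta>]] by auto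
    show "integrable ?M (\<lambda>w. C * \<bar>g w\<bar>)" using g by auto
    show "AE w in ?M. (\<lambda>n. g w * (\<zeta> w * \<theta> n w)) \<longlonglongrightarrow> g w * \<zeta> w"
    proof (rule AE_I2)
      fix w assume "w \<in> space ?M"
      then have "w \<in> U" by simp
      show "(\<lambda>n. g w * (\<zeta> w * \<theta> n w)) \<longlonglongrightarrow> g w * \<zeta> w"
        by (rule tendsto_eventually, rule eventually_mono[OF an[OF \<open>w \<in> U\<close>]])
          (simp add: \<theta>_def smooth_step_1)
    qed
    show "AE w in ?M. norm (g w * (\<zeta> w * \<theta> n w)) \<le> C * \<bar>g w\<bar>" for n
    proof (rule AE_I2)
      fix w assume "w \<in> space ?M"
      then have "\<bar>\<zeta> w * \<theta> n w\<bar> \<le> C * 1"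
        unfolding abs_mult using C smooth_step_bounds[of "a n w"]
        by (intro mult_mono) (auto simp: \<theta>_def)
      then show "norm (g w * (\<zeta> w * \<theta> n w)) \<le> C * \<bar>g w\<bar>"
        by (simp add: abs_mult[of "g w"] mult.commute[of C] mult_left_mono)
    qed
  qed
  ultimately show ?thesis
    unfolding eq using tendsto_minus LIMSEQ_unique by blast
qed

section \<open>Extension of test functions by reflection\<close>

lemma Basis_space_time:
  "e \<in> (Basis :: ((real^'n) \<times> real) set) \<longleftrightarrow> e = (0, 1) \<or> (\<exists>i. e = (axis i 1, 0))"
  by (auto simp: Basis_prod_def Basis_vec_def)

lemma test_function_pd_outside:
  assumes "\<eta> \<in> test_functions U" "w \<notin> closure {w. \<eta> w \<noteq> 0}"
  shows "\<eta> w = 0" "pd \<eta> e w = 0"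
proof -
  let ?K = "closure {w. \<eta> w \<noteq> 0}"
  show "\<eta> w = 0" using assms closure_subset[of "{w. \<eta> w \<noteq> 0}"] by blast
  have "((\<lambda>w. 0) has_derivative (\<lambda>h. 0)) (at w)" by simp
  then have "(\<eta> has_derivative (\<lambda>h. 0)) (at w)"
    by (rule has_derivative_transform_within_open[where s = "- ?K"])
      (use assms closure_subset[of "{w. \<eta> w \<noteq> 0}"] in auto)
  then show "pd \<eta> e w = 0" by (rule pd_eqI)
qed

lemma test_function_bounded:
  assumes "\<eta> \<in> test_functions U" "e \<in> Basis"
  shows "\<exists>C\<ge>0. \<forall>w. \<bar>\<eta> w\<bar> \<le> C \<and> \<bar>pd \<eta> e w\<bar> \<le> C"
proof -
  let ?K = "closure {w. \<eta> w \<noteq> 0}"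
  have sm: "smooth \<eta>" and K: "compact ?K" using assms by (auto simp: test_functions_def smooth_def)
  have out: "\<eta> w = 0 \<and> pd \<eta> e w = 0" if "w \<notin> ?K" for w
    using test_function_pd_outside[OF assms(1) that] by blast
  obtain C where C: "C \<ge> 0" "\<forall>w\<in>?K. \<bar>\<eta> w\<bar> \<le> C"
    using smooth_bounded_on[OF sm compact_imp_bounded[OF K]] by auto
  obtain C' where C': "C' \<ge> 0" "\<forall>w\<in>?K. \<bar>pd \<eta> e w\<bar> \<le> C'"
    using smooth_bounded_on[OF smooth_pd[OF sm assms(2)] compact_imp_bounded[OF K]] by auto
  have "\<bar>\<eta> w\<bar> \<le> max C C' \<and> \<bar>pd \<eta> e w\<bar> \<le> max C C'" for w
    using C C' out[of w] by (cases "w \<in> ?K") (auto simp: le_max_iff_disj)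
  then show ?thesis using C by (intro exI[of _ "max C C'"]) auto
qed

text \<open>Applied with \<open>s'\<close> the reflection of \<open>s\<close> at the face: the
  difference between a test function and its reflection is then linearly small at the face, as
  \<open>weak_deriv_up_to_face\<close> requires in the time direction.\<close>

lemma test_function_time_lipschitz:
  fixes \<eta> :: "(real^'n) \<times> real \<Rightarrow> real"
  assumes "smooth \<eta>" "\<And>w. \<bar>pd \<eta> (0, 1) w\<bar> \<le> C"
  shows "\<bar>\<eta> (y, s) - \<eta> (y, s')\<bar> \<le> C * \<bar>s - s'\<bar>"
proof -
  have "((\<lambda>\<tau>. \<eta> (y, \<tau>)) has_real_derivative pd \<eta> (0, 1) (y, \<tau>)) (at \<tau> within UNIV)" for \<tau>
  proof -
    have "((\<lambda>\<tau>. (y, \<tau>)) has_derivative (\<lambda>h. (0, h))) (at \<tau>)"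
      by (intro has_derivative_Pair has_derivative_const has_derivative_ident)
    then have "((\<lambda>\<tau>. \<eta> (y, \<tau>)) has_derivative (\<lambda>h. pd \<eta> (0, h) (y, \<tau>))) (at \<tau>)"
      using frechet_derivative_works[THEN iffD1, OF smooth_differentiable[OF assms(1), of "(y, \<tau>)"]]
      by (rule has_derivative_compose)
    moreover have "(\<lambda>h. pd \<eta> (0, h) (y, \<tau>)) = (*) (pd \<eta> (0, 1) (y, \<tau>))"
    proof
      fix h
      show "pd \<eta> (0, h) (y, \<tau>) = pd \<eta> (0, 1) (y, \<tau>) * h"
        using linear_cmul[OF linear_pd[OF smooth_differentiable[OF assms(1), of "(y, \<tau>)"]], of h "(0, 1)"]
        by simp
    qed
    ultimately show ?thesis unfolding has_field_derivative_def by metis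
  qed
  from field_differentiable_bound[OF convex_UNIV this, of C s s'] show ?thesis
    using assms(2) by simp
qed

text \<open>A test function on a small cylinder is only given up to the top face of that cylinder, whereas the
  subsolution property on the large cylinder asks for a test function beyond it. The extension
  multiplies by a cutoff supported in the box of half-width \<open>2 * \<rho>\<close> around \<open>z\<close> and reflects evenly in
  time across \<open>snd z\<close>; the time derivative is then extended oddly. Which extension is taken on the face
  itself matters, because the backward cylinders of the viscosity definition contain it.\<close>

locale cell =
  fixes z :: "(real^'n) \<times> real" and \<rho> :: real
  assumes rho_pos: "0 < \<rho>"
begin

text \<open>Half-width \<open>3 * \<rho>\<close> leaves room around the box of half-width
  \<open>2 * \<rho>\<close> that carries the cutoff. \<open>cellC\<close> contains its top face,
  like the cylinders of the viscosity definition; \<open>cellU\<close> is its interior, where weak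
  derivatives are tested.\<close>

definition base :: "(real^'n) set" where "base = {y. \<forall>i. \<bar>y $ i - fst z $ i\<bar> < 3 * \<rho>}"
definition cellU where "cellU = base \<times> {snd z - 3 * \<rho> <..< snd z}"
definition cellC where "cellC = base \<times> {snd z - 3 * \<rho> <.. snd z}"
abbreviation "flip_sign \<equiv> \<lambda>j :: (real^'n) \<times> real. if snd j = 0 then 1 else - 1 :: real"
abbreviation "R \<equiv> daff (0, 2 * snd z) flip_sign"

text \<open>On the face \<open>R\<close> is the identity and both branches would apply; asking for
  \<open>w \<in> cellC\<close> first keeps the value of \<open>h\<close> there even when
  \<open>\<sigma> = - 1\<close>.\<close>

definition ext :: "real \<Rightarrow> ((real^'n) \<times> real \<Rightarrow> real) \<Rightarrow> (real^'n) \<times> real \<Rightarrow> real" where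
  "ext \<sigma> h w = (if w \<in> cellC then h w else if R w \<in> cellC then \<sigma> * h (R w) else 0)"

sublocale refl: diag_affine "(0, 2 * snd z)" flip_sign
  by unfold_locales auto

lemma R_apply: "R w = (fst w, 2 * snd z - snd w)"
proof (rule euclidean_eqI)
  fix b :: "(real^'n) \<times> real" assume "b \<in> Basis"
  then show "R w \<bullet> b = (fst w, 2 * snd z - snd w) \<bullet> b"
    unfolding daff_inner[OF \<open>b \<in> Basis\<close>] by (cases w) (auto simp: Basis_space_time)
qed

lemma Jac_R: "refl.Jac = 1"
  by (rule prod.neutral) auto

lemma open_base: "open base"
proof -
  have "base = (\<Inter>i. {y. \<bar>y $ i - fst z $ i\<bar> < 3 * \<rho>})" by (auto simp: base_def)
  moreover have "open {y. \<bar>y $ i - fst z $ i\<bar> < 3 * \<rho>}" for i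
    by (intro open_Collect_less continuous_intros)
  ultimately show ?thesis by auto
qed

lemma bounded_base: "bounded base"
  unfolding bounded_iff
proof (intro exI ballI)
  fix y assume y: "y \<in> base"
  have "norm y \<le> (\<Sum>i\<in>UNIV. \<bar>y $ i\<bar>)" by (rule norm_le_l1_cart)
  also have "\<dots> \<le> (\<Sum>i\<in>UNIV. \<bar>fst z $ i\<bar> + 3 * \<rho>)"
  proof (rule sum_mono)
    fix i
    have "\<bar>y $ i - fst z $ i\<bar> < 3 * \<rho>" using y by (simp add: base_def)
    then show "\<bar>y $ i\<bar> \<le> \<bar>fst z $ i\<bar> + 3 * \<rho>" by linarith
  qed
  finally show "norm y \<le> (\<Sum>i\<in>UNIV. \<bar>fst z $ i\<bar> + 3 * \<rho>)" .
qed

lemma open_cellU: "open cellU"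
  unfolding cellU_def by (intro open_Times open_base) auto

lemma bounded_cellU: "bounded cellU"
  unfolding cellU_def by (intro bounded_Times bounded_base) auto

lemma bounded_cellC: "bounded cellC"
  unfolding cellC_def
  by (intro bounded_Times bounded_base bounded_subset[OF bounded_closed_interval[of "snd z - 3 * \<rho>" "snd z"]]) auto

lemma cellU_subset: "cellU \<subseteq> cellC"
  by (auto simp: cellU_def cellC_def)

lemma interior_cellC: "interior cellC = cellU"
proof -
  have "interior {snd z - 3 * \<rho> <.. snd z} = {snd z - 3 * \<rho> <..< snd z}"
  proof (rule antisym)
    have "interior {snd z - 3 * \<rho> <.. snd z} \<subseteq> interior {snd z - 3 * \<rho> .. snd z}"
      by (intro interior_mono) auto
    then show "interior {snd z - 3 * \<rho> <.. snd z} \<subseteq> {snd z - 3 * \<rho> <..< snd z}" by simp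
    show "{snd z - 3 * \<rho> <..< snd z} \<subseteq> interior {snd z - 3 * \<rho> <.. snd z}"
      by (intro interior_maximal) auto
  qed
  then show ?thesis unfolding cellC_def cellU_def by (simp add: interior_Times interior_open[OF open_base])
qed

lemma sets_cellU: "cellU \<in> sets lebesgue"
  using open_cellU by (simp add: borel_open)

lemma sets_cellC: "cellC \<in> sets lebesgue"
proof -
  have "cellC \<in> sets borel" unfolding cellC_def
    using open_base by (intro borel_Times) auto
  then show ?thesis by simp
qed

lemma AE_off_face: "AE w :: (real^'n) \<times> real in lebesgue. snd w \<noteq> snd z"
proof -
  have "negligible {w :: (real^'n) \<times> real. w \<bullet> (0, 1) = snd z}"
    by (intro negligible_standard_hyperplane) (simp add: Basis_space_time)
  then have "{w :: (real^'n) \<times> real. w \<bullet> (0, 1) = snd z} \<in> null_sets lebesgue"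
    by (simp add: negligible_iff_null_sets)
  from AE_not_in[OF this] show ?thesis by (auto simp: inner_prod_def)
qed

lemma integrable_cellU:
  fixes f :: "(real^'n) \<times> real \<Rightarrow> real"
  assumes "integrable (lebesgue_on cellC) f"
  shows "integrable (lebesgue_on cellU) f"
proof -
  have "integrable lebesgue (\<lambda>w. indicator cellC w *\<^sub>R f w)"
    using assms sets_cellC by (subst (asm) integrable_restrict_space) auto
  from integrable_mult_indicator[OF sets_cellU this]
  have "integrable lebesgue (\<lambda>w. indicator cellU w *\<^sub>R f w)"
    by (rule Bochner_Integration.integrable_cong[THEN iffD1, OF refl, rotated])
      (use cellU_subset in \<open>auto simp: indicator_def\<close>)
  then show ?thesis using sets_cellU by (subst integrable_restrict_space) auto
qed

lemma measurable_ext: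
  assumes hm: "h \<in> borel_measurable (lebesgue_on cellC)"
  shows "ext \<sigma> h \<in> borel_measurable lebesgue"
proof -
  define h0 where "h0 w = indicator cellC w * h w" for w
  have h0m: "h0 \<in> borel_measurable lebesgue"
    using hm sets_cellC by (subst (asm) borel_measurable_restrict_space_iff) (auto simp: h0_def[abs_def])
  then have h0Rm: "(\<lambda>w. h0 (R w)) \<in> borel_measurable lebesgue"
    using refl.borel_measurable_T_iff by blast
  have eq: "ext \<sigma> h w = h0 w + \<sigma> * h0 (R w) * (1 - indicator cellC w)" for w
    by (auto simp: ext_def h0_def indicator_def)
  show ?thesis
    unfolding eq[abs_def] using h0m h0Rm sets_cellC
    by (intro borel_measurable_add borel_measurable_times borel_measurable_diff borel_measurable_indicator) auto
qed

text \<open>Folding along the face: the reflected half is mapped back by \<open>R\<close>, which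
  preserves measure, so that on the original half \<open>k\<close> is replaced by its symmetrisation
  with sign \<open>\<sigma>\<close>. The face itself is a null set.\<close>

lemma integral_ext:
  assumes hC: "integrable (lebesgue_on cellC) h" and k: "k \<in> borel_measurable lebesgue" "\<And>w. \<bar>k w\<bar> \<le> C"
  shows "(LINT w|lebesgue. ext \<sigma> h w * k w) = (LINT w|lebesgue_on cellU. h w * (k w + \<sigma> * k (R w)))"
proof -
  have h: "integrable (lebesgue_on cellU) h" by (rule integrable_cellU[OF hC])
  define A where "A w = indicator cellU w * (h w * k w)" for w
  define A2 where "A2 w = indicator cellU w * (h w * k (R w))" for w
  have kR: "(\<lambda>w. k (R w)) \<in> borel_measurable lebesgue"
    using k refl.borel_measurable_T_iff by blast
  have i1: "integrable (lebesgue_on cellU) (\<lambda>w. h w * k w)"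
    using k by (intro integrable_mult_bounded[OF h, where C = C] measurable_restrict_space1) auto
  have i2: "integrable (lebesgue_on cellU) (\<lambda>w. h w * k (R w))"
    using k kR by (intro integrable_mult_bounded[OF h, where C = C] measurable_restrict_space1) auto
  have IA: "integrable lebesgue A"
    using i1 sets_cellU by (subst (asm) integrable_restrict_space) (auto simp: A_def[abs_def])
  have IA2: "integrable lebesgue A2"
    using i2 sets_cellU by (subst (asm) integrable_restrict_space) (auto simp: A2_def[abs_def])
  have IA2R: "integrable lebesgue (\<lambda>w. A2 (R w))" by (rule refl.integrable_T[OF IA2])
  have AE: "AE w in lebesgue. ext \<sigma> h w * k w = A w + \<sigma> * A2 (R w)"
    using AE_off_face
  proof (rule AE_mp[OF _ AE_I2], intro impI)
    fix w :: "(real^'n) \<times> real" assume "snd w \<noteq> snd z"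
    then show "ext \<sigma> h w * k w = A w + \<sigma> * A2 (R w)"
      by (auto simp: ext_def A_def A2_def cellC_def cellU_def indicator_def R_apply mem_Times_iff)
  qed
  have "(LINT w|lebesgue. ext \<sigma> h w * k w) = (LINT w|lebesgue. A w + \<sigma> * A2 (R w))"
  proof (rule integral_cong_AE[OF _ _ AE])
    show m: "(\<lambda>w. A w + \<sigma> * A2 (R w)) \<in> borel_measurable lebesgue" using IA IA2R by auto
    show "(\<lambda>w. ext \<sigma> h w * k w) \<in> borel_measurable lebesgue"
      using k(1) measurable_ext[of h \<sigma>] hC by auto
  qed
  also have "\<dots> = (LINT w|lebesgue. A w) + \<sigma> * (LINT w|lebesgue. A2 (R w))"
    using IA IA2R by simp
  also have "(LINT w|lebesgue. A2 (R w)) = (LINT w|lebesgue. A2 w)"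
    using refl.integral_T[of A2] unfolding Jac_R by simp
  also have "(LINT w|lebesgue. A w) + \<sigma> * (LINT w|lebesgue. A2 w) =
      (LINT w|lebesgue_on cellU. h w * k w) + \<sigma> * (LINT w|lebesgue_on cellU. h w * k (R w))"
    using sets_cellU by (simp add: A_def[abs_def] A2_def[abs_def] integral_restrict_space)
  also have "\<dots> = (LINT w|lebesgue_on cellU. h w * (k w + \<sigma> * k (R w)))"
    using i1 i2 by (simp add: distrib_left mult.left_commute[of _ \<sigma>])
  finally show ?thesis .
qed

text \<open>By folding, testing the extension with \<open>\<eta>\<close> amounts to testing on
  \<open>cellU\<close> with
  \<open>\<zeta> = \<kappa> * (\<eta> + \<sigma> * \<eta> \<circ> R)\<close>, where
  \<open>\<sigma>\<close> is the sign of the direction \<open>e\<close> under \<open>R\<close>. In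
  spatial directions the face contributes nothing to the integration by parts; in the time direction
  \<open>\<sigma> = - 1\<close>, and \<open>\<zeta>\<close> vanishes linearly at the face. In both
  cases \<open>weak_deriv_up_to_face\<close> applies.\<close>

lemma weak_deriv_ext:
  assumes fC: "integrable (lebesgue_on cellC) f" and gC: "integrable (lebesgue_on cellC) g"
    and w: "weak_deriv cellU e f g" and e: "e \<in> Basis"
    and \<kappa>: "smooth \<kappa>" "\<And>w b. \<kappa> w \<noteq> 0 \<Longrightarrow> b \<in> Basis \<Longrightarrow> \<bar>(w - z) \<bullet> b\<bar> \<le> 2 * \<rho>"
  shows "weak_deriv UNIV e (ext 1 (\<lambda>w. \<kappa> w * f w))
    (ext (flip_sign e) (\<lambda>w. \<kappa> w * g w + pd \<kappa> e w * f w))"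
  unfolding weak_deriv_def
proof
  fix \<eta> :: "(real^'n) \<times> real \<Rightarrow> real" assume \<eta>: "\<eta> \<in> test_functions UNIV"
  then have sm: "smooth \<eta>" by (auto simp: test_functions_def smooth_def)
  obtain C where C: "C \<ge> 0" "\<And>w. \<bar>\<eta> w\<bar> \<le> C" "\<And>w. \<bar>pd \<eta> e w\<bar> \<le> C"
    using test_function_bounded[OF \<eta> e] by auto
  note f = integrable_cellU[OF fC] and g = integrable_cellU[OF gC]
  let ?\<sigma> = "flip_sign e"
  define \<eta>\<sigma> where "\<eta>\<sigma> w = \<eta> w + ?\<sigma> * \<eta> (R w)" for w
  define \<zeta> where "\<zeta> w = \<kappa> w * \<eta>\<sigma> w" for w
  have smR: "smooth (\<lambda>w. \<eta> (R w))" by (rule smooth_compose_affine[OF sm has_derivative_daff])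
  have sm\<sigma>: "smooth \<eta>\<sigma>" unfolding \<eta>\<sigma>_def[abs_def] by (intro smooth_add smooth_mult smooth_const sm smR)
  have sm\<zeta>: "smooth \<zeta>" unfolding \<zeta>_def[abs_def] by (intro smooth_mult \<kappa>(1) sm\<sigma>)
  have pdR: "pd (\<lambda>w. \<eta> (R w)) e w = ?\<sigma> * pd \<eta> e (R w)" for w
    using e linear_cmul[OF linear_pd[OF smooth_differentiable[OF sm, of "R w"]], of ?\<sigma> e]
    by (subst pd_compose[OF smooth_differentiable[OF sm] has_derivative_daff])
      (simp add: daff_0_Basis)
  have pd\<sigma>: "pd \<eta>\<sigma> e w = pd \<eta> e w + pd \<eta> e (R w)" for w
  proof -
    have "pd \<eta>\<sigma> e w = pd \<eta> e w + pd (\<lambda>w. ?\<sigma> * \<eta> (R w)) e w"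
      unfolding \<eta>\<sigma>_def[abs_def]
      by (intro pd_add smooth_differentiable sm smooth_mult smooth_const smR)
    also have "pd (\<lambda>w. ?\<sigma> * \<eta> (R w)) e w = ?\<sigma> * pd (\<lambda>w. \<eta> (R w)) e w"
      by (subst pd_mult) (auto intro: smooth_differentiable smR simp: frechet_derivative_const)
    finally show ?thesis by (auto simp: pdR)
  qed
  have pd\<zeta>: "pd \<zeta> e w = \<kappa> w * pd \<eta>\<sigma> e w + pd \<kappa> e w * \<eta>\<sigma> w" for w
    unfolding \<zeta>_def[abs_def] by (intro pd_mult smooth_differentiable \<kappa>(1) sm\<sigma>)
  \<comment> \<open>This box contains the support of \<open>\<kappa>\<close>; below the face it lies
    in \<open>cellU\<close>, because \<open>2 * \<rho> < 3 * \<rho>\<close>.\<close>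
  let ?K = "cbox (z - (2 * \<rho>) *\<^sub>R One) (z + (2 * \<rho>) *\<^sub>R One)"
  have K: "w \<in> ?K \<longleftrightarrow> (\<forall>b\<in>Basis. \<bar>(w - z) \<bullet> b\<bar> \<le> 2 * \<rho>)" for w
    by (auto simp: mem_box inner_diff_left inner_add_left abs_le_iff algebra_simps)
  have KU: "w \<in> cellU" if "w \<in> ?K" "snd w < snd z" for w
  proof -
    have *: "\<bar>(w - z) \<bullet> b\<bar> \<le> 2 * \<rho>" if "b \<in> Basis" for b using that \<open>w \<in> ?K\<close> K by blast
    have "\<bar>fst w $ i - fst z $ i\<bar> < 3 * \<rho>" for i
    proof -
      have "(axis i 1, 0) \<in> (Basis :: ((real^'n) \<times> real) set)" by (auto simp: Basis_space_time)
      from *[OF this] show ?thesis using rho_pos by (simp add: inner_prod_def inner_axis)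
    qed
    moreover have "snd z - 3 * \<rho> < snd w"
      using *[of "(0, 1)"] rho_pos by (simp add: Basis_space_time inner_prod_def)
    ultimately show ?thesis using that by (auto simp: cellU_def base_def mem_Times_iff)
  qed
  obtain Ck0 where Ck0: "Ck0 \<ge> 0" "\<forall>w\<in>cellU. \<bar>\<kappa> w\<bar> \<le> Ck0"
    using smooth_bounded_on[OF \<kappa>(1) bounded_cellU] by auto
  \<comment> \<open>Spatial directions have \<open>snd e = 0\<close>, so only
    \<open>e = (0, 1)\<close> needs the Lipschitz estimate; the reflected time differs from
    \<open>snd w\<close> by twice the distance to the face.\<close>
  have L: "\<bar>snd e * \<zeta> w\<bar> \<le> (Ck0 * (2 * C)) * (snd z - snd w)" if "w \<in> cellU" for w
  proof (cases "snd e = 0")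
    case True
    then show ?thesis using that C Ck0 by (auto simp: cellU_def)
  next
    case False
    then have e1: "e = (0, 1)" using e by (auto simp: Basis_space_time)
    have "\<bar>\<eta>\<sigma> w\<bar> = \<bar>\<eta> (fst w, snd w) - \<eta> (fst w, 2 * snd z - snd w)\<bar>"
      by (simp add: \<eta>\<sigma>_def e1 R_apply)
    also have "\<dots> \<le> C * \<bar>snd w - (2 * snd z - snd w)\<bar>"
      using C e1 by (intro test_function_time_lipschitz sm) auto
    also have "\<dots> = 2 * C * (snd z - snd w)" using that by (auto simp: cellU_def)
    finally have "\<bar>\<kappa> w\<bar> * \<bar>\<eta>\<sigma> w\<bar> \<le> Ck0 * (2 * C * (snd z - snd w))"
      using Ck0 that by (intro mult_mono) auto
    then show ?thesis by (simp add: \<zeta>_def e1 abs_mult mult.assoc)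
  qed
  have main: "(LINT w|lebesgue_on cellU. f w * pd \<zeta> e w) = - (LINT w|lebesgue_on cellU. g w * \<zeta> w)"
  proof (rule weak_deriv_up_to_face[OF open_cellU bounded_cellU _ f g w e sm\<zeta> compact_cbox _ KU L])
    show "w \<in> cellU \<Longrightarrow> snd w < snd z" for w by (auto simp: cellU_def)
    show "\<zeta> w \<noteq> 0 \<Longrightarrow> w \<in> ?K" for w using \<kappa>(2) unfolding K \<zeta>_def by auto
  qed
  have ikf: "integrable (lebesgue_on cellC) (\<lambda>w. \<kappa> w * f w)"
    using integrable_mult_smooth[OF fC \<kappa>(1) bounded_cellC] by (simp add: mult.commute)
  have ikg: "integrable (lebesgue_on cellC) (\<lambda>w. \<kappa> w * g w)"
    using integrable_mult_smooth[OF gC \<kappa>(1) bounded_cellC] by (simp add: mult.commute)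
  have ipf: "integrable (lebesgue_on cellC) (\<lambda>w. pd \<kappa> e w * f w)"
    using integrable_mult_smooth[OF fC smooth_pd[OF \<kappa>(1) e] bounded_cellC] by (simp add: mult.commute)
  have m\<eta>: "\<eta> \<in> borel_measurable lebesgue" "pd \<eta> e \<in> borel_measurable lebesgue"
    using smooth_measurable[OF sm, of UNIV] smooth_measurable[OF smooth_pd[OF sm e], of UNIV]
    by (auto simp: lebesgue_on_UNIV_eq)
  have "(LINT w|lebesgue. ext 1 (\<lambda>w. \<kappa> w * f w) w * pd \<eta> e w)
      = (LINT w|lebesgue_on cellU. (\<kappa> w * f w) * (pd \<eta> e w + 1 * pd \<eta> e (R w)))"
    by (rule integral_ext[OF ikf m\<eta>(2) C(3)])
  \<comment> \<open>Product rule for \<open>\<zeta>\<close>: the term in which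
    \<open>\<kappa>\<close> is differentiated is split off and later becomes part of the extended
    derivative.\<close>
  also have "\<dots> = (LINT w|lebesgue_on cellU. f w * pd \<zeta> e w - (pd \<kappa> e w * f w) * \<eta>\<sigma> w)"
    by (intro Bochner_Integration.integral_cong refl) (simp add: pd\<zeta> pd\<sigma> algebra_simps)
  also have "\<dots> = (LINT w|lebesgue_on cellU. f w * pd \<zeta> e w) - (LINT w|lebesgue_on cellU. (pd \<kappa> e w * f w) * \<eta>\<sigma> w)"
    by (intro Bochner_Integration.integral_diff integrable_mult_smooth f integrable_cellU[OF ipf] sm\<sigma> smooth_pd sm\<zeta> e bounded_cellU)
  also have "\<dots> = - ((LINT w|lebesgue_on cellU. g w * \<zeta> w) + (LINT w|lebesgue_on cellU. (pd \<kappa> e w * f w) * \<eta>\<sigma> w))"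
    unfolding main by simp
  also have "\<dots> = - (LINT w|lebesgue_on cellU. g w * \<zeta> w + (pd \<kappa> e w * f w) * \<eta>\<sigma> w)"
    by (subst Bochner_Integration.integral_add)
      (intro refl integrable_mult_smooth g integrable_cellU[OF ipf] sm\<sigma> sm\<zeta> bounded_cellU)+
  also have "\<dots> = - (LINT w|lebesgue_on cellU. (\<kappa> w * g w + pd \<kappa> e w * f w) * (\<eta> w + ?\<sigma> * \<eta> (R w)))"
    by (intro arg_cong[of _ _ uminus] Bochner_Integration.integral_cong refl)
      (simp add: \<zeta>_def \<eta>\<sigma>_def algebra_simps)
  also have "\<dots> = - (LINT w|lebesgue. ext ?\<sigma> (\<lambda>w. \<kappa> w * g w + pd \<kappa> e w * f w) w * \<eta> w)"
    using integral_ext[OF Bochner_Integration.integrable_add[OF ikg ipf] m\<eta>(1) C(2), of ?\<sigma>] by simp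
  finally show "(LINT w|lebesgue_on UNIV. ext 1 (\<lambda>w. \<kappa> w * f w) w * pd \<eta> e w)
      = - (LINT w|lebesgue_on UNIV. ext ?\<sigma> (\<lambda>w. \<kappa> w * g w + pd \<kappa> e w * f w) w * \<eta> w)"
    by (simp add: lebesgue_on_UNIV_eq)
qed

lemma Lp_space_ext:
  assumes h: "h \<in> Lp_space p cellC" and \<sigma>: "\<bar>\<sigma>\<bar> = 1"
  shows "ext \<sigma> h \<in> Lp_space p UNIV"
proof -
  have hm: "h \<in> borel_measurable (lebesgue_on cellC)"
    and fin: "(\<integral>\<^sup>+ w. ennreal (\<bar>h w\<bar> powr p) \<partial>lebesgue_on cellC) < \<infinity>"
    using h by (auto simp: Lp_space_iff)
  have m: "ext \<sigma> h \<in> borel_measurable lebesgue" by (rule measurable_ext[OF hm])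
  have hp: "(\<lambda>w. ennreal (\<bar>h w\<bar> powr p) * indicator cellC w) \<in> borel_measurable lebesgue"
    using hm sets_cellC by (subst borel_measurable_restrict_space_iff_ennreal[symmetric]) auto
  have "(\<integral>\<^sup>+ w. ennreal (\<bar>ext \<sigma> h w\<bar> powr p) \<partial>lebesgue) \<le>
     (\<integral>\<^sup>+ w. ennreal (\<bar>h w\<bar> powr p) * indicator cellC w +
         ennreal (\<bar>h (R w)\<bar> powr p) * indicator cellC (R w) \<partial>lebesgue)"
    using \<sigma> by (intro nn_integral_mono) (auto simp: ext_def abs_mult indicator_def)
  also have "\<dots> = (\<integral>\<^sup>+ w. ennreal (\<bar>h w\<bar> powr p) * indicator cellC w \<partial>lebesgue) +
      (\<integral>\<^sup>+ w. ennreal (\<bar>h (R w)\<bar> powr p) * indicator cellC (R w) \<partial>lebesgue)"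
    using hp measurable_compose[OF refl.measurable_T hp] by (rule nn_integral_add)
  also have "(\<integral>\<^sup>+ w. ennreal (\<bar>h (R w)\<bar> powr p) * indicator cellC (R w) \<partial>lebesgue) =
      (\<integral>\<^sup>+ w. ennreal (\<bar>h w\<bar> powr p) * indicator cellC w \<partial>lebesgue)"
    using refl.nn_integral_T[OF hp] unfolding Jac_R by simp
  also have "(\<integral>\<^sup>+ w. ennreal (\<bar>h w\<bar> powr p) * indicator cellC w \<partial>lebesgue) +
      (\<integral>\<^sup>+ w. ennreal (\<bar>h w\<bar> powr p) * indicator cellC w \<partial>lebesgue) < \<infinity>"
    using fin sets_cellC by (simp add: set_nn_integral_lebesgue_on)
  finally show ?thesis using m by (simp add: Lp_space_iff lebesgue_on_UNIV_eq)
qed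

end

section \<open>Weak derivatives on the whole space and their restriction to open sets\<close>

lemma Lp_space_subset:
  assumes "g \<in> Lp_space p UNIV" "S \<in> sets lebesgue"
  shows "g \<in> Lp_space p S"
proof -
  have m: "g \<in> borel_measurable lebesgue"
    and fin: "(\<integral>\<^sup>+ z. ennreal (\<bar>g z\<bar> powr p) \<partial>lebesgue) < \<infinity>"
    using assms by (auto simp: Lp_space_iff lebesgue_on_UNIV_eq)
  have "(\<integral>\<^sup>+ z. ennreal (\<bar>g z\<bar> powr p) \<partial>lebesgue_on S) \<le> (\<integral>\<^sup>+ z. ennreal (\<bar>g z\<bar> powr p) \<partial>lebesgue)"
    unfolding set_nn_integral_lebesgue_on[OF assms(2)]
    by (intro nn_integral_mono) (auto simp: indicator_def)
  then show ?thesis using m fin by (auto simp: Lp_space_iff intro: measurable_restrict_space1)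
qed

lemma Lp_space_compact_support_integrable:
  assumes "f \<in> Lp_space p UNIV" "1 \<le> p" "k \<in> borel_measurable lebesgue" "\<And>w. \<bar>k w\<bar> \<le> C"
    and "compact K" "\<And>w. w \<notin> K \<Longrightarrow> k w = 0"
  shows "integrable lebesgue (\<lambda>w. f w * k w)"
proof -
  have K: "K \<in> lmeasurable" using assms by (simp add: lmeasurable_compact)
  then have "integrable (lebesgue_on K) f"
    by (intro Lp_space_integrable[OF Lp_space_subset[OF assms(1) fmeasurableD] assms(2)])
  then have "integrable (lebesgue_on K) (\<lambda>w. f w * k w)"
    using assms by (intro integrable_mult_bounded[where C = C] measurable_restrict_space1)
  then have "integrable lebesgue (\<lambda>w. indicator K w *\<^sub>R (f w * k w))"
    using K by (subst (asm) integrable_restrict_space) auto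
  then show ?thesis
    by (rule Bochner_Integration.integrable_cong[THEN iffD1, OF refl, rotated])
      (use assms in \<open>auto simp: indicator_def\<close>)
qed

lemma test_function_mult_integrable:
  assumes "f \<in> Lp_space p UNIV" "1 \<le> p" "\<eta> \<in> test_functions UNIV" "e \<in> Basis"
  shows "integrable lebesgue (\<lambda>w. f w * \<eta> w)" "integrable lebesgue (\<lambda>w. f w * pd \<eta> e w)"
proof -
  obtain C where C: "\<And>w. \<bar>\<eta> w\<bar> \<le> C" "\<And>w. \<bar>pd \<eta> e w\<bar> \<le> C"
    using test_function_bounded[OF assms(3,4)] by auto
  have sm: "smooth \<eta>" and K: "compact (closure {w. \<eta> w \<noteq> 0})"
    using assms by (auto simp: test_functions_def smooth_def)
  have m: "\<eta> \<in> borel_measurable lebesgue" "pd \<eta> e \<in> borel_measurable lebesgue"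
    using smooth_measurable[OF sm, of UNIV] smooth_measurable[OF smooth_pd[OF sm assms(4)], of UNIV]
    by (auto simp: lebesgue_on_UNIV_eq)
  show "integrable lebesgue (\<lambda>w. f w * \<eta> w)"
    by (rule Lp_space_compact_support_integrable[OF assms(1,2) m(1) C(1) K])
      (rule test_function_pd_outside[OF assms(3)])
  show "integrable lebesgue (\<lambda>w. f w * pd \<eta> e w)"
    by (rule Lp_space_compact_support_integrable[OF assms(1,2) m(2) C(2) K])
      (rule test_function_pd_outside[OF assms(3)])
qed

text \<open>Membership in \<open>Lp_space\<close> makes all four pairings with a test function
  integrable, as additivity of the Bochner integral requires.\<close>

lemma weak_deriv_add:
  assumes w: "weak_deriv UNIV e f1 g1" "weak_deriv UNIV e f2 g2"
    and f: "f1 \<in> Lp_space p UNIV" "g1 \<in> Lp_space p UNIV" "f2 \<in> Lp_space p UNIV" "g2 \<in> Lp_space p UNIV"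
    and p: "1 \<le> p" and e: "e \<in> Basis"
  shows "weak_deriv UNIV e (\<lambda>z. f1 z + f2 z) (\<lambda>z. g1 z + g2 z)"
  unfolding weak_deriv_def lebesgue_on_UNIV_eq
proof
  fix \<eta> :: "'a \<Rightarrow> real" assume \<eta>: "\<eta> \<in> test_functions UNIV"
  show "(LINT z|lebesgue. (f1 z + f2 z) * pd \<eta> e z) = - (LINT z|lebesgue. (g1 z + g2 z) * \<eta> z)"
    using w \<eta> test_function_mult_integrable[OF f(1) p \<eta> e] test_function_mult_integrable[OF f(2) p \<eta> e]
      test_function_mult_integrable[OF f(3) p \<eta> e] test_function_mult_integrable[OF f(4) p \<eta> e]
    by (simp add: weak_deriv_def lebesgue_on_UNIV_eq distrib_right)
qed

lemma weak_deriv_cmult: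
  assumes "weak_deriv UNIV e f g"
  shows "weak_deriv UNIV e (\<lambda>z. a * f z) (\<lambda>z. a * g z)"
  using assms by (auto simp: weak_deriv_def mult.assoc)

lemma integral_lebesgue_on_support:
  fixes h :: "'a::euclidean_space \<Rightarrow> real"
  assumes "S \<in> sets lebesgue" "\<And>w. w \<notin> S \<Longrightarrow> h w = 0"
  shows "(LINT w|lebesgue_on S. h w) = (LINT w|lebesgue. h w)"
proof -
  have "(\<lambda>w. indicator S w *\<^sub>R h w) = h" using assms(2) by (auto simp: indicator_def fun_eq_iff)
  then show ?thesis using assms(1) by (simp add: integral_restrict_space)
qed

lemma weak_deriv_open_subset:
  fixes f :: "'a::euclidean_space \<Rightarrow> real"
  assumes w: "weak_deriv UNIV e f g" and U: "open U"
  shows "weak_deriv U e f g"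
  unfolding weak_deriv_def
proof
  fix \<eta> :: "'a \<Rightarrow> real" assume \<eta>: "\<eta> \<in> test_functions U"
  then have \<eta>': "\<eta> \<in> test_functions UNIV" by (auto simp: test_functions_def)
  have out: "w \<notin> U \<Longrightarrow> \<eta> w = 0 \<and> pd \<eta> e w = 0" for w
    using test_function_pd_outside[OF \<eta>, of w] \<eta> unfolding test_functions_def by blast
  have "(LINT z|lebesgue_on U. f z * pd \<eta> e z) = (LINT z|lebesgue. f z * pd \<eta> e z)"
    using U out by (intro integral_lebesgue_on_support) (auto simp: borel_open)
  moreover have "(LINT z|lebesgue_on U. g z * \<eta> z) = (LINT z|lebesgue. g z * \<eta> z)"
    using U out by (intro integral_lebesgue_on_support) (auto simp: borel_open)
  ultimately show "(LINT z|lebesgue_on U. f z * pd \<eta> e z) = - (LINT z|lebesgue_on U. g z * \<eta> z)"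
    using w \<eta>' by (auto simp: weak_deriv_def lebesgue_on_UNIV_eq)
qed

text \<open>Allows a partial derivative of \<open>\<kappa>\<close> to take the place of the cutoff
  in \<open>weak_deriv_ext\<close>, which happens when a product is differentiated twice.\<close>

lemma pd_vanishes_off_support:
  fixes \<kappa> :: "'a::euclidean_space \<Rightarrow> real"
  assumes "\<And>w b. \<kappa> w \<noteq> 0 \<Longrightarrow> b \<in> Basis \<Longrightarrow> \<bar>(w - z) \<bullet> b\<bar> \<le> d"
    and "pd \<kappa> e w \<noteq> 0" "b \<in> Basis"
  shows "\<bar>(w - z) \<bullet> b\<bar> \<le> d"
proof (rule ccontr)
  let ?S = "{w. d < \<bar>(w - z) \<bullet> b\<bar>}"
  assume "\<not> ?thesis"
  then have w: "w \<in> ?S" by simp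
  have S: "open ?S" by (intro open_Collect_less continuous_intros)
  have 0: "0 = \<kappa> w" if "w \<in> ?S" for w using assms(1)[of w b] assms(3) that by force
  have "((\<lambda>w. 0) has_derivative (\<lambda>h. 0)) (at w)" by simp
  then have "(\<kappa> has_derivative (\<lambda>h. 0)) (at w)"
    by (rule has_derivative_transform_within_open[OF _ S w 0])
  from pd_eqI[OF this, of e] show False using assms(2) by simp
qed

lemma pd_box_cutoff_center:
  assumes "0 < \<rho>" "\<And>b. b \<in> Basis \<Longrightarrow> \<bar>(w - z) \<bullet> b\<bar> < \<rho>"
  shows "pd (box_cutoff z \<rho>) e w = 0" "pd (pd (box_cutoff z \<rho>) e) e' w = 0"
proof -
  let ?S = "{w. \<forall>b\<in>Basis. \<bar>(w - z) \<bullet> b\<bar> < \<rho>}"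
  have "?S = (\<Inter>b\<in>Basis. {w. \<bar>(w - z) \<bullet> b\<bar> < \<rho>})" by auto
  moreover have "open {w. \<bar>(w - z) \<bullet> b\<bar> < \<rho>}" for b by (intro open_Collect_less continuous_intros)
  ultimately have S: "open ?S" by auto
  have const: "pd g e w = 0" if "w \<in> ?S" "\<And>w. w \<in> ?S \<Longrightarrow> g w = c" for g :: "'a \<Rightarrow> real" and c e w
  proof -
    have "((\<lambda>w. c) has_derivative (\<lambda>h. 0)) (at w)" by simp
    then have "(g has_derivative (\<lambda>h. 0)) (at w)"
      by (rule has_derivative_transform_within_open[OF _ S that(1)]) (simp add: that(2))
    then show ?thesis by (rule pd_eqI)
  qed
  have 1: "pd (box_cutoff z \<rho>) e w = 0" if "w \<in> ?S" for w e
    using that by (rule const[where c = 1]) (use assms(1) in \<open>auto intro!: box_cutoff_1 less_imp_le\<close>)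
  then show "pd (box_cutoff z \<rho>) e w = 0" using assms(2) by auto
  show "pd (pd (box_cutoff z \<rho>) e) e' w = 0"
    by (rule const[where c = 0]) (use assms(2) 1 in auto)
qed

context cell
begin

lemma ext_add: "ext \<sigma> (\<lambda>w. f w + g w) = (\<lambda>w. ext \<sigma> f w + ext \<sigma> g w)"
  by (auto simp: ext_def fun_eq_iff algebra_simps)

lemma continuous_on_ext:
  assumes \<phi>: "continuous_on cellC \<phi>"
    and \<kappa>: "smooth \<kappa>" "\<And>w b. \<kappa> w \<noteq> 0 \<Longrightarrow> b \<in> Basis \<Longrightarrow> \<bar>(w - z) \<bullet> b\<bar> \<le> 2 * \<rho>"
  shows "continuous_on UNIV (ext 1 (\<lambda>w. \<kappa> w * \<phi> w))"
proof -
  \<comment> \<open>Folding map onto the times up to \<open>snd z\<close>. On the doubled cell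
    \<open>?V\<close> the even extension of \<open>h\<close> is \<open>h \<circ> P\<close>, hence
    continuous across the face; the open set \<open>?W\<close>, where the cutoff vanishes, covers
    the rest.\<close>
  define P where "P w = (fst w, snd z - \<bar>snd w - snd z\<bar>)" for w :: "(real^'n) \<times> real"
  let ?V = "base \<times> {snd z - 3 * \<rho> <..< snd z + 3 * \<rho>}"
  let ?W = "{w. \<exists>b\<in>Basis. 2 * \<rho> < \<bar>(w - z) \<bullet> b\<bar>}"
  have eq: "ext 1 h w = (if P w \<in> cellC then h (P w) else 0)" for h w
    by (cases w, cases "snd w \<le> snd z")
      (auto simp: ext_def P_def cellC_def R_apply abs_if)
  have "open ?V" by (intro open_Times open_base) auto
  have "?W = (\<Union>b\<in>Basis. {w. 2 * \<rho> < \<bar>(w - z) \<bullet> b\<bar>})" by auto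
  moreover have "open {w. 2 * \<rho> < \<bar>(w - z) \<bullet> b\<bar>}" for b by (intro open_Collect_less continuous_intros)
  ultimately have "open ?W" by auto
  have cP: "continuous_on ?V P" unfolding P_def by (intro continuous_intros)
  have PV: "P ` ?V \<subseteq> cellC" by (auto simp: P_def cellC_def)
  have "continuous_on ?V (\<lambda>w. \<kappa> (P w) * \<phi> (P w))"
    by (intro continuous_intros continuous_on_compose2[OF \<phi> cP PV]
        continuous_on_compose2[OF smooth_continuous[OF \<kappa>(1)] cP PV])
  then have 1: "continuous_on ?V (ext 1 (\<lambda>w. \<kappa> w * \<phi> w))"
    by (rule continuous_on_eq) (use PV in \<open>auto simp: eq\<close>)
  have 0: "ext 1 (\<lambda>w. \<kappa> w * \<phi> w) w = 0" if "w \<in> ?W" for w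
  proof -
    from that obtain b where b: "b \<in> Basis" "2 * \<rho> < \<bar>(w - z) \<bullet> b\<bar>" by blast
    then have "\<bar>(P w - z) \<bullet> b\<bar> = \<bar>(w - z) \<bullet> b\<bar>" by (auto simp: Basis_space_time P_def inner_prod_def)
    then have "\<kappa> (P w) = 0" using \<kappa>(2)[of "P w" b] b by auto
    then show ?thesis by (simp add: eq)
  qed
  have 2: "continuous_on ?W (ext 1 (\<lambda>w. \<kappa> w * \<phi> w))"
    by (rule continuous_on_eq[OF continuous_on_const[of _ 0]]) (simp add: 0)
  have "w \<in> ?V" if "w \<notin> ?W" for w
  proof -
    have *: "\<bar>(w - z) \<bullet> b\<bar> \<le> 2 * \<rho>" if "b \<in> Basis" for b using that \<open>w \<notin> ?W\<close> by force
    have "\<bar>fst w $ i - fst z $ i\<bar> < 3 * \<rho>" for i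
    proof -
      have "(axis i 1, 0) \<in> (Basis :: ((real^'n) \<times> real) set)" by (auto simp: Basis_space_time)
      from *[OF this] show ?thesis using rho_pos by (simp add: inner_prod_def inner_axis)
    qed
    moreover have "\<bar>snd w - snd z\<bar> \<le> 2 * \<rho>"
      using *[of "(0, 1)"] by (simp add: Basis_space_time inner_prod_def)
    ultimately show ?thesis using rho_pos by (auto simp: base_def mem_Times_iff)
  qed
  then have "UNIV = ?V \<union> ?W" by auto
  then show ?thesis using continuous_on_open_Un[OF \<open>open ?V\<close> \<open>open ?W\<close> 1 2] by simp
qed

text \<open>The witness extends \<open>\<kappa> * \<phi>\<close> for a box cutoff
  \<open>\<kappa>\<close>, with derivatives from the product rule. Near \<open>z\<close> the
  functions agree at every point of \<open>cellC\<close>, face included, since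
  \<open>\<kappa>\<close> is 1 there and its derivatives vanish; this carries over both the touching
  condition and the essential suprema.\<close>

lemma test_function_extension:
  assumes p: "1 \<le> p" and W: "W21 p cellC \<phi> \<phi>t D\<phi> D2\<phi>" and \<phi>: "continuous_on cellC \<phi>"
  obtains \<psi> \<psi>t D\<psi> D2\<psi> where "continuous_on UNIV \<psi>" "W21 p UNIV \<psi> \<psi>t D\<psi> D2\<psi>"
    "\<And>w. w \<in> cellC \<Longrightarrow> (\<And>b. b \<in> Basis \<Longrightarrow> \<bar>(w - z) \<bullet> b\<bar> < \<rho>) \<Longrightarrow>
      \<psi> w = \<phi> w \<and> \<psi>t w = \<phi>t w \<and> D\<psi> w = D\<phi> w \<and> D2\<psi> w = D2\<phi> w"
proof -
  define \<kappa> where "\<kappa> = box_cutoff z \<rho>"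
  let ?e = "\<lambda>k. (axis k 1, 0) :: (real^'n) \<times> real"
  have e: "?e k \<in> Basis" for k by (auto simp: Basis_space_time)
  have t: "(0, 1) \<in> (Basis :: ((real^'n) \<times> real) set)" by (auto simp: Basis_space_time)
  have sm: "smooth \<kappa>" unfolding \<kappa>_def by (rule smooth_box_cutoff[OF rho_pos])
  have supp: "\<kappa> w \<noteq> 0 \<Longrightarrow> b \<in> Basis \<Longrightarrow> \<bar>(w - z) \<bullet> b\<bar> \<le> 2 * \<rho>" for w b
    using box_cutoff_0[OF rho_pos, of b w z] unfolding \<kappa>_def by force
  have smk: "smooth (pd \<kappa> (?e k))" for k by (rule smooth_pd[OF sm e])
  have suppk: "pd \<kappa> (?e k) w \<noteq> 0 \<Longrightarrow> b \<in> Basis \<Longrightarrow> \<bar>(w - z) \<bullet> b\<bar> \<le> 2 * \<rho>" for k w b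
    by (rule pd_vanishes_off_support[OF supp])
  have L: "\<phi> \<in> Lp_space p cellC" "\<phi>t \<in> Lp_space p cellC" "(\<lambda>w. D\<phi> w $ k) \<in> Lp_space p cellC"
      "(\<lambda>w. D2\<phi> w $ k $ l) \<in> Lp_space p cellC" for k l
    using W by (auto simp: W21_def)
  have d: "weak_deriv cellU (0, 1) \<phi> \<phi>t" "weak_deriv cellU (?e k) \<phi> (\<lambda>w. D\<phi> w $ k)"
      "weak_deriv cellU (?e l) (\<lambda>w. D\<phi> w $ k) (\<lambda>w. D2\<phi> w $ k $ l)" for k l
    using W by (auto simp: W21_def interior_cellC)
  have lm: "cellC \<in> lmeasurable" by (intro bounded_set_imp_lmeasurable bounded_cellC sets_cellC)
  note I = L[THEN Lp_space_integrable[OF _ p lm]]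
  have mult: "smooth k \<Longrightarrow> g \<in> Lp_space p cellC \<Longrightarrow> (\<lambda>w. k w * g w) \<in> Lp_space p cellC" for k g
    using p by (intro Lp_space_mult_smooth bounded_cellC) auto
  have add: "f \<in> Lp_space p cellC \<Longrightarrow> g \<in> Lp_space p cellC \<Longrightarrow> (\<lambda>w. f w + g w) \<in> Lp_space p cellC" for f g
    using p by (intro Lp_space_add) auto
  define \<psi> where "\<psi> = ext 1 (\<lambda>w. \<kappa> w * \<phi> w)"
  define \<psi>t where "\<psi>t = ext (- 1) (\<lambda>w. \<kappa> w * \<phi>t w + pd \<kappa> (0, 1) w * \<phi> w)"
  define D\<psi> where "D\<psi> w = (\<chi> k. ext 1 (\<lambda>w. \<kappa> w * D\<phi> w $ k + pd \<kappa> (?e k) w * \<phi> w) w)" for w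
  \<comment> \<open>The gradient is the sum of the extensions of \<open>\<kappa> * D\<phi>\<close>
    and \<open>pd \<kappa> * \<phi>\<close>. Each summand is differentiated by
    \<open>weak_deriv_ext\<close>, the second with \<open>pd \<kappa>\<close> in the role of the
    cutoff.\<close>
  define D2\<psi> where "D2\<psi> w = (\<chi> k l. ext 1 (\<lambda>w. \<kappa> w * D2\<phi> w $ k $ l + pd \<kappa> (?e l) w * D\<phi> w $ k) w +
      ext 1 (\<lambda>w. pd \<kappa> (?e k) w * D\<phi> w $ l + pd (pd \<kappa> (?e k)) (?e l) w * \<phi> w) w)" for w
  show ?thesis
  proof
    show "continuous_on UNIV \<psi>" unfolding \<psi>_def by (rule continuous_on_ext[OF \<phi> sm supp])
    have Lk: "ext 1 (\<lambda>w. \<kappa> w * D2\<phi> w $ k $ l + pd \<kappa> (?e l) w * D\<phi> w $ k) \<in> Lp_space p UNIV"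
      "ext 1 (\<lambda>w. pd \<kappa> (?e k) w * D\<phi> w $ l + pd (pd \<kappa> (?e k)) (?e l) w * \<phi> w) \<in> Lp_space p UNIV"
      "ext 1 (\<lambda>w. \<kappa> w * D\<phi> w $ k) \<in> Lp_space p UNIV"
      "ext 1 (\<lambda>w. pd \<kappa> (?e k) w * \<phi> w) \<in> Lp_space p UNIV" for k l
      by (auto intro!: Lp_space_ext add mult L sm smk smooth_pd[OF smk] e)
    have "\<psi> \<in> Lp_space p UNIV" unfolding \<psi>_def by (intro Lp_space_ext mult sm L) simp
    moreover have "\<psi>t \<in> Lp_space p UNIV"
      unfolding \<psi>t_def by (intro Lp_space_ext add mult sm smooth_pd[OF sm t] L) simp
    moreover have "(\<lambda>w. D\<psi> w $ k) \<in> Lp_space p UNIV" for k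
      unfolding D\<psi>_def vec_lambda_beta by (intro Lp_space_ext add mult sm smk L) simp
    moreover have "(\<lambda>w. D2\<psi> w $ k $ l) \<in> Lp_space p UNIV" for k l
      unfolding D2\<psi>_def vec_lambda_beta using p by (intro Lp_space_add Lk) auto
    moreover have "weak_deriv UNIV (0, 1) \<psi> \<psi>t"
      using weak_deriv_ext[OF I(1) I(2) d(1) t sm supp] by (simp add: \<psi>_def \<psi>t_def)
    moreover have "weak_deriv UNIV (?e k) \<psi> (\<lambda>w. D\<psi> w $ k)" for k
      using weak_deriv_ext[OF I(1) I(3) d(2) e sm supp, of k] by (simp add: \<psi>_def D\<psi>_def)
    moreover have "weak_deriv UNIV (?e l) (\<lambda>w. D\<psi> w $ k) (\<lambda>w. D2\<psi> w $ k $ l)" for k l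
    proof -
      have "weak_deriv UNIV (?e l) (ext 1 (\<lambda>w. \<kappa> w * D\<phi> w $ k))
          (ext 1 (\<lambda>w. \<kappa> w * D2\<phi> w $ k $ l + pd \<kappa> (?e l) w * D\<phi> w $ k))"
        using weak_deriv_ext[OF I(3) I(4) d(3) e sm supp, of l k] by simp
      moreover have "weak_deriv UNIV (?e l) (ext 1 (\<lambda>w. pd \<kappa> (?e k) w * \<phi> w))
          (ext 1 (\<lambda>w. pd \<kappa> (?e k) w * D\<phi> w $ l + pd (pd \<kappa> (?e k)) (?e l) w * \<phi> w))"
        using weak_deriv_ext[OF I(1) I(3) d(2) e smk[of k] suppk[where k = k], of l] by simp
      ultimately show ?thesis
        unfolding D\<psi>_def D2\<psi>_def vec_lambda_beta ext_add[of 1 "\<lambda>w. \<kappa> w * D\<phi> w $ k"]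
        by (rule weak_deriv_add[OF _ _ Lk(3) Lk(1) Lk(4) Lk(2) p e])
    qed
    ultimately show "W21 p UNIV \<psi> \<psi>t D\<psi> D2\<psi>" by (simp add: W21_def)
  next
    fix w assume w: "w \<in> cellC" and b: "\<And>b. b \<in> Basis \<Longrightarrow> \<bar>(w - z) \<bullet> b\<bar> < \<rho>"
    have "\<kappa> w = 1" unfolding \<kappa>_def using b by (intro box_cutoff_1 rho_pos less_imp_le)
    moreover have "pd \<kappa> e w = 0" "pd (pd \<kappa> e) e' w = 0" for e e'
      unfolding \<kappa>_def by (rule pd_box_cutoff_center[OF rho_pos b], assumption)+
    ultimately show "\<psi> w = \<phi> w \<and> \<psi>t w = \<phi>t w \<and> D\<psi> w = D\<phi> w \<and> D2\<psi> w = D2\<phi> w"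
      using w by (simp add: \<psi>_def \<psi>t_def D\<psi>_def D2\<psi>_def ext_def vec_eq_iff)
  qed
qed

end

section \<open>Pucci operators and parabolic scaling\<close>

lemma mat_mult_vector: "mat c *v x = c *\<^sub>R (x :: real^'n)"
  by (simp add: matrix_vector_mult_def mat_def vec_eq_iff if_distrib[of "\<lambda>y. y * _"] cong: if_cong)

text \<open>A real-valued \<open>SUP\<close> is meaningful only over a set bounded above. The
  entries are bounded by polarisation: the quadratic form at \<open>axis i 1\<close> controls the
  diagonal, and its value at \<open>axis i 1 + axis j 1\<close> then controls the other entries by
  symmetry.\<close>

lemma elliptic_trace_bdd:
  assumes "lam \<le> Lam"
  shows "bdd_above ((\<lambda>A. - trace (A ** X)) ` (elliptic_matrices lam Lam :: (real^'n^'n) set))"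
proof -
  define L where "L = 2 * (\<bar>lam\<bar> + \<bar>Lam\<bar>)"
  have q: "(axis i 1 + s *\<^sub>R axis j 1) \<bullet> (A *v (axis i 1 + s *\<^sub>R axis j 1)) =
      A $ i $ i + s * (A $ i $ j) + s * (A $ j $ i) + s * s * A $ j $ j" for A :: "real^'n^'n" and i j s
    by (simp add: matrix_vector_right_distrib matrix_vector_mult_scaleR matrix_vector_mult_basis
        inner_add_left inner_add_right inner_axis' column_def algebra_simps)
  have ax: "(axis i 1 + s *\<^sub>R axis j 1) \<bullet> (axis i 1 + s *\<^sub>R axis j 1 :: real^'n) =
      (if i = j then (1 + s) * (1 + s) else 1 + s * s)" for i j and s :: real
    by (auto simp: inner_add_left inner_add_right inner_axis_axis algebra_simps)
  have entry: "\<bar>A $ i $ j\<bar> \<le> L" if A: "A \<in> elliptic_matrices lam Lam" for A :: "real^'n^'n" and i j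
  proof -
    have sym: "A $ j $ i = A $ i $ j" for i j
      using A by (auto simp: elliptic_matrices_def transpose_def vec_eq_iff)
    have lo: "lam * (\<xi> \<bullet> \<xi>) \<le> \<xi> \<bullet> (A *v \<xi>)" and up: "\<xi> \<bullet> (A *v \<xi>) \<le> Lam * (\<xi> \<bullet> \<xi>)" for \<xi>
      using A by (auto simp: elliptic_matrices_def loewner_le_def mat_mult_vector)
    have d: "lam \<le> A $ i $ i" "A $ i $ i \<le> Lam" for i
      using lo[of "axis i 1 + 0 *\<^sub>R axis i 1"] up[of "axis i 1 + 0 *\<^sub>R axis i 1"]
      unfolding q ax by auto
    show ?thesis
    proof (cases "i = j")
      case True
      then show ?thesis using d[of j] unfolding L_def by auto
    next
      case False
      then show ?thesis
        using lo[of "axis i 1 + 1 *\<^sub>R axis j 1"] up[of "axis i 1 + 1 *\<^sub>R axis j 1"] d[of i] d[of j]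
        unfolding q ax sym[of j i] L_def by simp
    qed
  qed
  show ?thesis
  proof (rule bdd_aboveI2)
    fix A :: "real^'n^'n" assume A: "A \<in> elliptic_matrices lam Lam"
    have "- trace (A ** X) \<le> \<bar>\<Sum>i\<in>UNIV. \<Sum>k\<in>UNIV. A $ i $ k * X $ k $ i\<bar>"
      by (simp add: trace_def matrix_matrix_mult_def)
    also have "\<dots> \<le> (\<Sum>i\<in>UNIV. \<Sum>k\<in>UNIV. L * \<bar>X $ k $ i\<bar>)"
      by (intro order_trans[OF sum_abs] sum_mono) (auto simp: abs_mult intro!: mult_right_mono entry A)
    finally show "- trace (A ** X) \<le> (\<Sum>i\<in>UNIV. \<Sum>k\<in>UNIV. L * \<bar>X $ k $ i\<bar>)" .
  qed
qed

text \<open>The change of sign interchanges infimum and supremum. This identity is what turns a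
  subsolution for \<open>pucci_minus\<close> into a supersolution for
  \<open>pucci_plus\<close>.\<close>

lemma pucci_minus_neg_scale:
  fixes X :: "real^'n^'n"
  assumes "lam \<le> Lam" "0 < c"
  shows "pucci_minus lam Lam ((- c) *\<^sub>R X) = - c * pucci_plus lam Lam X"
proof -
  let ?E = "elliptic_matrices lam Lam :: (real^'n^'n) set"
  have "mat lam \<in> ?E"
    using assms by (auto simp: elliptic_matrices_def loewner_le_def mat_mult_vector transpose_mat intro: mult_right_mono)
  then have ne: "?E \<noteq> {}" by auto
  have tr: "- trace (A ** ((- c) *\<^sub>R X)) = - (c * - trace (A ** X))" for A :: "real^'n^'n"
    by (simp add: trace_def matrix_matrix_mult_def sum_negf sum_distrib_left mult_ac)
  have bdd: "bdd_above ((\<lambda>A. - trace (A ** X)) ` ?E)" by (rule elliptic_trace_bdd[OF assms(1)])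
  have "pucci_minus lam Lam ((- c) *\<^sub>R X) = (INF A\<in>?E. - (c * - trace (A ** X)))"
    unfolding pucci_minus_def tr ..
  also have "\<dots> = - (SUP A\<in>?E. c * - trace (A ** X))"
    by (simp add: Inf_real_def image_image)
  also have "(SUP A\<in>?E. c * - trace (A ** X)) = c * (SUP A\<in>?E. - trace (A ** X))"
    using continuous_at_Sup_mono[of "\<lambda>x. c * x" "(\<lambda>A. - trace (A ** X)) ` ?E"] assms ne bdd
    by (simp add: mono_def image_image continuous_intros)
  finally show ?thesis by (simp add: pucci_plus_def)
qed

text \<open>\<open>Lim\<close> is a definite description, so its value can be used only once
  convergence is known; for essential suprema over shrinking cylinders convergence comes from
  monotonicity.\<close>

lemma mono_tendsto_INF_at_right:
  fixes g :: "real \<Rightarrow> ereal"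
  assumes "\<And>x y. 0 < x \<Longrightarrow> x \<le> y \<Longrightarrow> g x \<le> g y"
  shows "(g \<longlongrightarrow> (INF x\<in>{0<..}. g x)) (at_right 0)"
proof (rule order_tendstoI)
  fix a assume "a < (INF x\<in>{0<..}. g x)"
  then have "a < g x" if "0 < x" for x using that by (meson INF_lower greaterThan_iff less_le_trans)
  then show "\<forall>\<^sub>F x in at_right 0. a < g x"
    by (auto simp: eventually_at_filter)
next
  fix a assume "(INF x\<in>{0<..}. g x) < a"
  then obtain x where x: "0 < x" "g x < a" by (auto simp: INF_less_iff)
  have "g y < a" if "0 < y" "y < x" for y using assms[of y x] that x(2) by auto
  then show "\<forall>\<^sub>F y in at_right 0. g y < a"
    unfolding eventually_at_right_field using x(1) by blast
qed

section \<open>Geometry of cubes and cylinders, and essential suprema over them\<close>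

lemma mem_cube: "x \<in> cube r \<longleftrightarrow> (\<forall>i. \<bar>x $ i\<bar> < r)"
proof -
  have "- r < y \<and> y < r \<longleftrightarrow> \<bar>y\<bar> < r" for y :: real by auto
  then show ?thesis by (simp add: cube_def)
qed

lemma mem_Qr: "w \<in> Qr r z \<longleftrightarrow>
    (\<forall>i. \<bar>fst w $ i - fst z $ i\<bar> < r) \<and> snd z - r\<^sup>2 < snd w \<and> snd w \<le> snd z"
proof
  assume "w \<in> Qr r z"
  then obtain v where "w = z + v" "fst v \<in> cube r" "snd v \<in> {- (r\<^sup>2)<..0}" by (auto simp: Qr_def)
  then show "(\<forall>i. \<bar>fst w $ i - fst z $ i\<bar> < r) \<and> snd z - r\<^sup>2 < snd w \<and> snd w \<le> snd z"
    by (auto simp: mem_cube)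
next
  assume "(\<forall>i. \<bar>fst w $ i - fst z $ i\<bar> < r) \<and> snd z - r\<^sup>2 < snd w \<and> snd w \<le> snd z"
  then have "w - z \<in> cube r \<times> {- (r\<^sup>2)<..0}" by (auto simp: mem_cube mem_Times_iff)
  then show "w \<in> Qr r z" unfolding Qr_def by (intro image_eqI[of _ _ "w - z"]) auto
qed

lemma open_cube: "open (cube r :: (real^'n) set)"
proof -
  have "(cube r :: (real^'n) set) = (\<Inter>i. {x. - r < x $ i} \<inter> {x. x $ i < r})" by (auto simp: cube_def)
  moreover have "open ({x :: real^'n. - r < x $ i} \<inter> {x. x $ i < r})" for i
    by (intro open_Int open_Collect_less continuous_intros)
  ultimately show ?thesis by auto
qed

lemma Qr_eq: "Qr r z = (\<lambda>y. y - fst z) -` cube r \<times> {snd z - r\<^sup>2 <.. snd z}"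
  by (auto simp: mem_Qr mem_cube)

lemma sets_Qr: "Qr r z \<in> sets lebesgue"
proof -
  have "open ((\<lambda>y. y - fst z) -` cube r)"
    by (intro open_vimage open_cube continuous_intros)
  then have "Qr r z \<in> sets borel" unfolding Qr_eq by (intro borel_Times) auto
  then show ?thesis by simp
qed

lemma Qr_mono: "0 < r \<Longrightarrow> r \<le> r' \<Longrightarrow> Qr r z \<subseteq> Qr r' z"
proof
  fix w assume r: "0 < r" "r \<le> r'" and w: "w \<in> Qr r z"
  have "r\<^sup>2 \<le> r'\<^sup>2" using r by (intro power_mono) auto
  then have "snd z - r'\<^sup>2 < snd w" using w unfolding mem_Qr by linarith
  then show "w \<in> Qr r' z" using r w unfolding mem_Qr by (auto intro: less_le_trans)
qed

text \<open>Inclusion is the case of the identity map in \<open>esssup_on_T_le\<close>.\<close>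

lemma esssup_on_mono:
  assumes "S \<in> sets lebesgue" "S' \<in> sets lebesgue" "S \<subseteq> S'"
  shows "esssup_on S h \<le> esssup_on S' h"
proof -
  interpret diag_affine 0 "\<lambda>_ :: 'a. 1" by unfold_locales auto
  have "daff 0 (\<lambda>_. 1) x = x" for x :: 'a by (rule euclidean_eqI) (simp add: daff_inner)
  then show ?thesis using esssup_on_T_le[of S S' h] assms by auto
qed

lemma esssup_on_cong:
  assumes "\<And>w. w \<in> S \<Longrightarrow> g w = h w"
  shows "esssup_on S g = esssup_on S h"
proof -
  have m: "(\<lambda>z. ereal (g z)) \<in> borel_measurable (lebesgue_on S) \<longleftrightarrow>
      (\<lambda>z. ereal (h z)) \<in> borel_measurable (lebesgue_on S)"
    using assms by (intro measurable_cong) auto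
  show ?thesis
  proof (cases "(\<lambda>z. ereal (h z)) \<in> borel_measurable (lebesgue_on S)")
    case True
    then show ?thesis unfolding esssup_on_def
      using m assms by (intro esssup_AE_cong AE_I2) auto
  next
    case False
    then show ?thesis unfolding esssup_on_def using m by (simp add: esssup_non_measurable)
  qed
qed

section \<open>Transport of Sobolev functions by the parabolic dilation\<close>

context diag_affine
begin

lemma Lp_space_compose_T:
  assumes "g \<in> Lp_space p UNIV"
  shows "(\<lambda>z. g (T z)) \<in> Lp_space p UNIV"
proof -
  have m: "g \<in> borel_measurable lebesgue"
    and fin: "(\<integral>\<^sup>+ z. ennreal (\<bar>g z\<bar> powr p) \<partial>lebesgue) < \<infinity>"
    using assms by (auto simp: Lp_space_iff lebesgue_on_UNIV_eq)
  have "(\<lambda>z. ennreal (\<bar>g z\<bar> powr p)) \<in> borel_measurable lebesgue" using m by auto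
  from nn_integral_T[OF this] fin Jac_pos
  have "(\<integral>\<^sup>+ z. ennreal (\<bar>g (T z)\<bar> powr p) \<partial>lebesgue) < \<infinity>"
    using c_nonzero by (auto simp: ennreal_mult_less_top)
  then show ?thesis using m borel_measurable_T_iff by (auto simp: Lp_space_iff lebesgue_on_UNIV_eq)
qed

end

text \<open>The translation part is such that the top centre \<open>(0, 10)\<close> of
  \<open>Q\<close> goes to \<open>(x0, t0)\<close>.\<close>

lemma daff_parabolic:
  fixes x0 :: "real^'n"
  shows "daff (x0, t0 - 10 * r\<^sup>2) (\<lambda>j. if snd j = 0 then r else r\<^sup>2) w =
    (x0 + r *\<^sub>R fst w, t0 + r\<^sup>2 * (snd w - 10))"
proof (rule euclidean_eqI)
  fix b :: "(real^'n) \<times> real" assume "b \<in> Basis"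
  then show "daff (x0, t0 - 10 * r\<^sup>2) (\<lambda>j. if snd j = 0 then r else r\<^sup>2) w \<bullet> b =
      (x0 + r *\<^sub>R fst w, t0 + r\<^sup>2 * (snd w - 10)) \<bullet> b"
    unfolding daff_inner[OF \<open>b \<in> Basis\<close>]
    by (auto simp: Basis_space_time inner_prod_def inner_add_left algebra_simps)
qed

text \<open>Chain rule for the inverse dilation: each spatial derivative costs \<open>1 / r\<close>,
  the time derivative \<open>1 / r^2\<close>. The factor \<open>- a\<close> will undo the sign and
  the normalisation of the rescaled supersolution.\<close>

lemma W21_compose_daff:
  fixes t :: "(real^'n) \<times> real"
  assumes W: "W21 p UNIV \<psi> \<psi>t D\<psi> D2\<psi>" and p: "0 \<le> p" and r: "0 < r" and S: "S \<in> sets lebesgue"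
  defines "V \<equiv> daff t (\<lambda>j. if snd j = 0 then 1 / r else 1 / r\<^sup>2)"
  shows "W21 p S (\<lambda>w. - a * \<psi> (V w)) (\<lambda>w. - (a / r\<^sup>2) * \<psi>t (V w))
    (\<lambda>w. (- (a / r)) *\<^sub>R D\<psi> (V w)) (\<lambda>w. (- (a / r\<^sup>2)) *\<^sub>R D2\<psi> (V w))"
proof -
  interpret diag_affine t "\<lambda>j. if snd j = 0 then 1 / r else 1 / r\<^sup>2" using r by unfold_locales auto
  let ?e = "\<lambda>k. (axis k 1, 0) :: (real^'n) \<times> real"
  have e: "?e k \<in> Basis" for k by (auto simp: Basis_space_time)
  have t: "(0, 1) \<in> (Basis :: ((real^'n) \<times> real) set)" by (auto simp: Basis_space_time)
  have L: "\<psi> \<in> Lp_space p UNIV" "\<psi>t \<in> Lp_space p UNIV" "(\<lambda>w. D\<psi> w $ k) \<in> Lp_space p UNIV"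
      "(\<lambda>w. D2\<psi> w $ k $ l) \<in> Lp_space p UNIV" for k l
    using W by (auto simp: W21_def)
  have d: "weak_deriv UNIV (0, 1) \<psi> \<psi>t" "weak_deriv UNIV (?e k) \<psi> (\<lambda>w. D\<psi> w $ k)"
      "weak_deriv UNIV (?e l) (\<lambda>w. D\<psi> w $ k) (\<lambda>w. D2\<psi> w $ k $ l)" for k l
    using W by (auto simp: W21_def)
  have c: "(\<lambda>w. c * g (V w)) \<in> Lp_space p S" if "g \<in> Lp_space p UNIV" for c g
  proof -
    have *: "(\<lambda>w. g (V w)) \<in> Lp_space p S"
      unfolding V_def by (rule Lp_space_subset[OF Lp_space_compose_T[OF that] S])
    then show ?thesis using p by (intro Lp_space_bound[OF *, where C = "\<bar>c\<bar>"])
        (auto simp: Lp_space_iff abs_mult)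
  qed
  have w: "weak_deriv (interior S) e (\<lambda>w. c * f (V w))
      (\<lambda>w. c * ((if snd e = 0 then 1 / r else 1 / r\<^sup>2) * g (V w)))"
    if "weak_deriv UNIV e f g" "e \<in> Basis" for c e f g
    unfolding V_def
    by (rule weak_deriv_open_subset[OF weak_deriv_cmult[OF weak_deriv_compose_T[OF that]] open_interior])
  show ?thesis
    unfolding W21_def
    using c[OF L(1), where c = "- a"] c[OF L(2), where c = "- (a / r\<^sup>2)"]
      c[OF L(3), where c = "- (a / r)"] c[OF L(4), where c = "- (a / r\<^sup>2)"]
      w[OF d(1) t, where c = "- a"] w[OF d(2) e, where c = "- a"] w[OF d(3) e, where c = "- (a / r)"]
    by (simp add: power2_eq_square)
qed

lemma cell_in_cylinder:
  fixes z :: "(real^'n) \<times> real"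
  assumes "z \<in> pcyl (cube 10) 10"
  obtains \<rho> where "0 < \<rho>" "pcompactly_in (cell.cellC z \<rho>) (cube 10) 10"
proof -
  have z: "\<And>i. \<bar>fst z $ i\<bar> < 10" "0 < snd z" "snd z \<le> 10"
    using assms by (auto simp: pcyl_def mem_cube)
  \<comment> \<open>The smallest of the height above the bottom and the distances to the lateral
    faces; the top does not belong to the parabolic boundary, so \<open>snd z = 10\<close> is
    allowed. Dividing by 4 leaves a margin \<open>\<rho>\<close> around the cell of half-width
    \<open>3 * \<rho>\<close>.\<close>
  define m where "m = Min (insert (snd z) (range (\<lambda>i. 10 - \<bar>fst z $ i\<bar>)))"
  define \<rho> where "\<rho> = m / 4"
  have m: "0 < m" "m \<le> snd z" "m \<le> 10 - \<bar>fst z $ i\<bar>" for i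
    unfolding m_def using z by (auto simp: Min_gr_iff simp del: Min_insert intro!: Min_le)
  have \<rho>: "0 < \<rho>" "3 * \<rho> \<le> snd z - \<rho>" "\<bar>fst z $ i\<bar> + 3 * \<rho> \<le> 10 - \<rho>" for i
    unfolding \<rho>_def using m(1,2) m(3)[of i] by linarith+
  interpret cell z \<rho> by unfold_locales (rule \<rho>)
  have b: "\<bar>y $ i\<bar> < 10 - \<rho>" if "y \<in> base" for y i
  proof -
    have "\<bar>y $ i - fst z $ i\<bar> < 3 * \<rho>" using that by (simp add: base_def)
    then show ?thesis using \<rho>(3)[of i] by linarith
  qed
  have "cellC \<subseteq> pcyl (cube 10) 10"
  proof
    fix v assume v: "v \<in> cellC"
    then have "\<bar>fst v $ i\<bar> < 10" for i using b[of "fst v" i] \<rho>(1) by (auto simp: cellC_def)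
    then show "v \<in> pcyl (cube 10) 10"
      using v \<rho>(1,2) z by (auto simp: cellC_def pcyl_def mem_cube mem_Times_iff)
  qed
  moreover have "0 < pdist_set cellC (pboundary (cube 10) 10)"
  proof -
    \<comment> \<open>A margin \<open>\<rho>\<close> in space contributes \<open>\<rho>\<close> to
      \<open>pdist\<close>, a margin \<open>\<rho>\<close> in time contributes its square
      root.\<close>
    have "ereal (min \<rho> (sqrt \<rho>)) \<le> pdist_set cellC (pboundary (cube 10) 10)"
      unfolding pdist_set_def
    proof (intro INF_greatest)
      fix v w assume v: "v \<in> cellC" and w: "w \<in> pboundary (cube 10 :: (real^'n) set) 10"
      have "fst v \<in> base" using v by (auto simp: cellC_def)
      show "ereal (min \<rho> (sqrt \<rho>)) \<le> ereal (pdist v w)"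
      proof (cases "snd w = 0")
        case True
        then have "\<rho> \<le> \<bar>snd v - snd w\<bar>" using v \<rho> by (auto simp: cellC_def)
        then have "sqrt \<rho> \<le> pdist v w" unfolding pdist_def by (intro real_sqrt_le_mono) (simp add: add_increasing)
        then show ?thesis by (simp add: min_le_iff_disj)
      next
        case False
        then have "fst w \<notin> cube 10"
          using w interior_open[OF open_cube[of 10]] by (auto simp: pboundary_def frontier_def)
        then obtain i where "10 \<le> \<bar>fst w $ i\<bar>" by (auto simp: mem_cube not_less)
        then have "\<rho> \<le> \<bar>(fst v - fst w) $ i\<bar>" using b[OF \<open>fst v \<in> base\<close>, of i] by simp
        also have "\<dots> \<le> norm (fst v - fst w)" by (rule component_le_norm_cart)
        finally have "\<rho>\<^sup>2 \<le> (norm (fst v - fst w))\<^sup>2" using \<rho> by (intro power_mono) auto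
        then have "sqrt (\<rho>\<^sup>2) \<le> pdist v w" unfolding pdist_def by (intro real_sqrt_le_mono) simp
        then show ?thesis using \<rho> by (simp add: min_le_iff_disj)
      qed
    qed
    moreover have "0 < ereal (min \<rho> (sqrt \<rho>))" using \<rho> by simp
    ultimately show ?thesis by (rule less_le_trans[rotated])
  qed
  ultimately show ?thesis using that[of \<rho>] \<rho> sets_cellC by (simp add: pcompactly_in_def)
qed

text \<open>Parabolic scaling. Adding constants to a test function is harmless, so the transported test
  function omits \<open>b\<close>, and no weak derivative of a constant is needed.\<close>

lemma supersol_of_scaled_subsol:
  fixes x0 :: "real^'n" and t0 :: real and u \<mu> f :: "(real^'n) \<times> real \<Rightarrow> real"
  assumes p: "1 \<le> p" and r: "0 < r" and a: "0 < a" and lam: "lam \<le> Lam"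
    and u: "Lp_visc_subsol p (cube 10) 10 (\<lambda>z \<xi> X. pucci_minus lam Lam X - \<mu> z * norm \<xi> - f z) u"
  defines "\<Phi> \<equiv> \<lambda>w. (x0 + r *\<^sub>R fst w, t0 + r\<^sup>2 * (snd w - 10))"
  assumes sub: "\<And>w. w \<in> pcyl (cube 10) 10 \<Longrightarrow> \<Phi> w \<in> pcyl (cube 10) 10"
  shows "Lp_visc_supersol p (cube 10) 10
    (\<lambda>z \<xi> X. pucci_plus lam Lam X + (r * \<mu> (\<Phi> z)) * norm \<xi> + r\<^sup>2 / a * f (\<Phi> z))
    (\<lambda>w. (b - u (\<Phi> w)) / a)"
  unfolding Lp_visc_supersol_def
proof (intro conjI allI impI ballI)
  have cu: "continuous_on (pcyl (cube 10) 10) u" using u by (simp add: Lp_visc_subsol_def)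
  have "continuous_on (pcyl (cube 10) 10) \<Phi>" unfolding \<Phi>_def by (intro continuous_intros)
  then have "continuous_on (pcyl (cube 10) 10) (\<lambda>w. u (\<Phi> w))"
    using sub by (intro continuous_on_compose2[OF cu]) auto
  then show "continuous_on (pcyl (cube 10) 10) (\<lambda>w. (b - u (\<Phi> w)) / a)"
    using a by (intro continuous_intros) auto
next
  fix \<phi> \<phi>t :: "(real^'n) \<times> real \<Rightarrow> real" and D\<phi> :: "(real^'n) \<times> real \<Rightarrow> real^'n"
    and D2\<phi> :: "(real^'n) \<times> real \<Rightarrow> real^'n^'n" and z :: "(real^'n) \<times> real"
  assume "continuous_on (pcyl (cube 10) 10) \<phi> \<and> W21_loc p (cube 10) 10 \<phi> \<phi>t D\<phi> D2\<phi>"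
  then have c\<phi>: "continuous_on (pcyl (cube 10) 10) \<phi>" and W\<phi>: "W21_loc p (cube 10) 10 \<phi> \<phi>t D\<phi> D2\<phi>" by auto
  assume z: "z \<in> pcyl (cube 10) 10"
  assume "\<exists>\<delta>>0. Qr \<delta> z \<subseteq> pcyl (cube 10) 10 \<and>
    (\<forall>w\<in>Qr \<delta> z. (b - u (\<Phi> z)) / a - \<phi> z \<le> (b - u (\<Phi> w)) / a - \<phi> w)"
  then obtain \<delta> where \<delta>: "0 < \<delta>" "Qr \<delta> z \<subseteq> pcyl (cube 10) 10"
    "\<And>w. w \<in> Qr \<delta> z \<Longrightarrow> (b - u (\<Phi> z)) / a - \<phi> z \<le> (b - u (\<Phi> w)) / a - \<phi> w" by blast
  define G where "G w = \<phi>t w + (pucci_plus lam Lam (D2\<phi> w) + (r * \<mu> (\<Phi> w)) * norm (D\<phi> w) + r\<^sup>2 / a * f (\<Phi> w))" for w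
  define g where "g \<epsilon> = esssup_on (Qr \<epsilon> z) G" for \<epsilon>
  \<comment> \<open>Only the values of \<open>\<phi>\<close> near \<open>z\<close> at times up to
    \<open>snd z\<close> matter, so it suffices to extend \<open>\<phi>\<close> from a cell around
    \<open>z\<close>; on this cell \<open>\<phi>\<close> is in \<open>W21\<close>, not merely
    locally.\<close>
  obtain \<rho> where \<rho>: "0 < \<rho>" "pcompactly_in (cell.cellC z \<rho>) (cube 10) 10"
    using cell_in_cylinder[OF z] by blast
  interpret C: cell z \<rho> by unfold_locales (rule \<rho>)
  have cC: "continuous_on C.cellC \<phi>" and WC: "W21 p C.cellC \<phi> \<phi>t D\<phi> D2\<phi>"
    using W\<phi> \<rho> c\<phi> continuous_on_subset by (auto simp: W21_loc_def pcompactly_in_def)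
  obtain \<psi> \<psi>t D\<psi> D2\<psi> where c\<psi>: "continuous_on UNIV \<psi>" and W\<psi>: "W21 p UNIV \<psi> \<psi>t D\<psi> D2\<psi>"
    and agree: "\<And>w. w \<in> C.cellC \<Longrightarrow> (\<And>b. b \<in> Basis \<Longrightarrow> \<bar>(w - z) \<bullet> b\<bar> < \<rho>) \<Longrightarrow>
      \<psi> w = \<phi> w \<and> \<psi>t w = \<phi>t w \<and> D\<psi> w = D\<phi> w \<and> D2\<psi> w = D2\<phi> w"
    by (rule C.test_function_extension[OF p WC cC]) blast
  interpret diag_affine "(x0, t0 - 10 * r\<^sup>2)" "\<lambda>j. if snd j = 0 then r else r\<^sup>2"
    using r by unfold_locales auto
  have T: "T w = \<Phi> w" for w unfolding \<Phi>_def by (rule daff_parabolic)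
  define V where "V = T'"
  have V: "V (\<Phi> w) = w" for w using T'_T[of w] by (simp add: V_def T)
  have \<Phi>V: "\<Phi> (V w) = w" for w using T_T'[of w] by (simp add: V_def T)
  have V_eq: "V = daff (- (\<Sum>j\<in>Basis. ((x0, t0 - 10 * r\<^sup>2) \<bullet> j / (if snd j = 0 then r else r\<^sup>2)) *\<^sub>R j))
      (\<lambda>j. if snd j = 0 then 1 / r else 1 / r\<^sup>2)"
    unfolding V_def by (simp add: if_distrib[of "\<lambda>x. 1 / x"])
  have img: "\<Phi> ` Qr \<epsilon> z = Qr (r * \<epsilon>) (\<Phi> z)" for \<epsilon>
  proof -
    have mem: "w \<in> Qr \<epsilon> z \<longleftrightarrow> \<Phi> w \<in> Qr (r * \<epsilon>) (\<Phi> z)" for w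
    proof -
      have "\<bar>r * x - r * y\<bar> < r * \<epsilon> \<longleftrightarrow> \<bar>x - y\<bar> < \<epsilon>" for x y
        using r by (simp add: right_diff_distrib[symmetric] abs_mult)
      moreover have "r\<^sup>2 * x - (r * \<epsilon>)\<^sup>2 < r\<^sup>2 * y \<longleftrightarrow> x - \<epsilon>\<^sup>2 < y" for x y
        using r by (simp add: power_mult_distrib right_diff_distrib[symmetric])
      from this[of "snd z - 10" "snd w - 10"]
      have "t0 + r\<^sup>2 * (snd z - 10) - (r * \<epsilon>)\<^sup>2 < t0 + r\<^sup>2 * (snd w - 10) \<longleftrightarrow> snd z - \<epsilon>\<^sup>2 < snd w"
        by (simp add: algebra_simps)
      ultimately show ?thesis using r by (simp add: mem_Qr \<Phi>_def)
    qed
    show ?thesis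
    proof
      show "\<Phi> ` Qr \<epsilon> z \<subseteq> Qr (r * \<epsilon>) (\<Phi> z)" by (rule image_subsetI) (simp add: mem)
      show "Qr (r * \<epsilon>) (\<Phi> z) \<subseteq> \<Phi> ` Qr \<epsilon> z"
      proof
        fix w assume "w \<in> Qr (r * \<epsilon>) (\<Phi> z)"
        then show "w \<in> \<Phi> ` Qr \<epsilon> z" by (intro image_eqI[of _ _ "V w"]) (simp_all add: mem \<Phi>V)
      qed
    qed
  qed
  have near: "w \<in> C.cellC \<and> (\<forall>b\<in>Basis. \<bar>(w - z) \<bullet> b\<bar> < \<rho>)" if "w \<in> Qr \<epsilon> z" "\<epsilon> \<le> \<rho>" "\<epsilon>\<^sup>2 \<le> \<rho>" for w \<epsilon>
  proof -
    have *: "\<bar>fst w $ i - fst z $ i\<bar> < \<rho>" for i using that by (auto simp: mem_Qr intro: less_le_trans)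
    moreover have "\<bar>fst w $ i - fst z $ i\<bar> < 3 * \<rho>" for i using *[of i] \<rho>(1) by simp
    moreover have "snd z - \<rho> < snd w" "snd w \<le> snd z" using that by (auto simp: mem_Qr)
    ultimately show ?thesis using \<rho>(1)
      by (auto simp: C.cellC_def C.base_def mem_Times_iff Basis_space_time inner_prod_def inner_axis)
  qed
  have ag: "\<psi> w = \<phi> w \<and> \<psi>t w = \<phi>t w \<and> D\<psi> w = D\<phi> w \<and> D2\<psi> w = D2\<phi> w"
    if "w \<in> Qr \<epsilon> z" "\<epsilon> \<le> \<rho>" "\<epsilon>\<^sup>2 \<le> \<rho>" for w \<epsilon>
    using near[OF that] agree[of w] by blast
  \<comment> \<open>\<open>Qr \<epsilon> z\<close> has half-width \<open>\<epsilon>\<close> in space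
    but depth \<open>\<epsilon>^2\<close> in time; both must fit into the box of half-width
    \<open>\<rho>\<close> on which the extension agrees with \<open>\<phi>\<close>.\<close>
  define \<delta>' where "\<delta>' = min \<delta> (min \<rho> (sqrt \<rho>))"
  have \<delta>': "0 < \<delta>'" "\<delta>' \<le> \<delta>" "\<delta>' \<le> \<rho>" using \<delta> \<rho> by (auto simp: \<delta>'_def)
  have sq: "\<epsilon>\<^sup>2 \<le> \<rho>" if "0 < \<epsilon>" "\<epsilon> \<le> \<delta>'" for \<epsilon>
  proof -
    have "\<epsilon>\<^sup>2 \<le> (sqrt \<rho>)\<^sup>2" using that by (intro power_mono) (auto simp: \<delta>'_def)
    then show ?thesis using \<rho> by simp
  qed
  note zz = Qr_mono[OF \<delta>'(1,2), of z]
  \<comment> \<open>\<open>(b - u \<circ> \<Phi>) / a - \<phi>\<close> has a minimum at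
    \<open>z\<close> exactly when \<open>u + a * (\<phi> \<circ> V)\<close> has a maximum at
    \<open>\<Phi> z\<close>. This dictates the test function for \<open>u\<close>, with
    \<open>\<phi>\<close> replaced by its extension \<open>\<psi>\<close>.\<close>
  let ?\<phi> = "\<lambda>w. - a * \<psi> (V w)" and ?\<phi>t = "\<lambda>w. - (a / r\<^sup>2) * \<psi>t (V w)"
    and ?D = "\<lambda>w. (- (a / r)) *\<^sub>R D\<psi> (V w)" and ?D2 = "\<lambda>w. (- (a / r\<^sup>2)) *\<^sub>R D2\<psi> (V w)"
  have "continuous_on (pcyl (cube 10) 10) ?\<phi>"
    unfolding V_def by (intro continuous_intros continuous_on_compose2[OF c\<psi> continuous_on_daff]) auto
  moreover have "W21_loc p (cube 10) 10 ?\<phi> ?\<phi>t ?D ?D2"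
    unfolding W21_loc_def pcompactly_in_def V_eq
    using W21_compose_daff[OF W\<psi> _ r] p by auto
  moreover have "\<Phi> z \<in> pcyl (cube 10) 10" by (rule sub[OF z])
  moreover have "\<exists>d>0. Qr d (\<Phi> z) \<subseteq> pcyl (cube 10) 10 \<and>
      (\<forall>w\<in>Qr d (\<Phi> z). u w - ?\<phi> w \<le> u (\<Phi> z) - ?\<phi> (\<Phi> z))"
  proof (intro exI[of _ "r * \<delta>'"] conjI ballI)
    show "0 < r * \<delta>'" using r \<delta>' by simp
    show "Qr (r * \<delta>') (\<Phi> z) \<subseteq> pcyl (cube 10) 10"
      unfolding img[symmetric] using zz \<delta>(2) sub by blast
    fix w assume "w \<in> Qr (r * \<delta>') (\<Phi> z)"
    then obtain v where v: "v \<in> Qr \<delta>' z" "w = \<Phi> v" unfolding img[symmetric] by blast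
    have "z \<in> Qr \<delta>' z" using \<delta>'(1) by (simp add: mem_Qr)
    then have "\<psi> z = \<phi> z" "\<psi> v = \<phi> v" using ag[OF _ \<delta>'(3) sq] v \<delta>' by auto
    moreover have "(b - u (\<Phi> z)) / a - \<phi> z \<le> (b - u (\<Phi> v)) / a - \<phi> v" using \<delta>(3) v zz by blast
    then have "a * ((b - u (\<Phi> z)) / a - \<phi> z) \<le> a * ((b - u (\<Phi> v)) / a - \<phi> v)"
      using a by (intro mult_left_mono) auto
    moreover have "a * (x / a - y) = x - a * y" for x y using a by (simp add: field_simps)
    ultimately show "u w - ?\<phi> w \<le> u (\<Phi> z) - ?\<phi> (\<Phi> z)" by (simp add: v V del: times_divide_eq_right)
  qed
  ultimately have Lim_le: "Lim (at_right 0) (\<lambda>\<epsilon>. essinf_on (Qr \<epsilon> (\<Phi> z))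
      (\<lambda>w. ?\<phi>t w + (pucci_minus lam Lam (?D2 w) - \<mu> w * norm (?D w) - f w))) \<le> 0"
    (is "Lim _ ?E \<le> 0")
    using u[unfolded Lp_visc_subsol_def, THEN conjunct2, rule_format, of ?\<phi> ?\<phi>t ?D ?D2 "\<Phi> z"]
    by blast
  have ar: "0 < a / r\<^sup>2" using a r by simp
  \<comment> \<open>On small cylinders the operator at the transported test function is
    \<open>- (a / r^2)\<close> times the operator \<open>G\<close> at \<open>\<phi>\<close>, so the
    essential infimum becomes an essential supremum.\<close>
  have E: "?E \<epsilon> = - (ereal (a / r\<^sup>2) * g (\<epsilon> / r))" if \<epsilon>: "0 < \<epsilon>" "\<epsilon> \<le> r * \<delta>'" for \<epsilon>
  proof -
    let ?h = "\<lambda>w. ?\<phi>t w + (pucci_minus lam Lam (?D2 w) - \<mu> w * norm (?D w) - f w)"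
    have er: "0 < \<epsilon> / r" "\<epsilon> / r \<le> \<delta>'" using \<epsilon> r by (auto simp: field_simps)
    have Q: "Qr \<epsilon> (\<Phi> z) = T ` Qr (\<epsilon> / r) z" using img[of "\<epsilon> / r"] r by (simp add: T)
    have h: "- ?h (T w) = a / r\<^sup>2 * G w" if "w \<in> Qr (\<epsilon> / r) z" for w
    proof -
      have 1: "?h (T w) = - (a / r\<^sup>2) * \<phi>t w + (- (a / r\<^sup>2) * pucci_plus lam Lam (D2\<phi> w)
          - \<mu> (\<Phi> w) * (a / r * norm (D\<phi> w)) - f (\<Phi> w))"
        using ag[OF that _ sq[OF er]] er \<delta>'(3) a r
        by (simp only: T V pucci_minus_neg_scale[OF lam ar]) simp
      have 2: "- (- (a / r\<^sup>2) * \<phi>t w + (- (a / r\<^sup>2) * pucci_plus lam Lam (D2\<phi> w)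
          - \<mu> (\<Phi> w) * (a / r * norm (D\<phi> w)) - f (\<Phi> w))) = a / r\<^sup>2 * G w"
        using a r by (simp add: G_def field_simps power2_eq_square)
      show ?thesis unfolding 1 by (rule 2)
    qed
    have "?E \<epsilon> = - esssup_on (Qr \<epsilon> (\<Phi> z)) (\<lambda>w. - ?h w)"
      by (simp add: essinf_on_def esssup_on_def)
    also have "esssup_on (Qr \<epsilon> (\<Phi> z)) (\<lambda>w. - ?h w) = esssup_on (Qr (\<epsilon> / r) z) (\<lambda>w. - ?h (T w))"
      unfolding Q by (rule esssup_on_image_T[OF sets_Qr])
    also have "\<dots> = esssup_on (Qr (\<epsilon> / r) z) (\<lambda>w. a / r\<^sup>2 * G w)"
      by (rule esssup_on_cong) (rule h)
    also have "\<dots> = ereal (a / r\<^sup>2) * g (\<epsilon> / r)"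
      using esssup_cmult[OF ar, of "lebesgue_on (Qr (\<epsilon> / r) z)" "\<lambda>w. ereal (G w)"]
      by (simp add: g_def esssup_on_def)
    finally show ?thesis .
  qed
  define L where "L = (INF x\<in>{0<..}. g x)"
  have "g x \<le> g y" if "0 < x" "x \<le> y" for x y
    unfolding g_def by (intro esssup_on_mono sets_Qr Qr_mono that)
  then have gL: "(g \<longlongrightarrow> L) (at_right 0)" unfolding L_def by (rule mono_tendsto_INF_at_right)
  have "filterlim (\<lambda>\<epsilon>. \<epsilon> / r) (at_right 0) (at_right 0)" using r by real_asymp
  from filterlim_compose[OF gL this]
  have "((\<lambda>\<epsilon>. - (ereal (a / r\<^sup>2) * g (\<epsilon> / r))) \<longlongrightarrow> - (ereal (a / r\<^sup>2) * L)) (at_right 0)"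
    using ar by (intro tendsto_uminus_ereal tendsto_cmult_ereal) auto
  then have "(?E \<longlongrightarrow> - (ereal (a / r\<^sup>2) * L)) (at_right 0)"
  proof (rule Lim_transform_eventually)
    have "\<forall>\<^sub>F \<epsilon> in at_right 0. 0 < \<epsilon> \<and> \<epsilon> < r * \<delta>'"
      using r \<delta>' by (auto simp: eventually_at_right_field intro!: exI[of _ "r * \<delta>'"])
    then show "\<forall>\<^sub>F \<epsilon> in at_right 0. - (ereal (a / r\<^sup>2) * g (\<epsilon> / r)) = ?E \<epsilon>"
      by (rule eventually_mono) (use E in auto)
  qed
  then have "Lim (at_right 0) ?E = - (ereal (a / r\<^sup>2) * L)" by (intro tendsto_Lim) auto
  then have "0 \<le> ereal (a / r\<^sup>2) * L" using Lim_le by (simp add: ereal_uminus_le_0_iff)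
  \<comment> \<open>\<open>L\<close> may be infinite, so the positive factor is cancelled by cases
    on \<open>ereal\<close>.\<close>
  moreover have "0 \<le> ereal c * L \<Longrightarrow> 0 < c \<Longrightarrow> 0 \<le> L" for c
    by (cases L) (auto simp: zero_le_mult_iff)
  ultimately have "0 \<le> L" using ar by blast
  moreover have "Lim (at_right 0) g = L" using gL by (intro tendsto_Lim) auto
  ultimately show "0 \<le> Lim (at_right 0) (\<lambda>\<epsilon>. esssup_on (Qr \<epsilon> z)
      (\<lambda>w. \<phi>t w + (pucci_plus lam Lam (D2\<phi> w) + r * \<mu> (\<Phi> w) * norm (D\<phi> w) + r\<^sup>2 / a * f (\<Phi> w))))"
    by (simp add: g_def[abs_def] G_def[abs_def])
qed

section \<open>Growth along shrinking cylinders\<close>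

lemma cube_mono: "r \<le> r' \<Longrightarrow> cube r \<subseteq> cube r'"
  unfolding mem_cube subset_iff by (meson less_le_trans)

lemma lmeasurable_Times_cube:
  "(cube r :: (real^'n) set) \<times> {a<..b :: real} \<in> lmeasurable"
proof (rule bounded_set_imp_lmeasurable)
  have "bounded (cube r :: (real^'n) set)"
    unfolding bounded_iff
  proof (intro exI ballI)
    fix y :: "real^'n" assume "y \<in> cube r"
    then have "(\<Sum>i\<in>UNIV. \<bar>y $ i\<bar>) \<le> (\<Sum>i\<in>(UNIV :: 'n set). r)"
      by (intro sum_mono) (auto simp: mem_cube less_imp_le)
    then show "norm y \<le> (\<Sum>i\<in>(UNIV :: 'n set). r)" using norm_le_l1_cart[of y] by linarith
  qed
  then show "bounded ((cube r :: (real^'n) set) \<times> {a<..b})"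
    by (intro bounded_Times bounded_subset[OF bounded_closed_interval[of a b]]) auto
  have "(cube r :: (real^'n) set) \<times> {a<..b} \<in> sets borel"
    by (intro borel_Times borel_open[OF open_cube]) auto
  then show "(cube r :: (real^'n) set) \<times> {a<..b} \<in> sets lebesgue" by simp
qed

lemma measure_J1_pos: "0 < measure lebesgue (J1 :: ((real^'n) \<times> real) set)"
proof (rule ccontr)
  have m: "(J1 :: ((real^'n) \<times> real) set) \<in> lmeasurable"
    unfolding J1_def by (rule lmeasurable_Times_cube)
  assume "\<not> ?thesis"
  then have "measure lebesgue (J1 :: ((real^'n) \<times> real) set) = 0"
    using measure_nonneg[of lebesgue "J1 :: ((real^'n) \<times> real) set"] by linarith
  then have "negligible (J1 :: ((real^'n) \<times> real) set)" using m by (simp add: negligible_iff_measure)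
  then have "negligible ((cube 1 :: (real^'n) set) \<times> {0<..<1/2 :: real})"
    by (rule negligible_subset) (auto simp: J1_def)
  moreover have "open ((cube 1 :: (real^'n) set) \<times> {0<..<1/2 :: real})"
    by (intro open_Times open_cube) auto
  moreover have "(0, 1/4) \<in> (cube 1 :: (real^'n) set) \<times> {0<..<1/2 :: real}" by (simp add: mem_cube)
  ultimately show False using open_not_negligible by blast
qed

lemma lmeasurable_sublevel:
  assumes "continuous_on S h" "S \<in> lmeasurable"
  shows "{z\<in>S. h z \<le> (c::real)} \<in> lmeasurable"
proof -
  have "closedin (top_of_set S) (S \<inter> h -` {..c})"
    using assms by (intro continuous_closedin_preimage) auto
  then obtain K where K: "closed K" "S \<inter> h -` {..c} = S \<inter> K" by (auto simp: closedin_closed)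
  have "S \<inter> K \<in> lmeasurable"
    using assms(2) K(1) by (intro fmeasurable_Int_fmeasurable) (auto simp: borel_closed)
  moreover have "{z\<in>S. h z \<le> c} = S \<inter> h -` {..c}" by auto
  ultimately show ?thesis using K by simp
qed

lemma lmeasurable_superlevel:
  assumes "continuous_on S h" "S \<in> lmeasurable"
  shows "{z\<in>S. (c::real) < h z} \<in> lmeasurable"
proof -
  have "S - {z\<in>S. h z \<le> c} \<in> lmeasurable"
    using assms lmeasurable_sublevel[OF assms] by (intro fmeasurable_Diff) auto
  moreover have "S - {z\<in>S. h z \<le> c} = {z\<in>S. c < h z}" by auto
  ultimately show ?thesis by simp
qed

text \<open>The \<open>n\<close> spatial directions contribute \<open>r\<close> each and time
  contributes \<open>r^2\<close>, whence the parabolic dimension \<open>n + 2\<close>.\<close>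

lemma parabolic_jacobian:
  fixes r :: real
  assumes "0 \<le> r"
  shows "(\<Prod>j\<in>(Basis :: ((real^'n) \<times> real) set). \<bar>if snd j = 0 then r else r\<^sup>2\<bar>) = r ^ (CARD('n) + 2)"
proof -
  let ?e = "\<lambda>i::'n. (axis i 1, 0) :: (real^'n) \<times> real"
  have B: "(Basis :: ((real^'n) \<times> real) set) = insert (0, 1) (range ?e)"
    by (auto simp: Basis_space_time)
  have "inj ?e" by (auto simp: inj_on_def axis_eq_axis)
  then have "(\<Prod>j\<in>range ?e. \<bar>if snd j = 0 then r else r\<^sup>2\<bar>) = r ^ CARD('n)"
    using assms by (subst prod.reindex) (simp_all add: abs_of_nonneg)
  then show ?thesis unfolding B using assms
    by (subst prod.insert) (auto simp: power_add power2_eq_square)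
qed

text \<open>Chebyshev's inequality: the integrand is at least \<open>H powr e\<close> wherever
  \<open>H < u\<close>.\<close>

lemma measure_superlevel_le_Lp_norm:
  assumes S: "S \<in> lmeasurable" "continuous_on S u"
    and e: "0 < e" and H: "0 < H" and N: "0 \<le> N" "Lp_norm e S (\<lambda>z. max (u z) 0) \<le> ennreal N"
  shows "measure lebesgue {z\<in>S. H < u z} \<le> (N / H) powr e"
proof -
  let ?I = "\<integral>\<^sup>+ z. ennreal (\<bar>max (u z) 0\<bar> powr e) \<partial>lebesgue_on S"
  let ?A = "{z\<in>S. H < u z}"
  have A: "?A \<in> lmeasurable" by (rule lmeasurable_superlevel[OF S(2,1)])
  \<comment> \<open>\<open>enn2real\<close> sends infinity to 0, so finiteness is secured before
    passing to real numbers.\<close>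
  have fin: "?I \<noteq> \<infinity>" using N by (auto simp: Lp_norm_def Let_def top_unique split: if_splits)
  then have "enn2real ?I powr (1 / e) \<le> N" using N by (simp add: Lp_norm_def Let_def)
  then have "(enn2real ?I powr (1 / e)) powr e \<le> N powr e" using e by (intro powr_mono2) auto
  then have I: "enn2real ?I \<le> N powr e" using e by (simp add: powr_powr)
  have "ennreal (H powr e) * emeasure lebesgue ?A = (\<integral>\<^sup>+ z. ennreal (H powr e) * indicator ?A z \<partial>lebesgue)"
    using A by (subst nn_integral_cmult_indicator) (auto simp: fmeasurable_def)
  also have "\<dots> \<le> (\<integral>\<^sup>+ z. ennreal (\<bar>max (u z) 0\<bar> powr e) * indicator S z \<partial>lebesgue)"
    using H e by (intro nn_integral_mono) (auto simp: indicator_def intro!: ennreal_leI powr_mono2)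
  also have "\<dots> = ?I" using S by (simp add: set_nn_integral_lebesgue_on fmeasurableD)
  finally have "enn2real (ennreal (H powr e) * emeasure lebesgue ?A) \<le> enn2real ?I"
    using fin by (intro enn2real_mono) (auto simp: less_top)
  then have "H powr e * measure lebesgue ?A \<le> N powr e"
    using I by (simp add: enn2real_mult measure_def)
  then show ?thesis using H N by (simp add: powr_divide field_simps)
qed

text \<open>If \<open>u\<close> reaches \<open>H\<close> at the top centre of a small cylinder on which it stays below \<open>\<nu> * H\<close>, then
  \<open>(\<nu> * H - u) / ((\<nu> - 1) * H)\<close>, rescaled to \<open>Q\<close>, is a nonnegative supersolution with infimum at most 1
  over \<open>J2\<close>. It is at least \<open>(\<nu> - 1/2) / (\<nu> - 1)\<close> exactly where \<open>u \<le> H / 2\<close>, which is a large number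
  for \<open>\<nu>\<close> close to 1.\<close>

lemma growth_step:
  fixes u \<mu> f :: "(real^'n) \<times> real \<Rightarrow> real" and x0 :: "real^'n"
  assumes lam: "lam \<le> Lam" and p: "1 \<le> p" "real CARD('n) + 2 \<le> 2 * p" and q: "real CARD('n) + 2 \<le> q"
    and dec: "decay_constants TYPE('n) lam Lam p q M A0 \<beta>0 \<epsilon>1"
    and \<mu>: "\<mu> \<in> Lp_nonneg q Q" "Lp_norm q Q \<mu> \<le> ennreal M"
    and f: "f \<in> Lp_nonneg p Q" "Lp_norm p Q f \<le> ennreal (\<epsilon>1 * ((\<nu> - 1) * H))"
    and u: "Lp_visc_subsol p (cube 10) 10 (\<lambda>z \<xi> X. pucci_minus lam Lam X - \<mu> z * norm \<xi> - f z) u"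
    and \<nu>: "1 < \<nu>" "A0 * ((\<nu> - 1/2) / (\<nu> - 1)) powr (- \<beta>0) \<le> measure lebesgue (J1 :: ((real^'n) \<times> real) set) / 2"
    and H: "0 < H" and r: "0 < r" "r \<le> 1"
    and x0: "\<And>i. \<bar>x0 $ i\<bar> + 10 * r \<le> 1" and t0: "10 * r\<^sup>2 < t0" "t0 \<le> 1/2"
    and large: "H \<le> u (x0, t0)"
    and upper: "\<And>x t. (\<And>i. \<bar>x $ i - x0 $ i\<bar> < 10 * r) \<Longrightarrow> t0 - 10 * r\<^sup>2 < t \<Longrightarrow> t \<le> t0 \<Longrightarrow> u (x, t) \<le> \<nu> * H"
  shows "r ^ (CARD('n) + 2) * (measure lebesgue (J1 :: ((real^'n) \<times> real) set) / 2)
    \<le> measure lebesgue {z\<in>J1. H / 2 < u z}"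
proof -
  define a where "a = (\<nu> - 1) * H"
  have a: "0 < a" using \<nu> H by (simp add: a_def)
  define \<Phi> where "\<Phi> = (\<lambda>w :: (real^'n) \<times> real. (x0 + r *\<^sub>R fst w, t0 + r\<^sup>2 * (snd w - 10)))"
  interpret diag_affine "(x0, t0 - 10 * r\<^sup>2)" "\<lambda>j :: (real^'n) \<times> real. if snd j = 0 then r else r\<^sup>2"
    using r by unfold_locales auto
  have T: "T = \<Phi>" by (simp add: fun_eq_iff \<Phi>_def daff_parabolic)
  have Jac: "Jac = r ^ (CARD('n) + 2)" using r by (intro parabolic_jacobian) auto
  have Jac_powr: "Jac = r powr (real CARD('n) + 2)"
    unfolding Jac using r by (subst powr_realpow[symmetric]) (auto simp: add.commute)
  have \<Phi>Q: "(\<forall>i. \<bar>fst (\<Phi> w) $ i - x0 $ i\<bar> < 10 * r) \<and> t0 - 10 * r\<^sup>2 < snd (\<Phi> w) \<and> snd (\<Phi> w) \<le> t0"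
    if "w \<in> Q" for w
  proof -
    have w: "\<And>i. \<bar>fst w $ i\<bar> < 10" "0 < snd w" "snd w \<le> 10"
      using that by (auto simp: Q_def pcyl_def mem_cube)
    have "\<bar>fst (\<Phi> w) $ i - x0 $ i\<bar> < 10 * r" for i
      using w(1)[of i] r by (simp add: \<Phi>_def abs_mult)
    moreover have "r\<^sup>2 * snd w > 0" "r\<^sup>2 * snd w \<le> r\<^sup>2 * 10" using w r by auto
    ultimately show ?thesis by (simp add: \<Phi>_def algebra_simps)
  qed
  have sub: "\<Phi> w \<in> Q" if "w \<in> Q" for w
  proof -
    have "\<bar>fst (\<Phi> w) $ i\<bar> < 10" for i
    proof -
      have "\<bar>fst (\<Phi> w) $ i - x0 $ i\<bar> < 10 * r" using \<Phi>Q[OF that] by blast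
      then show ?thesis using x0[of i] by linarith
    qed
    then show ?thesis using \<Phi>Q[OF that] t0 by (auto simp: Q_def pcyl_def mem_cube mem_Times_iff)
  qed
  have J1Q: "(J1 :: ((real^'n) \<times> real) set) \<subseteq> Q"
    using cube_mono[of 1 10] by (auto simp: J1_def Q_def pcyl_def)
  \<comment> \<open>The conclusion counts only points of \<open>J1\<close>, the set on which the
    \<open>\<epsilon>0\<close>-norm controls \<open>u\<close>; so the rescaled copy of
    \<open>J1\<close> has to stay inside \<open>J1\<close>.\<close>
  have subJ: "\<Phi> w \<in> J1" if "w \<in> J1" for w
  proof -
    have w: "\<And>i. \<bar>fst w $ i\<bar> < 1" "w \<in> Q"
      using that J1Q by (auto simp: J1_def mem_cube)
    have "\<bar>fst (\<Phi> w) $ i\<bar> < 1" for i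
    proof -
      have "\<bar>r * fst w $ i\<bar> < r" using w(1)[of i] r by (simp add: abs_mult)
      then show ?thesis using x0[of i] r by (simp add: \<Phi>_def)
    qed
    then show ?thesis using \<Phi>Q[OF w(2)] t0 by (auto simp: J1_def mem_cube mem_Times_iff)
  qed
  have Qm: "(Q :: ((real^'n) \<times> real) set) \<in> sets lebesgue"
    unfolding Q_def pcyl_def using lmeasurable_Times_cube[of 10 0 10] by (rule fmeasurableD)
  have TQ: "T ` Q \<subseteq> Q" using sub by (auto simp: T)
  define w where "w = (\<lambda>z. (\<nu> * H - u (\<Phi> z)) / a)"
  have "Lp_visc_supersol p (cube 10) 10
    (\<lambda>z \<xi> X. pucci_plus lam Lam X + (r * \<mu> (\<Phi> z)) * norm \<xi> + r\<^sup>2 / a * f (\<Phi> z)) w"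
    unfolding w_def \<Phi>_def
    by (rule supersol_of_scaled_subsol[OF p(1) r(1) a lam u])
      (use sub in \<open>simp add: Q_def \<Phi>_def\<close>)
  moreover have "(\<lambda>z. r * \<mu> (\<Phi> z)) \<in> Lp_nonneg q Q" "Lp_norm q Q (\<lambda>z. r * \<mu> (\<Phi> z)) \<le> ennreal M"
  proof -
    \<comment> \<open>Since \<open>r \<le> 1\<close> and \<open>q \<ge> n + 2\<close>, the factor
      \<open>r\<close> in front of the drift outweighs the loss from the change of
      variables.\<close>
    have k: "r powr q \<le> 1 powr q * Jac"
      unfolding Jac_powr using r q by (simp add: powr_mono')
    have q0: "0 < q" using q by simp
    show "(\<lambda>z. r * \<mu> (\<Phi> z)) \<in> Lp_nonneg q Q"
      using Lp_norm_compose_T(1)[OF Qm TQ \<mu>(1) q0 _ _ k] r unfolding T by simp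
    show "Lp_norm q Q (\<lambda>z. r * \<mu> (\<Phi> z)) \<le> ennreal M"
      using order_trans[OF Lp_norm_compose_T(2)[OF Qm TQ \<mu>(1) q0 _ _ k]] \<mu>(2) r unfolding T by simp
  qed
  moreover have "(\<lambda>z. r\<^sup>2 / a * f (\<Phi> z)) \<in> Lp_nonneg p Q"
    "Lp_norm p Q (\<lambda>z. r\<^sup>2 / a * f (\<Phi> z)) \<le> ennreal \<epsilon>1"
  proof -
    \<comment> \<open>The same comparison for the source, where the factor \<open>r^2\<close> calls
      for \<open>2 * p \<ge> n + 2\<close>; the remaining \<open>1 / a\<close> is compensated by the
      bound assumed on \<open>f\<close>.\<close>
    have "(r\<^sup>2) powr p = r powr (2 * p)" using r powr_powr[of r 2 p] by simp
    also have "\<dots> \<le> Jac" unfolding Jac_powr using r p by (simp add: powr_mono')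
    finally have "(r\<^sup>2) powr p * (1 / a) powr p \<le> Jac * (1 / a) powr p" by (intro mult_right_mono) auto
    then have k: "(r\<^sup>2 / a) powr p \<le> (1 / a) powr p * Jac"
      using a by (simp add: powr_divide mult.commute)
    have p0: "0 < p" "0 \<le> r\<^sup>2 / a" "0 \<le> 1 / a" using p a by auto
    show "(\<lambda>z. r\<^sup>2 / a * f (\<Phi> z)) \<in> Lp_nonneg p Q"
      using Lp_norm_compose_T(1)[OF Qm TQ f(1) p0 k] unfolding T .
    have "Lp_norm p Q (\<lambda>z. r\<^sup>2 / a * f (\<Phi> z)) \<le> ennreal (1 / a) * Lp_norm p Q f"
      using Lp_norm_compose_T(2)[OF Qm TQ f(1) p0 k] unfolding T .
    also have "\<dots> \<le> ennreal (1 / a) * ennreal (\<epsilon>1 * a)"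
      using f(2) unfolding a_def[symmetric] by (intro mult_left_mono) auto
    also have "\<dots> = ennreal \<epsilon>1" using a by (simp add: ennreal_mult'[symmetric])
    finally show "Lp_norm p Q (\<lambda>z. r\<^sup>2 / a * f (\<Phi> z)) \<le> ennreal \<epsilon>1" .
  qed
  moreover have nonneg: "\<forall>z\<in>Q. 0 \<le> w z"
  proof
    fix z :: "(real^'n) \<times> real" assume "z \<in> Q"
    then have "u (\<Phi> z) \<le> \<nu> * H" using \<Phi>Q upper[of "fst (\<Phi> z)" "snd (\<Phi> z)"] by simp
    then show "0 \<le> w z" using a by (simp add: w_def)
  qed
  \<comment> \<open>The witness is \<open>(0, 10)\<close>, which \<open>\<Phi>\<close> maps to
    \<open>(x0, t0)\<close>, where \<open>u\<close> is at least \<open>H\<close>.\<close>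
  moreover have "(INF z\<in>J2. w z) \<le> 1"
  proof (rule cINF_lower2)
    show "(0, 10) \<in> (J2 :: ((real^'n) \<times> real) set)" by (simp add: J2_def mem_cube)
    have "\<nu> * H - u (x0, t0) \<le> a" using large by (simp add: a_def algebra_simps)
    then show "w (0, 10) \<le> 1" using a by (simp add: w_def \<Phi>_def)
    have "(J2 :: ((real^'n) \<times> real) set) \<subseteq> Q"
      using cube_mono[of 1 10] by (auto simp: J2_def Q_def pcyl_def)
    then show "bdd_below (w ` J2)" using nonneg by (intro bdd_belowI[of _ 0]) auto
  qed
  ultimately have decay: "measure lebesgue {z\<in>J1. s \<le> w z} \<le> A0 * s powr (- \<beta>0)" if "0 < s" for s
    using dec that unfolding decay_constants_def by blast
  define s where "s = (\<nu> - 1/2) / (\<nu> - 1)"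
  have s: "0 < s" using \<nu> by (simp add: s_def)
  have sa: "s * a = (\<nu> - 1/2) * H" using \<nu> by (simp add: s_def a_def)
  have "s \<le> w z \<longleftrightarrow> u (\<Phi> z) \<le> H / 2" for z
  proof -
    have "s \<le> w z \<longleftrightarrow> s * a \<le> \<nu> * H - u (\<Phi> z)" using a by (simp add: w_def pos_le_divide_eq)
    then show ?thesis unfolding sa by (simp add: algebra_simps)
  qed
  then have A: "measure lebesgue {z\<in>J1. u (\<Phi> z) \<le> H / 2} \<le> measure lebesgue (J1 :: ((real^'n) \<times> real) set) / 2"
    using decay[OF s] \<nu>(2) unfolding s_def[symmetric] by simp
  have J1m: "(J1 :: ((real^'n) \<times> real) set) \<in> lmeasurable"
    unfolding J1_def by (rule lmeasurable_Times_cube)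
  have cu: "continuous_on Q u" using u by (simp add: Lp_visc_subsol_def Q_def)
  have "continuous_on J1 \<Phi>" unfolding \<Phi>_def by (intro continuous_intros)
  then have cu\<Phi>: "continuous_on J1 (\<lambda>z. u (\<Phi> z))"
    by (rule continuous_on_compose2[OF continuous_on_subset[OF cu J1Q]]) (use subJ in auto)
  let ?B = "{z\<in>J1. H / 2 < u (\<Phi> z)}"
  have Bm: "?B \<in> lmeasurable" by (rule lmeasurable_superlevel[OF cu\<Phi> J1m])
  have B: "?B = J1 - {z\<in>J1. u (\<Phi> z) \<le> H / 2}" by auto
  have "measure lebesgue ?B = measure lebesgue (J1 :: ((real^'n) \<times> real) set) - measure lebesgue {z\<in>J1. u (\<Phi> z) \<le> H / 2}"
    unfolding B
    by (rule measurable_measure_Diff[OF J1m fmeasurableD[OF lmeasurable_sublevel[OF cu\<Phi> J1m]]]) auto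
  then have "measure lebesgue (J1 :: ((real^'n) \<times> real) set) / 2 \<le> measure lebesgue ?B" using A by linarith
  then have "r ^ (CARD('n) + 2) * (measure lebesgue (J1 :: ((real^'n) \<times> real) set) / 2) \<le> Jac * measure lebesgue ?B"
    unfolding Jac using r by (intro mult_left_mono) auto
  also have "\<dots> = measure lebesgue (T ` ?B)"
    by (rule measure_image_T[OF fmeasurableD[OF Bm], symmetric])
  also have "\<dots> \<le> measure lebesgue {z\<in>J1. H / 2 < u z}"
    by (rule measure_mono_fmeasurable[OF _ sets_image_T[OF fmeasurableD[OF Bm]]
          lmeasurable_superlevel[OF continuous_on_subset[OF cu J1Q] J1m]])
      (use subJ in \<open>auto simp: T\<close>)
  finally show ?thesis .
qed

text \<open>The conditions on \<open>C\<close> have separate purposes: the second keeps the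
  normalised source below \<open>\<epsilon>1\<close> at every level, and the third makes Chebyshev's
  bound at level 0 at most half of what \<open>growth_step\<close> yields. The factor 80 in
  \<open>r0\<close> comes from the total drift: the sum of all \<open>10 * r0 * \<tau> ^ k\<close>
  is \<open>1/8\<close>.\<close>

lemma subsol_le_on_J3:
  fixes u \<mu> f :: "(real^'n) \<times> real \<Rightarrow> real"
  defines "m \<equiv> measure lebesgue (J1 :: ((real^'n) \<times> real) set)"
  assumes lam: "lam \<le> Lam" and p: "1 \<le> p" "real CARD('n) + 2 \<le> 2 * p" and q: "real CARD('n) + 2 \<le> q"
    and dec: "decay_constants TYPE('n) lam Lam p q M A0 \<beta>0 \<epsilon>1" and e0: "0 < \<epsilon>0"
    and \<nu>: "1 < \<nu>" "A0 * ((\<nu> - 1/2) / (\<nu> - 1)) powr (- \<beta>0) \<le> m / 2"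
    and \<tau>: "\<tau> = \<nu> powr (- \<epsilon>0 / (real CARD('n) + 2))" and r0: "r0 = (1 - \<tau>) / 80"
    and C: "0 < C" "1 \<le> \<epsilon>1 * (\<nu> - 1) * C" "(2 / C) powr \<epsilon>0 \<le> m * r0 ^ (CARD('n) + 2) / 4"
    and \<mu>: "\<mu> \<in> Lp_nonneg q Q" "Lp_norm q Q \<mu> \<le> ennreal M"
    and f: "f \<in> Lp_nonneg p Q" "Lp_norm p Q f \<le> ennreal S"
    and u: "Lp_visc_subsol p (cube 10) 10 (\<lambda>z \<xi> X. pucci_minus lam Lam X - \<mu> z * norm \<xi> - f z) u"
    and S: "0 < S" "Lp_norm \<epsilon>0 J1 (\<lambda>z. max (u z) 0) \<le> ennreal S"
    and z: "z \<in> J3"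
  shows "u z \<le> C * S"
proof (rule ccontr)
  assume "\<not> ?thesis"
  then have uz: "C * S < u z" by simp
  let ?d = "CARD('n) + 2"
  have m: "0 < m" unfolding m_def by (rule measure_J1_pos)
  have e1: "0 < \<epsilon>1" using dec by (simp add: decay_constants_def)
  have \<tau>01: "0 < \<tau>" "\<tau> < 1"
  proof -
    show "0 < \<tau>" unfolding \<tau> using \<nu> by simp
    have "\<nu> powr (- \<epsilon>0 / (real CARD('n) + 2)) < \<nu> powr 0"
      using \<nu> e0 by (intro powr_less_mono) (auto simp: divide_neg_pos add_pos_pos)
    then show "\<tau> < 1" unfolding \<tau> using \<nu> by simp
  qed
  \<comment> \<open>The exponent in \<open>\<tau>\<close> makes the volume of the cylinders shrink
    by \<open>\<nu> powr (- \<epsilon>0)\<close> per step, the rate of Chebyshev's bound in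
    \<open>small\<close>; so the comparison at level 0 persists at all levels.\<close>
  have \<tau>d: "\<tau> ^ ?d = \<nu> powr (- \<epsilon>0)"
  proof -
    have "\<tau> ^ ?d = \<tau> powr (real ?d)" using \<tau>01 by (simp only: powr_realpow)
    also have "\<dots> = \<nu> powr (- \<epsilon>0 / (real CARD('n) + 2) * real ?d)" unfolding \<tau> by (simp only: powr_powr)
    also have "- \<epsilon>0 / (real CARD('n) + 2) * real ?d = - \<epsilon>0" by (simp add: field_simps)
    finally show ?thesis .
  qed
  have r0': "0 < r0" "r0 \<le> 1 / 80" using \<tau>01 by (auto simp: r0)
  define rr where "rr k = r0 * \<tau> ^ k" for k
  define bb where "bb k = (\<Sum>j<k. 10 * rr j)" for k
  define H where "H k = C * S * \<nu> ^ k" for k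
  have rr: "0 < rr k" "rr k \<le> 1 / 80" for k
  proof -
    show "0 < rr k" using r0' \<tau>01 by (simp add: rr_def)
    have "\<tau> ^ k \<le> 1" using \<tau>01 by (intro power_le_one) auto
    then have "r0 * \<tau> ^ k \<le> r0 * 1" using r0' by (intro mult_left_mono) auto
    then show "rr k \<le> 1 / 80" using r0'(2) unfolding rr_def by linarith
  qed
  have bb: "0 \<le> bb k" "bb k \<le> 1 / 8" for k
  proof -
    show "0 \<le> bb k" unfolding bb_def using rr(1) by (intro sum_nonneg) (auto intro: less_imp_le)
    have "bb k = 10 * r0 * (\<Sum>j<k. \<tau> ^ j)" by (simp add: bb_def rr_def sum_distrib_left mult.assoc)
    also have "\<dots> = 10 * r0 * ((1 - \<tau> ^ k) / (1 - \<tau>))" using \<tau>01 by (simp add: sum_gp_strict)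
    also have "\<dots> = (1 - \<tau> ^ k) / 8" using \<tau>01 by (simp add: r0 field_simps)
    also have "\<dots> \<le> 1 / 8" using \<tau>01 by simp
    finally show "bb k \<le> 1 / 8" .
  qed
  have H: "0 < H k" "C * S \<le> H k" for k
  proof -
    show "0 < H k" using C S \<nu> by (simp add: H_def)
    have "1 \<le> \<nu> ^ k" using \<nu> by (intro one_le_power) auto
    then have "C * S * 1 \<le> C * S * \<nu> ^ k" using C S by (intro mult_left_mono) auto
    then show "C * S \<le> H k" by (simp add: H_def)
  qed
  have cu: "continuous_on Q u" using u by (simp add: Lp_visc_subsol_def Q_def)
  have J1Q: "(J1 :: ((real^'n) \<times> real) set) \<subseteq> Q"
    using cube_mono[of 1 10] by (auto simp: J1_def Q_def pcyl_def)
  have J1m: "(J1 :: ((real^'n) \<times> real) set) \<in> lmeasurable"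
    unfolding J1_def by (rule lmeasurable_Times_cube)
  have small: "measure lebesgue {z\<in>J1. H k / 2 < u z} \<le> m * rr k ^ ?d / 4" for k
  proof -
    have "measure lebesgue {z\<in>J1. H k / 2 < u z} \<le> (S / (H k / 2)) powr \<epsilon>0"
      using H[of k] S by (intro measure_superlevel_le_Lp_norm J1m e0 continuous_on_subset[OF cu J1Q]) auto
    also have "S / (H k / 2) = 2 / C * inverse (\<nu> ^ k)" using S C \<nu> by (simp add: H_def field_simps)
    also have "\<dots> powr \<epsilon>0 = (2 / C) powr \<epsilon>0 * (\<tau> ^ ?d) ^ k"
    proof -
      have "inverse (\<nu> ^ k) powr \<epsilon>0 = (\<nu> powr (- \<epsilon>0)) ^ k"
        using \<nu> by (simp add: powr_minus power_inverse inverse_powr powr_power mult.commute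
            powr_powr flip: powr_realpow)
      then show ?thesis unfolding \<tau>d using C(1) \<nu>(1) by (subst powr_mult) auto
    qed
    also have "\<dots> \<le> m * r0 ^ ?d / 4 * (\<tau> ^ ?d) ^ k"
      using C(3) \<tau>01 by (intro mult_right_mono) auto
    also have "\<dots> = m * rr k ^ ?d / 4"
      by (simp only: rr_def power_mult_distrib power_mult[symmetric] mult.commute[of k]) simp
    finally show ?thesis .
  qed
  have points: "\<exists>x t. (\<forall>i. \<bar>x $ i\<bar> \<le> 1/2 + bb k) \<and> 1/4 - bb k < t \<and> t \<le> 1/2 \<and> H k \<le> u (x, t)" for k
  proof (induction k)
    case 0
    show ?case using z uz
      by (intro exI[of _ "fst z"] exI[of _ "snd z"]) (auto simp: J3_def mem_cube bb_def H_def less_imp_le)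
  next
    case (Suc k)
    then obtain x0 t0 where x0: "\<And>i. \<bar>x0 $ i\<bar> \<le> 1/2 + bb k" and t0: "1/4 - bb k < t0" "t0 \<le> 1/2"
      and ux: "H k \<le> u (x0, t0)" by blast
    let ?r = "rr k"
    \<comment> \<open>The radii are below 1, so the drift in time is dominated by the drift in
      space, and \<open>bb\<close> controls both.\<close>
    have sq: "10 * ?r\<^sup>2 \<le> 10 * ?r"
    proof -
      have "?r * ?r \<le> ?r * 1" using rr[of k] by (intro mult_left_mono) auto
      then show ?thesis by (simp add: power2_eq_square)
    qed
    have "\<exists>x t. (\<forall>i. \<bar>x $ i - x0 $ i\<bar> < 10 * ?r) \<and> t0 - 10 * ?r\<^sup>2 < t \<and> t \<le> t0 \<and> \<nu> * H k < u (x, t)"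
    proof (rule ccontr)
      assume no: "\<not> ?thesis"
      have "?r ^ ?d * (m / 2) \<le> measure lebesgue {z\<in>J1. H k / 2 < u z}"
        unfolding m_def
      proof (rule growth_step[OF lam p q dec \<mu> f(1) _ u \<nu>(1) \<nu>(2)[unfolded m_def] H(1) rr(1) _ _ _ t0(2) ux])
        have "S * 1 \<le> S * (\<epsilon>1 * (\<nu> - 1) * C)" using C(2) S by (intro mult_left_mono) auto
        also have "\<dots> = \<epsilon>1 * (\<nu> - 1) * (C * S)" by simp
        also have "\<dots> \<le> \<epsilon>1 * (\<nu> - 1) * H k" using H(2)[of k] e1 \<nu> by (intro mult_left_mono) auto
        finally have "S \<le> \<epsilon>1 * ((\<nu> - 1) * H k)" by (simp add: mult.assoc)
        then show "Lp_norm p Q f \<le> ennreal (\<epsilon>1 * ((\<nu> - 1) * H k))"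
          using f(2) by (meson ennreal_leI order_trans)
        show "?r \<le> 1" using rr(2)[of k] by linarith
        show "\<bar>x0 $ i\<bar> + 10 * ?r \<le> 1" for i using x0[of i] bb(2)[of k] rr(2)[of k] by linarith
        show "10 * ?r\<^sup>2 < t0" using sq t0(1) bb(2)[of k] rr(2)[of k] by linarith
        show "u (x, t) \<le> \<nu> * H k"
          if "\<And>i. \<bar>x $ i - x0 $ i\<bar> < 10 * ?r" "t0 - 10 * ?r\<^sup>2 < t" "t \<le> t0" for x t
          using no that by (meson not_le)
      qed
      also note small[of k]
      finally have "?r ^ ?d * (m / 2) \<le> m * ?r ^ ?d / 4" .
      moreover have "0 < m * ?r ^ ?d" using m rr(1)[of k] by simp
      ultimately show False by (simp add: algebra_simps)
    qed
    then obtain x t where x: "\<And>i. \<bar>x $ i - x0 $ i\<bar> < 10 * ?r" and t: "t0 - 10 * ?r\<^sup>2 < t" "t \<le> t0"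
      and ux': "\<nu> * H k < u (x, t)" by blast
    have bS: "bb (Suc k) = bb k + 10 * ?r" by (simp add: bb_def)
    have "\<bar>x $ i\<bar> \<le> 1/2 + bb (Suc k)" for i using x[of i] x0[of i] bS by linarith
    moreover have "1/4 - bb (Suc k) < t" "t \<le> 1/2" using t t0 sq bS by linarith+
    moreover have "H (Suc k) \<le> u (x, t)" using ux' by (simp add: H_def mult_ac)
    ultimately show ?case by blast
  qed
  \<comment> \<open>\<open>J3\<close> enlarged by the largest possible drift:
    \<open>5/8 = 1/2 + 1/8\<close> and \<open>1/8 = 1/4 - 1/8\<close>.\<close>
  let ?K = "{x :: real^'n. \<forall>i. \<bar>x $ i\<bar> \<le> 5/8} \<times> {1/8 .. 1/2 :: real}"
  have "compact ?K"
  proof (intro compact_Times)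
    have "\<bar>y\<bar> \<le> 5/8 \<longleftrightarrow> - (5/8) \<le> y \<and> y \<le> 5/8" for y :: real by linarith
    then have "{x :: real^'n. \<forall>i. \<bar>x $ i\<bar> \<le> 5/8} = cbox (\<chi> i. - (5/8)) (\<chi> i. 5/8)"
      by (simp only: set_eq_iff mem_Collect_eq mem_box_cart vec_lambda_beta simp_thms)
    then show "compact {x :: real^'n. \<forall>i. \<bar>x $ i\<bar> \<le> 5/8}" by simp
  qed auto
  moreover have "?K \<subseteq> Q"
  proof
    fix w assume w: "w \<in> ?K"
    have "\<bar>fst w $ i\<bar> < 10" for i
    proof -
      have "\<bar>fst w $ i\<bar> \<le> 5/8" using w by (simp only: mem_Times_iff mem_Collect_eq)
      then show ?thesis by linarith
    qed
    then show "w \<in> Q" using w by (auto simp: Q_def pcyl_def mem_cube mem_Times_iff)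
  qed
  ultimately have "compact (u ` ?K)" by (intro compact_continuous_image continuous_on_subset[OF cu])
  then have "bdd_above (u ` ?K)" by (intro bounded_imp_bdd_above compact_imp_bounded)
  define B where "B = Sup (u ` ?K)"
  have B: "u w \<le> B" if "w \<in> ?K" for w
    unfolding B_def by (rule cSUP_upper[OF that \<open>bdd_above (u ` ?K)\<close>])
  have "H k \<le> B" for k
  proof -
    obtain x t where xt: "\<And>i. \<bar>x $ i\<bar> \<le> 1/2 + bb k" "1/4 - bb k < t" "t \<le> 1/2" "H k \<le> u (x, t)"
      using points[of k] by blast
    have "\<bar>x $ i\<bar> \<le> 5/8" for i using xt(1)[of i] bb(2)[of k] by linarith
    moreover have "1/8 \<le> t" using xt(2) bb(2)[of k] by linarith
    ultimately have "(x, t) \<in> ?K" using xt(3) by simp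
    then show ?thesis using B xt(4) by (meson order_trans)
  qed
  moreover obtain k where "B / (C * S) < \<nu> ^ k" using real_arch_pow[OF \<nu>(1)] by blast
  then have "B < H k" using C(1) S(1) by (simp add: H_def pos_divide_less_eq mult.commute)
  ultimately show False using not_le by blast
qed

theorem proposition4p5:
  fixes lam Lam p1 p q M A0 \<beta>0 \<epsilon>1 \<epsilon>0 :: real
  assumes "0 < lam" and "lam \<le> Lam"
    and "ABP_exponent TYPE('n::finite) lam Lam p1"
    and "real CARD('n) + 2 < q" and "p1 < p" and "p \<le> q"
    and "0 \<le> M"
    and "decay_constants TYPE('n) lam Lam p q M A0 \<beta>0 \<epsilon>1"
    and "0 < \<epsilon>0" and "\<epsilon>0 < \<beta>0"
  shows "\<exists>C3>0. \<forall>(\<mu> :: (real ^ 'n) \<times> real \<Rightarrow> real) f u.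
           \<mu> \<in> Lp_nonneg q Q \<and> Lp_norm q Q \<mu> = ennreal M \<and> f \<in> Lp_nonneg p Q \<and>
           Lp_visc_subsol p (cube 10) 10
             (\<lambda>z \<xi> X. pucci_minus lam Lam X - \<mu> z * norm \<xi> - f z) u \<longrightarrow>
           (SUP z\<in>J3. ereal (u z))
             \<le> enn2ereal (ennreal C3 * (Lp_norm \<epsilon>0 J1 (\<lambda>z. max (u z) 0) + Lp_norm p Q f))"
proof -
  define m where "m = measure lebesgue (J1 :: ((real^'n) \<times> real) set)"
  have m: "0 < m" unfolding m_def by (rule measure_J1_pos)
  have A0: "0 < A0" and b0: "0 < \<beta>0" and e1: "0 < \<epsilon>1"
    using assms(8) by (auto simp: decay_constants_def)
  have card: "1 \<le> real CARD('n)" using zero_less_card_finite[where 'a = 'n] by linarith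
  \<comment> \<open>From \<open>p > p1 \<ge> (n + 2) / 2\<close> and
    \<open>n \<ge> 1\<close>.\<close>
  have p: "1 \<le> p" "real CARD('n) + 2 \<le> 2 * p"
    using assms(3,5) card by (auto simp: ABP_exponent_def)
  \<comment> \<open>\<open>s\<close> is a level above which the decay estimate leaves at most half
    of \<open>J1\<close>. Then \<open>\<nu>\<close> is the solution of
    \<open>(\<nu> - 1/2) / (\<nu> - 1) = s\<close>, and \<open>s \<ge> 2\<close> keeps
    \<open>s - 1\<close> positive.\<close>
  define s where "s = max 2 ((2 * A0 / m) powr (1 / \<beta>0))"
  define \<nu> where "\<nu> = 1 + 1 / (2 * (s - 1))"
  have s: "2 \<le> s" by (simp add: s_def)
  have \<nu>1: "1 < \<nu>" using s by (simp add: \<nu>_def)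
  have \<nu>s: "(\<nu> - 1/2) / (\<nu> - 1) = s" using s by (simp add: \<nu>_def field_simps)
  have "2 * A0 / m = ((2 * A0 / m) powr (1 / \<beta>0)) powr \<beta>0" using A0 m b0 by (simp add: powr_powr)
  also have "\<dots> \<le> s powr \<beta>0" using b0 by (intro powr_mono2) (auto simp: s_def)
  finally have "2 * A0 / m \<le> s powr \<beta>0" .
  then have \<nu>2: "A0 * ((\<nu> - 1/2) / (\<nu> - 1)) powr (- \<beta>0) \<le> m / 2"
    unfolding \<nu>s using s m by (simp add: powr_minus field_simps)
  define \<tau> where "\<tau> = \<nu> powr (- \<epsilon>0 / (real CARD('n) + 2))"
  define r0 where "r0 = (1 - \<tau>) / 80"
  have "\<nu> powr (- \<epsilon>0 / (real CARD('n) + 2)) < \<nu> powr 0"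
    using \<nu>1 assms(9) by (intro powr_less_mono) (auto simp: divide_neg_pos add_pos_pos)
  then have r0: "0 < r0" using \<nu>1 by (simp add: r0_def \<tau>_def)
  define c where "c = m * r0 ^ (CARD('n) + 2) / 4"
  have c: "0 < c" using m r0 by (simp add: c_def)
  \<comment> \<open>The first entry gives \<open>(2 / C) powr \<epsilon>0 \<le> c\<close>, the
    second takes care of the source. Both are fixed before \<open>\<mu>\<close>, \<open>f\<close>
    and \<open>u\<close> are chosen.\<close>
  define C where "C = max (2 / c powr (1 / \<epsilon>0)) (1 / (\<epsilon>1 * (\<nu> - 1)))"
  have C0: "0 < C" using c by (simp add: C_def less_max_iff_disj)
  have "1 / (\<epsilon>1 * (\<nu> - 1)) \<le> C" by (simp add: C_def)
  then have C1: "1 \<le> \<epsilon>1 * (\<nu> - 1) * C" using e1 \<nu>1 by (simp add: field_simps)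
  have C2: "(2 / C) powr \<epsilon>0 \<le> m * r0 ^ (CARD('n) + 2) / 4"
  proof -
    have "2 / c powr (1 / \<epsilon>0) \<le> C" by (simp add: C_def)
    then have "2 / C \<le> c powr (1 / \<epsilon>0)" using C0 c by (simp add: field_simps)
    then have "(2 / C) powr \<epsilon>0 \<le> (c powr (1 / \<epsilon>0)) powr \<epsilon>0"
      using C0 assms(9) by (intro powr_mono2) auto
    also have "\<dots> = c" using c assms(9) by (simp add: powr_powr)
    finally show ?thesis unfolding c_def .
  qed
  show ?thesis
  proof (intro exI[of _ C] conjI allI impI C0)
    fix \<mu> f u :: "(real ^ 'n) \<times> real \<Rightarrow> real"
    assume hyp: "\<mu> \<in> Lp_nonneg q Q \<and> Lp_norm q Q \<mu> = ennreal M \<and> f \<in> Lp_nonneg p Q \<and>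
      Lp_visc_subsol p (cube 10) 10 (\<lambda>z \<xi> X. pucci_minus lam Lam X - \<mu> z * norm \<xi> - f z) u"
    let ?N = "Lp_norm \<epsilon>0 J1 (\<lambda>z. max (u z) 0)" and ?F = "Lp_norm p Q f"
    show "(SUP z\<in>J3. ereal (u z)) \<le> enn2ereal (ennreal C * (?N + ?F))"
    proof (cases "?N + ?F = \<infinity>")
      case True
      show ?thesis unfolding True using C0 by (simp add: ennreal_mult_top)
    next
      case False
      define S where "S = enn2real (?N + ?F)"
      have S: "?N + ?F = ennreal S" "0 \<le> S" using False by (auto simp: S_def less_top)
      \<comment> \<open>\<open>S\<close> may vanish, whereas the iteration starts from a positive
        level; hence the passage through \<open>S + \<delta>\<close>.\<close>
      have bound: "u z \<le> C * (S + \<delta>)" if "0 < \<delta>" "z \<in> J3" for \<delta> z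
      proof (rule subsol_le_on_J3[OF assms(2) p _ assms(8,9) \<nu>1 \<nu>2[unfolded m_def] \<tau>_def r0_def C0 C1
            C2[unfolded m_def]])
        have le: "?N + ?F \<le> ennreal (S + \<delta>)" unfolding S using that by (intro ennreal_leI) auto
        show "?N \<le> ennreal (S + \<delta>)" using le by (rule order_trans[rotated]) simp
        show "?F \<le> ennreal (S + \<delta>)" using le by (rule order_trans[rotated]) simp
      qed (use hyp that S assms(4) in auto)
      have "u z \<le> C * S" if "z \<in> J3" for z
      proof (rule field_le_epsilon)
        fix e :: real assume "0 < e"
        then show "u z \<le> C * S + e"
          using bound[of "e / C" z] that C0 by (simp add: distrib_left)
      qed
      then have "(SUP z\<in>J3. ereal (u z)) \<le> ereal (C * S)" by (intro SUP_least) simp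
      also have "\<dots> = enn2ereal (ennreal C * (?N + ?F))"
        unfolding S using C0 S(2) by (simp add: ennreal_mult[symmetric] enn2ereal_ennreal)
      finally show ?thesis .
    qed
  qed
qed

end
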